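(* For the groups below, with the standard two-element generating sets, let $\alpha$ denote the cogrowth (exponential growth rate of freely reduced words representing the identity) and $\rho$ the exponential growth rate of all words representing the identity. The following lower bounds hold for $\alpha$: $$\alpha(BS(2,2)) \geq 2.5904,\quad \alpha(BS(2,3)) \geq 2.42579,\quad \alpha(BS(3,5)) \geq 2.06357,\quad \alpha(F) \geq 2.17329,$$ where $F$ is Thompson's group. Consequently the following lower bounds hold for $\rho$: $$\rho(BS(2,2)) \geq 3.748522,\quad \rho(BS(2,3)) \geq 3.66250,\quad \rho(BS(3,5)) \geq 3.51736,\quad \rho(F) \geq 3.55368.$$
   Context: Let $G$ be a group generated by two elements $a,b$. Consider words in the four formal letters $a,a^{-1},b,b^{-1}$ (equivalently, paths starting at the identity in the Cayley graph of $G$, in which generators and their inverses label distinct edges). Let $r_n$ be the number of words of length $n$ in these four letters that represent the identity of $G$, and let $p_n$ be the number of such words which are freely reduced (contain no subword $ss^{-1}$ for a letter $s$, where $(s^{-1})^{-1}=s$). Define $$\rho = \rho(G)=\limsup_{n\to\infty} r_n^{1/n},\qquad \alpha=\alpha(G)=\limsup_{n\to\infty} p_n^{1/n}.$$ The Baumslag–Solitar group is $BS(p,q)=\langle a,b \mid a b^{p} a^{-1} = b^{q}\rangle$ with generating set $\{a,b\}$. Thompson's group is $F=\langle a,b \mid [ab^{-1},a^{-1}ba],\ [ab^{-1},a^{-2}ba^{2}]\rangle$ with generating set $\{a,b\}$, where $[x,y]=xyx^{-1}y^{-1}$. *)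

theory Defs
  imports Complex_Main "HOL-Library.Extended_Real" "HOL-Algebra.Generated_Groups"
begin

datatype letter = LA | LA_inv | LB | LB_inv

fun letter_inv :: "letter \<Rightarrow> letter" where
  "letter_inv LA = LA_inv"
| "letter_inv LA_inv = LA"
| "letter_inv LB = LB_inv"
| "letter_inv LB_inv = LB"

type_synonym word = "letter list"

definition word_inv :: "word \<Rightarrow> word" where
  "word_inv w = rev (map letter_inv w)"

definition word_comm :: "word \<Rightarrow> word \<Rightarrow> word" where
  "word_comm x y = x @ y @ word_inv x @ word_inv y"

definition freely_reduced :: "word \<Rightarrow> bool" where
  "freely_reduced w \<longleftrightarrow> \<not> (\<exists>u s v. w = u @ [s, letter_inv s] @ v)"

text \<open>Evaluation of letters and words in a group \<open>G\<close>, at two elements \<open>x\<close>, \<open>y\<close>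
  substituted for the letters \<open>LA\<close>, \<open>LB\<close>.\<close>

fun letter_val :: "('g, 'm) monoid_scheme \<Rightarrow> 'g \<Rightarrow> 'g \<Rightarrow> letter \<Rightarrow> 'g" where
  "letter_val G x y LA = x"
| "letter_val G x y LA_inv = inv\<^bsub>G\<^esub> x"
| "letter_val G x y LB = y"
| "letter_val G x y LB_inv = inv\<^bsub>G\<^esub> y"

definition word_val :: "('g, 'm) monoid_scheme \<Rightarrow> 'g \<Rightarrow> 'g \<Rightarrow> word \<Rightarrow> 'g" where
  "word_val G x y w = foldr (\<lambda>s g. letter_val G x y s \<otimes>\<^bsub>G\<^esub> g) w \<one>\<^bsub>G\<^esub>"

definition num_trivial :: "('g, 'm) monoid_scheme \<Rightarrow> 'g \<Rightarrow> 'g \<Rightarrow> nat \<Rightarrow> nat" where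
  "num_trivial G x y n = card {w. length w = n \<and> word_val G x y w = \<one>\<^bsub>G\<^esub>}"

definition num_trivial_reduced :: "('g, 'm) monoid_scheme \<Rightarrow> 'g \<Rightarrow> 'g \<Rightarrow> nat \<Rightarrow> nat" where
  "num_trivial_reduced G x y n =
     card {w. length w = n \<and> freely_reduced w \<and> word_val G x y w = \<one>\<^bsub>G\<^esub>}"

definition rho :: "('g, 'm) monoid_scheme \<Rightarrow> 'g \<Rightarrow> 'g \<Rightarrow> ereal" where
  "rho G x y = limsup (\<lambda>n. ereal (root n (real (num_trivial G x y n))))"

definition alpha :: "('g, 'm) monoid_scheme \<Rightarrow> 'g \<Rightarrow> 'g \<Rightarrow> ereal" where
  "alpha G x y = limsup (\<lambda>n. ereal (root n (real (num_trivial_reduced G x y n))))"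

text \<open>The group \<open>\<langle>a, b | R\<rangle>\<close>: words modulo the least congruence that
  cancels \<open>s s\<inverse>\<close> and every relator in \<open>R\<close>.\<close>

inductive pres_eq :: "word set \<Rightarrow> word \<Rightarrow> word \<Rightarrow> bool" for R :: "word set" where
  pres_refl: "pres_eq R u u"
| pres_sym: "pres_eq R u v \<Longrightarrow> pres_eq R v u"
| pres_trans: "pres_eq R u v \<Longrightarrow> pres_eq R v w \<Longrightarrow> pres_eq R u w"
| pres_cancel: "pres_eq R (u @ [s, letter_inv s] @ v) (u @ v)"
| pres_relator: "r \<in> R \<Longrightarrow> pres_eq R (u @ r @ v) (u @ v)"

definition pres_class :: "word set \<Rightarrow> word \<Rightarrow> word set" where
  "pres_class R w = {v. pres_eq R w v}"

definition presented_group :: "word set \<Rightarrow> word set monoid" where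
  "presented_group R =
     \<lparr>carrier = range (pres_class R),
      monoid.mult = (\<lambda>X Y. \<Union>u\<in>X. \<Union>v\<in>Y. pres_class R (u @ v)),
      one = pres_class R []\<rparr>"

definition gen_a :: "word set \<Rightarrow> word set" where
  "gen_a R = pres_class R [LA]"

definition gen_b :: "word set \<Rightarrow> word set" where
  "gen_b R = pres_class R [LB]"

definition BS_relators :: "nat \<Rightarrow> nat \<Rightarrow> word set" where
  "BS_relators p q = {[LA] @ replicate p LB @ [LA_inv] @ word_inv (replicate q LB)}"

definition BS :: "nat \<Rightarrow> nat \<Rightarrow> word set monoid" where
  "BS p q = presented_group (BS_relators p q)"

definition thompson_relators :: "word set" where
  "thompson_relators =
     {word_comm [LA, LB_inv] [LA_inv, LB, LA],
      word_comm [LA, LB_inv] [LA_inv, LA_inv, LB, LA, LA]}"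

definition thompson_F :: "word set monoid" where
  "thompson_F = presented_group thompson_relators"

lemma letter_inv_invol [simp]: "letter_inv (letter_inv s) = s"
  by (cases s) auto

instance letter :: finite
proof
  have "(UNIV :: letter set) \<subseteq> {LA, LA_inv, LB, LB_inv}"
    using letter.exhaust by blast
  then show "finite (UNIV :: letter set)"
    by (rule finite_subset) simp
qed

lemma finite_words_of_length: "finite {w :: word. length w = n \<and> P w}"
  using finite_lists_length_eq[of "UNIV :: letter set" n]
  by (rule rev_finite_subset) auto

lemma pres_class_eq_iff: "pres_class R u = pres_class R v \<longleftrightarrow> pres_eq R u v"
  unfolding pres_class_def by (auto intro: pres_refl pres_sym pres_trans)

lemma pres_eq_context: "pres_eq R u v \<Longrightarrow> pres_eq R (x @ u @ y) (x @ v @ y)"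
proof (induction rule: pres_eq.induct)
  case (pres_cancel u s v)
  show ?case using pres_eq.pres_cancel[of R "x @ u" s "v @ y"] by simp
next
  case (pres_relator r u v)
  then show ?case using pres_eq.pres_relator[of r R "x @ u" "v @ y"] by simp
qed (auto intro: pres_eq.pres_refl pres_eq.pres_sym pres_eq.pres_trans)

lemma pres_eq_append: "pres_eq R u u' \<Longrightarrow> pres_eq R v v' \<Longrightarrow> pres_eq R (u @ v) (u' @ v')"
  using pres_eq_context[of R u u' "[]" v] pres_eq_context[of R v v' u' "[]"]
  by (auto intro: pres_trans)

lemma presented_group_mult:
  "pres_class R u \<otimes>\<^bsub>presented_group R\<^esub> pres_class R v = pres_class R (u @ v)"
proof -
  have "pres_class R (u' @ v') = pres_class R (u @ v)"
    if "u' \<in> pres_class R u" "v' \<in> pres_class R v" for u' v'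
    using that pres_eq_append[of R u u' v v']
    by (auto simp: pres_class_eq_iff) (auto simp: pres_class_def intro: pres_sym)
  moreover have "u \<in> pres_class R u" "v \<in> pres_class R v"
    by (auto simp: pres_class_def intro: pres_refl)
  ultimately have "(\<Union>u'\<in>pres_class R u. \<Union>v'\<in>pres_class R v. pres_class R (u' @ v'))
      = pres_class R (u @ v)"
    by blast
  then show ?thesis by (simp add: presented_group_def)
qed

lemma presented_group_carrier: "carrier (presented_group R) = range (pres_class R)"
  by (simp add: presented_group_def)

lemma presented_group_one: "\<one>\<^bsub>presented_group R\<^esub> = pres_class R []"
  by (simp add: presented_group_def)

lemma word_inv_append: "word_inv (u @ v) = word_inv v @ word_inv u"
  by (simp add: word_inv_def)

lemma word_inv_invol [simp]: "word_inv (word_inv w) = w"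
  by (simp add: word_inv_def rev_map o_def)

lemma pres_eq_right_inv: "pres_eq R (w @ word_inv w) []"
proof (induction w)
  case Nil
  then show ?case by (simp add: word_inv_def pres_refl)
next
  case (Cons s w)
  have "pres_eq R ([s] @ (w @ word_inv w) @ [letter_inv s]) ([s] @ [] @ [letter_inv s])"
    by (rule pres_eq_context[OF Cons.IH])
  moreover have "pres_eq R [s, letter_inv s] []"
    using pres_cancel[of R "[]" s "[]"] by simp
  ultimately show ?case by (auto simp: word_inv_def intro: pres_trans)
qed

lemma pres_eq_left_inv: "pres_eq R (word_inv w @ w) []"
  using pres_eq_right_inv[of R "word_inv w"] by simp

lemma pres_class_in_carrier: "pres_class R u \<in> carrier (presented_group R)"
  by (simp add: presented_group_carrier)

lemma group_presented_group: "group (presented_group R)"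
proof (rule groupI)
  let ?G = "presented_group R"
  show "\<one>\<^bsub>?G\<^esub> \<in> carrier ?G"
    by (simp add: presented_group_one pres_class_in_carrier)
  fix X assume "X \<in> carrier ?G"
  then obtain u where X: "X = pres_class R u"
    unfolding presented_group_carrier by (rule rangeE)
  show "\<one>\<^bsub>?G\<^esub> \<otimes>\<^bsub>?G\<^esub> X = X"
    by (simp add: X presented_group_one presented_group_mult)
  show "\<exists>Y\<in>carrier ?G. Y \<otimes>\<^bsub>?G\<^esub> X = \<one>\<^bsub>?G\<^esub>"
  proof (rule bexI)
    show "pres_class R (word_inv u) \<otimes>\<^bsub>?G\<^esub> X = \<one>\<^bsub>?G\<^esub>"
      by (simp add: X presented_group_mult presented_group_one pres_class_eq_iff pres_eq_left_inv)
  qed (rule pres_class_in_carrier)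
  fix Y assume "Y \<in> carrier ?G"
  then obtain v where Y: "Y = pres_class R v"
    unfolding presented_group_carrier by (rule rangeE)
  show "X \<otimes>\<^bsub>?G\<^esub> Y \<in> carrier ?G"
    by (simp add: X Y presented_group_mult pres_class_in_carrier)
  fix Z assume "Z \<in> carrier ?G"
  then obtain w where Z: "Z = pres_class R w"
    unfolding presented_group_carrier by (rule rangeE)
  show "X \<otimes>\<^bsub>?G\<^esub> Y \<otimes>\<^bsub>?G\<^esub> Z = X \<otimes>\<^bsub>?G\<^esub> (Y \<otimes>\<^bsub>?G\<^esub> Z)"
    by (simp add: X Y Z presented_group_mult)
qed

lemma presented_group_inv:
  "inv\<^bsub>presented_group R\<^esub> (pres_class R u) = pres_class R (word_inv u)"
  by (rule group.inv_equality[OF group_presented_group])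
     (simp_all add: presented_group_mult presented_group_one pres_class_in_carrier
        pres_class_eq_iff pres_eq_left_inv)

lemma word_val_presented_group:
  "word_val (presented_group R) (gen_a R) (gen_b R) w = pres_class R w"
proof (induction w)
  case Nil
  then show ?case by (simp add: word_val_def presented_group_one)
next
  case (Cons s w)
  have "letter_val (presented_group R) (gen_a R) (gen_b R) s = pres_class R [s]"
    by (cases s) (auto simp: gen_a_def gen_b_def presented_group_inv word_inv_def)
  with Cons show ?case by (simp add: word_val_def presented_group_mult)
qed

lemma word_val_eq_one_iff:
  "word_val (presented_group R) (gen_a R) (gen_b R) w = \<one>\<^bsub>presented_group R\<^esub> \<longleftrightarrow> pres_eq R w []"
  by (simp add: word_val_presented_group presented_group_one pres_class_eq_iff)

lemma generate_presented_group:
  "generate (presented_group R) {gen_a R, gen_b R} = carrier (presented_group R)"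
proof
  interpret group "presented_group R" by (rule group_presented_group)
  show "generate (presented_group R) {gen_a R, gen_b R} \<subseteq> carrier (presented_group R)"
    by (rule generate_incl) (simp add: gen_a_def gen_b_def pres_class_in_carrier)
  have "word_val (presented_group R) (gen_a R) (gen_b R) w
          \<in> generate (presented_group R) {gen_a R, gen_b R}" for w
  proof (induction w)
    case Nil
    then show ?case by (simp add: word_val_def generate.one)
  next
    case (Cons s w)
    have "letter_val (presented_group R) (gen_a R) (gen_b R) s
            \<in> generate (presented_group R) {gen_a R, gen_b R}"
      by (cases s) (auto intro: generate.incl generate.inv)
    with Cons show ?case by (simp add: word_val_def generate.eng)
  qed
  then show "carrier (presented_group R) \<subseteq> generate (presented_group R) {gen_a R, gen_b R}"
    by (auto simp: presented_group_carrier word_val_presented_group)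
qed

text \<open>The universal property: a word is trivial in \<open>\<langle>a, b | R\<rangle>\<close> only if it is
  trivial in every group with two marked elements satisfying the relators.\<close>

lemma (in group) letter_val_closed:
  "x \<in> carrier G \<Longrightarrow> y \<in> carrier G \<Longrightarrow> letter_val G x y s \<in> carrier G"
  by (cases s) auto

lemma (in group) word_val_closed:
  "x \<in> carrier G \<Longrightarrow> y \<in> carrier G \<Longrightarrow> word_val G x y w \<in> carrier G"
  by (induction w) (auto simp: word_val_def letter_val_closed)

lemma (in group) word_val_append:
  assumes "x \<in> carrier G" "y \<in> carrier G"
  shows "word_val G x y (u @ v) = word_val G x y u \<otimes> word_val G x y v"
proof (induction u)
  case Nil
  then show ?case using word_val_closed[OF assms, of v] by (simp add: word_val_def)
next
  case (Cons s u)
  have "word_val G x y (t # z) = letter_val G x y t \<otimes> word_val G x y z" for t z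
    by (simp add: word_val_def)
  with Cons show ?case by (simp add: m_assoc letter_val_closed word_val_closed assms)
qed

lemma (in group) word_val_respects_pres_eq:
  assumes "x \<in> carrier G" "y \<in> carrier G" and R: "\<And>r. r \<in> R \<Longrightarrow> word_val G x y r = \<one>"
    and "pres_eq R u v"
  shows "word_val G x y u = word_val G x y v"
  using assms(4)
proof (induction rule: pres_eq.induct)
  case (pres_cancel u s v)
  have "word_val G x y [s, letter_inv s] = \<one>"
    using assms(1,2) by (cases s) (auto simp: word_val_def)
  then show ?case
    by (simp only: word_val_append[OF assms(1,2)] l_one word_val_closed[OF assms(1,2)])
next
  case (pres_relator r u v)
  then show ?case
    by (simp only: word_val_append[OF assms(1,2)] l_one word_val_closed[OF assms(1,2)] R)
qed auto

end

theory Submission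
  imports Defs
begin

text \<open>For an amenable subgroup \<open>H\<close> the coset graph of \<open>H\<close> has the same spectral radius as the Cayley
  graph, but a finite piece of it sees many more relations than a piece of the same size of the Cayley
  graph. For \<open>H\<close> finitely generated abelian this is elementary: a finite automaton whose states are
  cosets reads at least \<open>c lam ^ n\<close> words of length \<open>n\<close>, where \<open>lam\<close> is certified by a positive function
  \<open>f\<close> with \<open>A f \<ge> lam f\<close>, and these words take only polynomially many values, so the pigeonhole principle
  yields about \<open>lam ^ (2 n)\<close> trivial words of length \<open>2 n\<close>. Free trees hung on the missing edges of the
  piece improve the bound, and turn the condition at a vertex with \<open>d\<close> edges into
  \<open>A f \<ge> (al + (d - 1) / al) f\<close> for the bound \<open>lam = al + 3 / al\<close>. The subgroup is \<open>\<langle>b\<rangle>\<close> for the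
  Baumslag-Solitar groups, and for Thompson's group it is \<open>\<int>\<^sup>4\<close>, generated by copies of \<open>x\<^sub>0\<close> on the four
  dyadic quarters of the unit interval. The functions \<open>f\<close> are tables of about 1000 to 2500 integers.
  Finally, a bound for \<open>rho\<close> is turned into one for \<open>alpha\<close> by comparing the number of trivial words
  with the superharmonic function \<open>al ^ - |u|\<close> on the free group.\<close>

section \<open>Free reduction\<close>

text \<open>The automata count words, not cosets: determinism makes the accepted words distinct, and
  the end state of a run fixes its value up to a product of elements of \<open>E\<close>. Hence
  distinct states may represent the same coset, and trees can be hung on without asking where their
  branches lead in the coset graph. Normal forms and spanning trees only name the states; what has
  to be proved is one equation in \<open>G\<close> per edge. For the Baumslag-Solitar groups it
  follows uniformly from the defining relation. For Thompson's group every edge outside the spanning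
  tree is a relation of its own; a rewriting procedure for the infinite presentation, itself derived
  from the two relators, settles it by evaluation. The threshold \<open>3 \<le> al\<^sup>2\<close>
  plays two roles: \<open>al + 3 / al\<close> increases beyond \<open>sqrt 3\<close>, so a bound for
  \<open>rho\<close> can be inverted, and truncated trees stay subharmonic. Truncation keeps the
  automaton finite at a cost that tends to 0. The values \<open>57 / 22\<close>,
  \<open>131 / 54\<close>, \<open>97 / 47\<close>, \<open>50 / 23\<close> of \<open>al\<close> lie
  just above the claimed bounds for \<open>alpha\<close> and have small denominators, so that the
  tables can be checked with small integers.\<close>

fun push :: "letter \<Rightarrow> word \<Rightarrow> word" where
  "push l [] = [l]"
| "push l (m # u) = (if m = letter_inv l then u else l # m # u)"

definition free_red :: "word \<Rightarrow> word" where
  "free_red w = foldr push w []"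

lemma letter_inv_neq [simp]: "letter_inv l \<noteq> l" "l \<noteq> letter_inv l"
  by (cases l; simp)+

lemma freely_reduced_Nil [simp]: "freely_reduced []"
  by (simp add: freely_reduced_def)

lemma freely_reduced_Cons:
  "freely_reduced (l # u) \<longleftrightarrow> freely_reduced u \<and> (\<forall>v. u \<noteq> letter_inv l # v)"
proof
  assume *: "freely_reduced (l # u)"
  have "freely_reduced u"
    unfolding freely_reduced_def
  proof
    assume "\<exists>x s v. u = x @ [s, letter_inv s] @ v"
    then obtain x s v where "l # u = (l # x) @ [s, letter_inv s] @ v" by auto
    with * show False unfolding freely_reduced_def by blast
  qed
  moreover have "u \<noteq> letter_inv l # v" for v
  proof
    assume "u = letter_inv l # v"
    then have "l # u = [] @ [l, letter_inv l] @ v" by simp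
    with * show False unfolding freely_reduced_def by blast
  qed
  ultimately show "freely_reduced u \<and> (\<forall>v. u \<noteq> letter_inv l # v)" by blast
next
  assume *: "freely_reduced u \<and> (\<forall>v. u \<noteq> letter_inv l # v)"
  show "freely_reduced (l # u)"
    unfolding freely_reduced_def
  proof
    assume "\<exists>x s v. l # u = x @ [s, letter_inv s] @ v"
    then obtain x s v where "l # u = x @ [s, letter_inv s] @ v" by blast
    with * show False unfolding freely_reduced_def by (cases x) auto
  qed
qed

lemma freely_reduced_push: "freely_reduced u \<Longrightarrow> freely_reduced (push l u)"
  by (cases u) (auto simp: freely_reduced_Cons)

lemma push_push_inv: "freely_reduced u \<Longrightarrow> push (letter_inv l) (push l u) = u"
proof (cases u)
  case (Cons m v)
  assume "freely_reduced u"
  with Cons show ?thesis by (cases v) (auto simp: freely_reduced_Cons)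
qed simp

lemma free_red_simps [simp]: "free_red [] = []" "free_red (l # w) = push l (free_red w)"
  by (simp_all add: free_red_def)

lemma freely_reduced_free_red: "freely_reduced (free_red w)"
  by (induction w) (auto intro: freely_reduced_push)

lemma length_push_le: "length (push l u) \<le> Suc (length u)"
  by (cases u) auto

lemma length_free_red_le: "length (free_red w) \<le> length w"
proof (induction w)
  case (Cons l w)
  then show ?case using length_push_le[of l "free_red w"] by simp
qed simp

lemma (in group) word_val_Cons: "word_val G x y (l # w) = letter_val G x y l \<otimes> word_val G x y w"
  by (simp add: word_val_def)

lemma (in group) word_val_Nil [simp]: "word_val G x y [] = \<one>"
  by (simp add: word_val_def)

lemma (in group) letter_val_inv:
  "x \<in> carrier G \<Longrightarrow> y \<in> carrier G \<Longrightarrow> letter_val G x y (letter_inv l) = inv (letter_val G x y l)"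
  by (cases l) auto

lemma (in group) word_val_push:
  assumes "x \<in> carrier G" "y \<in> carrier G"
  shows "word_val G x y (push l u) = letter_val G x y l \<otimes> word_val G x y u"
proof (cases "\<exists>v. u = letter_inv l # v")
  case True
  then show ?thesis
    using assms by (auto simp: word_val_Cons letter_val_inv letter_val_closed word_val_closed m_assoc[symmetric])
next
  case False
  then have "push l u = l # u" by (cases u) auto
  then show ?thesis by (simp add: word_val_Cons)
qed

lemma (in group) word_val_free_red:
  assumes "x \<in> carrier G" "y \<in> carrier G"
  shows "word_val G x y (free_red w) = word_val G x y w"
  by (induction w) (simp_all add: word_val_push word_val_Cons assms)

lemma (in group) word_val_word_inv:
  assumes "x \<in> carrier G" "y \<in> carrier G"
  shows "word_val G x y (word_inv w) = inv (word_val G x y w)"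
proof (induction w)
  case (Cons l w)
  have "word_val G x y (word_inv (l # w)) = word_val G x y (word_inv w) \<otimes> letter_val G x y (letter_inv l)"
    using assms by (simp add: word_inv_def word_val_append word_val_Cons letter_val_closed)
  then show ?case
    using Cons assms
    by (simp add: word_val_Cons letter_val_inv inv_mult_group word_val_closed letter_val_closed)
qed (simp add: word_inv_def)

lemma finite_words [simp]: "finite {w :: word. length w = n \<and> P w}" "finite {w :: word. length w = n}"
  using finite_words_of_length[of n P] finite_words_of_length[of n "\<lambda>_. True"] by simp_all

lemma words_Suc: "{w :: word. length w = Suc n \<and> P w} = (\<Union>l. (#) l ` {w. length w = n \<and> P (l # w)})"
  by (auto simp: length_Suc_conv)

lemma UNIV_letter: "(UNIV :: letter set) = {LA, LA_inv, LB, LB_inv}"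
  using letter.exhaust by blast

lemma card_UNIV_letter: "card (UNIV :: letter set) = 4"
  by (simp add: UNIV_letter)

lemma sum_letters: "(\<Sum>l\<in>UNIV. h l) = h LA + h LA_inv + h LB + h LB_inv"
  for h :: "letter \<Rightarrow> 'a :: comm_monoid_add"
  by (simp add: UNIV_letter add.assoc)

lemma bij_letter_inv: "bij letter_inv"
  by (rule o_bij[of letter_inv]) auto

section \<open>Counting words with a given free reduction\<close>

definition red_count :: "nat \<Rightarrow> word \<Rightarrow> nat" where
  "red_count n u = card {w. length w = n \<and> free_red w = u}"

lemma red_count_Suc:
  assumes "freely_reduced u"
  shows "red_count (Suc n) u = (\<Sum>l\<in>UNIV. red_count n (push l u))"
proof -
  \<comment> \<open>On reduced words \<open>push l\<close> is inverted by
    \<open>push (letter_inv l)\<close>. So a word with first letter \<open>l\<close> reduces to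
    \<open>u\<close> exactly when its tail reduces to the neighbour of \<open>u\<close> in the
    direction \<open>letter_inv l\<close> of the 4-regular tree.\<close>
  have eq: "push l (free_red w) = u \<longleftrightarrow> free_red w = push (letter_inv l) u" for l w
    using push_push_inv[OF freely_reduced_free_red, of l w] push_push_inv[OF assms, of "letter_inv l"]
    by auto
  have "red_count (Suc n) u
      = card (\<Union>l. (#) l ` {w. length w = n \<and> free_red w = push (letter_inv l) u})"
    unfolding red_count_def words_Suc by (simp add: eq)
  also have "\<dots> = (\<Sum>l\<in>UNIV. red_count n (push (letter_inv l) u))"
    unfolding red_count_def
    by (subst card_UN_disjoint) (auto simp: card_image)
  also have "\<dots> = (\<Sum>l\<in>UNIV. red_count n (push l u))"
    by (rule sum.reindex_bij_betw[OF bij_letter_inv])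
  finally show ?thesis .
qed

text \<open>A nonempty word has one shorter neighbour, by cancelling its head, and three longer
  ones, which gives equality; the empty word has four longer neighbours, and there
  \<open>t \<le> 1\<close> is used.\<close>

lemma sum_push_weight_le:
  fixes t :: real
  assumes "0 < t" "t \<le> 1"
  shows "(\<Sum>l\<in>UNIV. t ^ length (push l u)) \<le> (1 / t + 3 * t) * t ^ length u"
proof (cases u)
  case Nil
  have "t * t \<le> 1" using assms by (simp add: mult_le_one)
  then have "t \<le> 1 / t" using assms by (simp add: field_simps)
  with Nil show ?thesis by (simp add: card_UNIV_letter)
next
  case (Cons m v)
  have "t ^ length v = (1 / t) * (t * t ^ length v)" using assms by simp
  then have "t ^ length v + 3 * (t * (t * t ^ length v)) = (1 / t + 3 * t) * t ^ length u"
    by (simp add: Cons algebra_simps)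
  with Cons show ?thesis by (cases m) (simp_all add: sum_letters)
qed

text \<open>By \<open>red_count_Suc\<close>, \<open>red_count n\<close> arises from the indicator of
  the empty word by applying the adjacency operator of the tree \<open>n\<close> times. The
  indicator lies below \<open>t ^ length u\<close>, and superharmonicity propagates this
  bound.\<close>

lemma red_count_le:
  fixes t :: real
  assumes t: "0 < t" "t \<le> 1" and "freely_reduced u"
  shows "red_count n u \<le> (1 / t + 3 * t) ^ n * t ^ length u"
  using assms(3)
proof (induction n arbitrary: u)
  case 0
  have "{w. length w = 0 \<and> free_red w = u} = (if u = [] then {[]} else {})" by auto
  then have "red_count 0 u = (if u = [] then 1 else 0)"
    unfolding red_count_def by simp
  with t show ?case by (auto split: if_splits)
next
  case (Suc n)
  have l0: "0 \<le> 1 / t + 3 * t" using t by simp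
  have "real (red_count (Suc n) u) = (\<Sum>l\<in>UNIV. real (red_count n (push l u)))"
    by (simp add: red_count_Suc Suc.prems)
  also have "\<dots> \<le> (\<Sum>l\<in>UNIV. (1 / t + 3 * t) ^ n * t ^ length (push l u))"
    by (intro sum_mono Suc.IH freely_reduced_push Suc.prems)
  also have "\<dots> = (1 / t + 3 * t) ^ n * (\<Sum>l\<in>UNIV. t ^ length (push l u))"
    by (simp add: sum_distrib_left)
  also have "\<dots> \<le> (1 / t + 3 * t) ^ n * ((1 / t + 3 * t) * t ^ length u)"
    by (intro mult_left_mono sum_push_weight_le t zero_le_power l0)
  finally show ?case by (simp add: algebra_simps)
qed

section \<open>Comparison of \<open>rho\<close> and \<open>alpha\<close>\<close>

lemma (in group) num_trivial_le:
  fixes t :: real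
  assumes xy: "x \<in> carrier G" "y \<in> carrier G" and t: "0 < t" "t \<le> 1"
  shows "num_trivial G x y n \<le> (1 / t + 3 * t) ^ n * (\<Sum>k\<le>n. num_trivial_reduced G x y k * t ^ k)"
proof -
  let ?R = "\<lambda>k. {u. length u = k \<and> freely_reduced u \<and> word_val G x y u = \<one>}"
  \<comment> \<open>Free reduction preserves the value, so the trivial words can be sorted by the
    reduced trivial word that they reduce to.\<close>
  have "{w. length w = n \<and> word_val G x y w = \<one>}
      \<subseteq> (\<Union>k\<le>n. \<Union>u\<in>?R k. {w. length w = n \<and> free_red w = u})"
    using length_free_red_le by (auto simp: freely_reduced_free_red word_val_free_red xy)
  then have "num_trivial G x y n \<le> card (\<Union>k\<le>n. \<Union>u\<in>?R k. {w. length w = n \<and> free_red w = u})"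
    unfolding num_trivial_def by (intro card_mono) auto
  also have "\<dots> \<le> (\<Sum>k\<le>n. card (\<Union>u\<in>?R k. {w. length w = n \<and> free_red w = u}))"
    by (rule card_UN_le) simp
  also have "\<dots> \<le> (\<Sum>k\<le>n. \<Sum>u\<in>?R k. red_count n u)"
    unfolding red_count_def by (intro sum_mono card_UN_le) simp
  finally have "real (num_trivial G x y n) \<le> (\<Sum>k\<le>n. \<Sum>u\<in>?R k. real (red_count n u))"
    by (simp flip: of_nat_sum)
  also have "\<dots> \<le> (\<Sum>k\<le>n. \<Sum>u\<in>?R k. (1 / t + 3 * t) ^ n * t ^ k)"
    using red_count_le[OF t, of _ n] by (intro sum_mono) auto
  also have "\<dots> = (1 / t + 3 * t) ^ n * (\<Sum>k\<le>n. num_trivial_reduced G x y k * t ^ k)"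
    by (simp add: num_trivial_reduced_def sum_distrib_left algebra_simps)
  finally show ?thesis .
qed

text \<open>Any \<open>b\<close> strictly between \<open>alpha\<close> and \<open>s\<close>
  eventually bounds the number of reduced trivial words of length \<open>k\<close> by
  \<open>b ^ k\<close>. With \<open>t = 1 / s\<close> the sum in \<open>num_trivial_le\<close> then
  stays bounded, and a constant disappears under the n-th root.\<close>

lemma (in group) rho_le_of_alpha_less:
  assumes xy: "x \<in> carrier G" "y \<in> carrier G" and al: "alpha G x y < ereal s" and s: "1 \<le> s"
  shows "rho G x y \<le> ereal (s + 3 / s)"
proof -
  obtain b where b: "alpha G x y < ereal b" "b < s"
    using ereal_dense2[OF al] by auto
  define p where "p = num_trivial_reduced G x y"
  have "\<forall>\<^sub>F n in sequentially. ereal (root n (p n)) < ereal b"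
    using b(1) unfolding alpha_def p_def by (rule Limsup_lessD)
  then obtain N where N: "\<And>n. n \<ge> N \<Longrightarrow> root n (p n) < b"
    by (auto simp: eventually_sequentially)
  have b0: "0 < b"
    using le_less_trans[OF real_root_ge_zero N[OF order_refl]] by simp
  have pn: "real (p n) \<le> b ^ n" if "n \<ge> Suc N" for n
  proof -
    have n: "0 < n" using that by simp
    have "real (p n) = root n (p n) ^ n" using n by simp
    also have "\<dots> \<le> b ^ n" using N[of n] that by (intro power_mono) auto
    finally show ?thesis .
  qed
  define t where "t = 1 / s"
  have t: "0 < t" "t \<le> 1" using s by (auto simp: t_def)
  \<comment> \<open>The head up to \<open>N\<close>, where nothing is known about \<open>p\<close>,
    plus the geometric series that dominates the rest.\<close>
  define C where "C = (\<Sum>k\<le>N. p k * t ^ k) + 1 / (1 - b * t)"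
  have bt: "0 \<le> b * t" "b * t < 1" using b(2) b0 s by (auto simp: t_def)
  have bound: "(\<Sum>k\<le>n. p k * t ^ k) \<le> C" for n
  proof -
    have "(\<Sum>k\<le>n. p k * t ^ k) \<le> (\<Sum>k\<in>{..N} \<union> ({..n} - {..N}). p k * t ^ k)"
      using t by (intro sum_mono2) auto
    also have "\<dots> = (\<Sum>k\<le>N. p k * t ^ k) + (\<Sum>k\<in>{..n} - {..N}. p k * t ^ k)"
      by (rule sum.union_disjoint) auto
    also have "(\<Sum>k\<in>{..n} - {..N}. p k * t ^ k) \<le> (\<Sum>k\<in>{..n} - {..N}. (b * t) ^ k)"
      using pn t by (intro sum_mono) (auto simp: power_mult_distrib intro!: mult_right_mono)
    also have "\<dots> \<le> (\<Sum>k<Suc n. (b * t) ^ k)"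
      using bt by (intro sum_mono2) auto
    also have "\<dots> = (1 - (b * t) ^ Suc n) / (1 - b * t)"
      using bt by (simp only: sum_gp_strict) simp
    also have "\<dots> \<le> 1 / (1 - b * t)"
      using bt zero_le_power[of "b * t" "Suc n"] by (intro divide_right_mono) linarith+
    finally show ?thesis by (simp add: C_def)
  qed
  have C0: "0 < C"
    unfolding C_def using bt t by (intro add_nonneg_pos sum_nonneg) auto
  have lam: "1 / t + 3 * t = s + 3 / s" using s by (simp add: t_def)
  have s3: "0 < s + 3 / s" using s by (intro add_pos_pos) auto
  have "ereal (root n (num_trivial G x y n)) \<le> ereal (root n C * (s + 3 / s))" if "n > 0" for n
  proof -
    have "real (num_trivial G x y n) \<le> (s + 3 / s) ^ n * C"
      using num_trivial_le[OF xy t, of n] bound[of n] s3 unfolding lam p_def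
      by (meson mult_left_mono order_trans zero_le_power less_imp_le)
    then have "root n (num_trivial G x y n) \<le> root n ((s + 3 / s) ^ n * C)"
      using that by simp
    also have "\<dots> = (s + 3 / s) * root n C"
      using that s3 by (simp add: real_root_mult real_root_power_cancel)
    finally show ?thesis by (simp add: mult.commute)
  qed
  then have "rho G x y \<le> limsup (\<lambda>n. ereal (root n C * (s + 3 / s)))"
    unfolding rho_def by (intro Limsup_mono eventually_sequentiallyI[of 1]) auto
  also have "(\<lambda>n. ereal (root n C * (s + 3 / s))) \<longlonglongrightarrow> ereal (1 * (s + 3 / s))"
    using LIMSEQ_root_const[OF C0] by (intro tendsto_intros) auto
  then have "limsup (\<lambda>n. ereal (root n C * (s + 3 / s))) = ereal (s + 3 / s)"
    by (simp add: lim_imp_Limsup)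
  finally show ?thesis .
qed

text \<open>Beyond \<open>sqrt 3\<close> the function \<open>s + 3 / s\<close> is strictly
  increasing, so \<open>alpha < s\<close> would push \<open>rho\<close> strictly below
  \<open>s + 3 / s\<close>.\<close>

lemma (in group) alpha_ge_of_rho_ge:
  assumes xy: "x \<in> carrier G" "y \<in> carrier G"
    and s: "1 \<le> s" "3 < s\<^sup>2" and rho: "ereal (s + 3 / s) \<le> rho G x y"
  shows "ereal s \<le> alpha G x y"
proof (rule ccontr)
  assume "\<not> ereal s \<le> alpha G x y"
  then have "alpha G x y < ereal s" by simp
  then obtain b where b: "alpha G x y < ereal b" "b < s"
    using ereal_dense2[of "alpha G x y" "ereal s"] by force
  have sq: "sqrt 3 < s" using s by (simp add: real_less_lsqrt)
  \<comment> \<open>The maximum keeps \<open>r\<close> in the range where \<open>s + 3 / s\<close>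
    increases; it is still below \<open>s\<close> because \<open>sqrt 3\<close> is.\<close>
  define r where "r = max b (sqrt 3)"
  have r: "sqrt 3 \<le> r" "r < s" "alpha G x y < ereal r"
    using b sq by (auto simp: r_def less_max_iff_disj elim: order.strict_trans2)
  have "1 < sqrt (3 :: real)" by simp
  then have r1: "1 < r" using r(1) by linarith
  have "rho G x y \<le> ereal (r + 3 / r)"
    using r1 by (intro rho_le_of_alpha_less xy r(3)) simp
  with rho have le: "s + 3 / s \<le> r + 3 / r"
    using order_trans ereal_less_eq(3) by blast
  have "3 = sqrt 3 * sqrt 3" by simp
  also have "\<dots> < s * r" using r sq by (intro mult_less_le_imp_less) auto
  finally have "3 < s * r" .
  moreover have "(s + 3 / s) - (r + 3 / r) = (s - r) * (s * r - 3) / (s * r)"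
    using r1 s by (simp add: field_simps)
  moreover have "0 < (s - r) * (s * r - 3) / (s * r)"
    using \<open>3 < s * r\<close> r(2) r1 s by (intro divide_pos_pos mult_pos_pos) auto
  ultimately show False using le by simp
qed

section \<open>Words with few values\<close>

lemma length_word_inv [simp]: "length (word_inv w) = length w"
  by (simp add: word_inv_def)

context group
begin

definition list_prod :: "'a list \<Rightarrow> 'a" where
  "list_prod hs = foldr (\<otimes>) hs \<one>"

lemma list_prod_simps [simp]: "list_prod [] = \<one>" "list_prod (h # hs) = h \<otimes> list_prod hs"
  by (simp_all add: list_prod_def)

lemma list_prod_closed: "set hs \<subseteq> carrier G \<Longrightarrow> list_prod hs \<in> carrier G"
  by (induction hs) auto

lemma list_prod_append:
  "set hs \<subseteq> carrier G \<Longrightarrow> set hs' \<subseteq> carrier G \<Longrightarrow> list_prod (hs @ hs') = list_prod hs \<otimes> list_prod hs'"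
  by (induction hs) (auto simp: list_prod_closed m_assoc)

text \<open>Because \<open>e\<close> commutes with \<open>E\<close>, its occurrences can be
  collected in front. The number of factors is preserved, which is what bounds the exponent
  \<open>i\<close> in the count below.\<close>

lemma list_prod_split:
  assumes "insert e E \<subseteq> carrier G" and comm: "\<And>h. h \<in> E \<Longrightarrow> h \<otimes> e = e \<otimes> h"
    and "set hs \<subseteq> insert e E"
  shows "\<exists>i hs'. set hs' \<subseteq> E \<and> i + length hs' = length hs \<and> list_prod hs = e [^] (i :: nat) \<otimes> list_prod hs'"
  using assms(3)
proof (induction hs)
  case Nil
  show ?case by (intro exI[of _ 0] exI[of _ "[]"]) simp
next
  case (Cons h hs)
  then obtain i hs' where *: "set hs' \<subseteq> E" "i + length hs' = length hs"
      "list_prod hs = e [^] i \<otimes> list_prod hs'"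
    by auto
  have c: "e \<in> carrier G" "list_prod hs' \<in> carrier G"
    using * assms(1) by (auto intro: list_prod_closed)
  show ?case
  proof (cases "h = e")
    case True
    have "list_prod (h # hs) = e [^] Suc i \<otimes> list_prod hs'"
      unfolding list_prod_simps True *(3) nat_pow_Suc2[OF c(1)] using c by (simp add: m_assoc)
    with * show ?thesis by (intro exI[of _ "Suc i"] exI[of _ hs']) auto
  next
    case False
    then have h: "h \<in> E" "h \<in> carrier G" using Cons.prems assms(1) by auto
    have "h \<otimes> e [^] i = e [^] i \<otimes> h"
    proof (induction i)
      case (Suc i)
      have "h \<otimes> e [^] Suc i = (h \<otimes> e [^] i) \<otimes> e" using c h by (simp add: m_assoc)
      also have "\<dots> = e [^] i \<otimes> (h \<otimes> e)" using c h by (simp add: Suc m_assoc)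
      finally show ?case using c h by (simp add: comm m_assoc)
    qed (use h in simp)
    then have "list_prod (h # hs) = e [^] i \<otimes> list_prod (h # hs')"
      using c h by (simp add: *(3) m_assoc[symmetric])
    with * h show ?thesis by (intro exI[of _ i] exI[of _ "h # hs'"]) auto
  qed
qed

text \<open>A product of commuting elements is determined by the multiplicity of each element, and
  every multiplicity lies between 0 and \<open>K\<close>. That the bound is polynomial in
  \<open>K\<close> is why the pigeonhole principle costs no exponential factor.\<close>

lemma card_commuting_products:
  assumes "finite E" "E \<subseteq> carrier G" and "\<And>g h. g \<in> E \<Longrightarrow> h \<in> E \<Longrightarrow> g \<otimes> h = h \<otimes> g"
  shows "finite {list_prod hs |hs. set hs \<subseteq> E \<and> length hs \<le> K} \<and>
    card {list_prod hs |hs. set hs \<subseteq> E \<and> length hs \<le> K} \<le> (K + 1) ^ card E"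
  using assms
proof (induction E rule: finite_induct)
  case empty
  have "{list_prod hs |hs. set hs \<subseteq> {} \<and> length hs \<le> K} = {\<one>}" by auto
  then show ?case by simp
next
  case (insert e E)
  let ?S = "\<lambda>E. {list_prod hs |hs. set hs \<subseteq> E \<and> length hs \<le> K}"
  let ?f = "\<lambda>(i :: nat, g). e [^] i \<otimes> g"
  have IH: "finite (?S E)" "card (?S E) \<le> (K + 1) ^ card E"
    using insert by auto
  have sub: "?S (insert e E) \<subseteq> ?f ` ({..K} \<times> ?S E)"
  proof
    fix g assume "g \<in> ?S (insert e E)"
    then obtain hs where hs: "g = list_prod hs" "set hs \<subseteq> insert e E" "length hs \<le> K" by blast
    obtain i hs' where *: "set hs' \<subseteq> E" "i + length hs' = length hs"
        "list_prod hs = e [^] i \<otimes> list_prod hs'"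
      using list_prod_split[OF insert.prems(1) _ hs(2)] insert.prems(2) by blast
    have "(i, list_prod hs') \<in> {..K} \<times> ?S E" using * hs(3) by auto
    then show "g \<in> ?f ` ({..K} \<times> ?S E)" using * hs(1) by (intro image_eqI) auto
  qed
  have fin: "finite ({..K} \<times> ?S E)" using IH(1) by simp
  have "card (?S (insert e E)) \<le> card ({..K} \<times> ?S E)"
    using fin sub by (meson card_image_le card_mono finite_imageI order_trans)
  also have "\<dots> \<le> (K + 1) * (K + 1) ^ card E"
    unfolding card_cartesian_product using mult_le_mono2[OF IH(2), of "K + 1"] by simp
  finally show ?case
    using insert.hyps finite_subset[OF sub finite_imageI[OF fin]] by simp
qed

text \<open>Pigeonhole: two words with the same value give a trivial word of twice the length.\<close>

lemma num_trivial_double_ge: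
  fixes c :: real
  assumes xy: "x \<in> carrier G" "y \<in> carrier G"
    and L: "L \<subseteq> {w. length w = n}" and S: "finite S" "word_val G x y ` L \<subseteq> S"
    and "real (card L) \<ge> real (card S) * c" and "0 \<le> c" and "S \<noteq> {}"
  shows "num_trivial G x y (2 * n) \<ge> c\<^sup>2"
proof -
  have fL: "finite L" using L finite_subset[OF L] by simp
  have len: "length w = n" if "w \<in> L" for w using L that by auto
  have "\<exists>g\<in>S. c \<le> card {w\<in>L. word_val G x y w = g}"
  proof (rule ccontr)
    assume "\<not> ?thesis"
    then have *: "real (card {w\<in>L. word_val G x y w = g}) < c" if "g \<in> S" for g
      using that by auto
    have "L = (\<Union>g\<in>S. {w\<in>L. word_val G x y w = g})" using S(2) by auto
    then have "card L \<le> (\<Sum>g\<in>S. card {w\<in>L. word_val G x y w = g})"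
      using card_UN_le[OF S(1), of "\<lambda>g. {w\<in>L. word_val G x y w = g}"] by simp
    then have "real (card L) \<le> (\<Sum>g\<in>S. real (card {w\<in>L. word_val G x y w = g}))"
      by (simp flip: of_nat_sum)
    also have "\<dots> < (\<Sum>g\<in>S. c)"
      using * S(1) \<open>S \<noteq> {}\<close> by (intro sum_strict_mono) auto
    finally show False using assms(6) by simp
  qed
  then obtain g where g: "c \<le> card {w\<in>L. word_val G x y w = g}" by blast
  define M where "M = {w\<in>L. word_val G x y w = g}"
  have fM: "finite M" using fL by (simp add: M_def)
  \<comment> \<open>All words in \<open>M\<close> have length \<open>n\<close>, so the concatenation
    can be cut at position \<open>n\<close>.\<close>
  have inj: "inj_on (\<lambda>(u, v). u @ word_inv v) (M \<times> M)"
  proof (rule inj_onI, clarify)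
    fix u v u' v' assume *: "u \<in> M" "v \<in> M" "u' \<in> M" "v' \<in> M" "u @ word_inv v = u' @ word_inv v'"
    have "length u = length u'" using * L by (auto simp: M_def)
    with * have "u = u'" "word_inv v = word_inv v'" by auto
    then show "u = u' \<and> v = v'" using word_inv_invol by metis
  qed
  have "(\<lambda>(u, v). u @ word_inv v) ` (M \<times> M) \<subseteq> {w. length w = 2 * n \<and> word_val G x y w = \<one>}"
    using xy by (auto simp: M_def word_val_append word_val_word_inv word_val_closed len)
  then have "card (M \<times> M) \<le> num_trivial G x y (2 * n)"
    unfolding num_trivial_def by (intro card_inj_on_le[OF inj]) auto
  then have "real (card M) ^ 2 \<le> num_trivial G x y (2 * n)"
    by (simp add: card_cartesian_product power2_eq_square flip: of_nat_mult)
  moreover have "c\<^sup>2 \<le> real (card M) ^ 2"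
    using g \<open>0 \<le> c\<close> by (intro power_mono) (auto simp: M_def)
  ultimately show ?thesis by linarith
qed

text \<open>The square is compensated by the doubled length, the polynomial denominator and the
  constant have n-th roots tending to 1, and a limsup is at least the limsup along the even
  lengths.\<close>

lemma rho_ge_of_growth:
  fixes c lam :: real and d K :: nat
  assumes c: "0 < c" and lam: "0 < lam"
    and ge: "\<And>n. num_trivial G x y (2 * n) \<ge> (c * lam ^ n / (real n * real K + 1) ^ d)\<^sup>2"
  shows "ereal lam \<le> rho G x y"
proof -
  define r where "r n = c * lam ^ n / (real n * K + 1) ^ d" for n
  have lim: "(\<lambda>n. root (2 * n) ((r n)\<^sup>2)) \<longlonglongrightarrow> lam"
  proof (rule Lim_transform_eventually)
    let ?s = "\<lambda>n. root n (real n * K + 1)"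
    have "?s \<longlonglongrightarrow> 1"
    proof (rule tendsto_sandwich)
      show "\<forall>\<^sub>F n in sequentially. 1 \<le> ?s n"
        by (intro eventually_sequentiallyI[of 1]) simp
      show "\<forall>\<^sub>F n in sequentially. ?s n \<le> root n (real n) * root n (real K + 1)"
        by (intro eventually_sequentiallyI[of 1])
          (simp add: real_root_mult[symmetric] algebra_simps)
      have "(\<lambda>n. root n (real n) * root n (real K + 1)) \<longlonglongrightarrow> 1 * 1"
        by (intro tendsto_mult LIMSEQ_root LIMSEQ_root_const) simp
      then show "(\<lambda>n. root n (real n) * root n (real K + 1)) \<longlonglongrightarrow> 1" by simp
    qed simp
    then have "(\<lambda>n. root n c * lam / ?s n ^ d) \<longlonglongrightarrow> 1 * lam / 1 ^ d"
      using c by (intro tendsto_intros LIMSEQ_root_const) auto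
    then show "(\<lambda>n. root n c * lam / ?s n ^ d) \<longlonglongrightarrow> lam" by simp
    show "\<forall>\<^sub>F n in sequentially. root n c * lam / ?s n ^ d = root (2 * n) ((r n)\<^sup>2)"
    proof (intro eventually_sequentiallyI[of 1])
      fix n :: nat assume n: "1 \<le> n"
      have "0 \<le> r n" using c lam by (simp add: r_def)
      then have "root (2 * n) ((r n)\<^sup>2) = root n (r n)"
        by (simp add: mult.commute[of 2 n] real_root_mult_exp real_root_power_cancel)
      also have "\<dots> = root n c * lam / ?s n ^ d"
        using n lam
        by (simp add: r_def real_root_mult real_root_divide real_root_power real_root_power_cancel)
      finally show "root n c * lam / ?s n ^ d = root (2 * n) ((r n)\<^sup>2)" by simp
    qed
  qed
  have "ereal lam = limsup (\<lambda>n. ereal (root (2 * n) ((r n)\<^sup>2)))"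
    using lim by (intro lim_imp_Limsup[symmetric]) auto
  also have "\<dots> \<le> limsup (\<lambda>n. ereal (root (2 * n) (num_trivial G x y (2 * n))))"
  proof (intro Limsup_mono eventually_sequentiallyI[of 1])
    fix n :: nat assume "1 \<le> n"
    moreover have "(r n)\<^sup>2 \<le> num_trivial G x y (2 * n)"
      using ge[of n] by (simp add: r_def algebra_simps)
    ultimately show "ereal (root (2 * n) ((r n)\<^sup>2)) \<le> ereal (root (2 * n) (num_trivial G x y (2 * n)))"
      by simp
  qed
  also have "\<dots> \<le> rho G x y"
    unfolding rho_def
    using limsup_subseq_mono[of "\<lambda>n. 2 * n" "\<lambda>n. ereal (root n (num_trivial G x y n))"]
    by (simp add: strict_mono_def o_def)
  finally show ?thesis .
qed

end

section \<open>Growth of partial automata\<close>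

fun run :: "('s \<Rightarrow> letter \<Rightarrow> 's option) \<Rightarrow> 's \<Rightarrow> word \<Rightarrow> 's option" where
  "run \<delta> s [] = Some s"
| "run \<delta> s (l # w) = (case \<delta> s l of None \<Rightarrow> None | Some t \<Rightarrow> run \<delta> t w)"

definition opt_val :: "('s \<Rightarrow> real) \<Rightarrow> 's option \<Rightarrow> real" where
  "opt_val f s = (case s of None \<Rightarrow> 0 | Some t \<Rightarrow> f t)"

lemma opt_val_simps [simp]: "opt_val f None = 0" "opt_val f (Some t) = f t"
  by (simp_all add: opt_val_def)

text \<open>Iteration of the inequality \<open>A f \<ge> lam f\<close>, one first letter at a time;
  a run that gets stuck contributes 0.\<close>

lemma run_growth:
  fixes lam :: real
  assumes closed: "\<And>s l t. s \<in> X \<Longrightarrow> \<delta> s l = Some t \<Longrightarrow> t \<in> X"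
    and ineq: "\<And>s. s \<in> X \<Longrightarrow> lam * f s \<le> (\<Sum>l\<in>UNIV. opt_val f (\<delta> s l))"
    and lam: "0 \<le> lam" and "s \<in> X"
  shows "lam ^ n * f s \<le> (\<Sum>w | length w = n. opt_val f (run \<delta> s w))"
  using \<open>s \<in> X\<close>
proof (induction n arbitrary: s)
  case (Suc n)
  let ?W = "{w :: word. length w = n}"
  have "lam ^ Suc n * f s = lam ^ n * (lam * f s)" by simp
  also have "\<dots> \<le> lam ^ n * (\<Sum>l\<in>UNIV. opt_val f (\<delta> s l))"
    by (intro mult_left_mono ineq Suc.prems zero_le_power lam)
  also have "\<dots> = (\<Sum>l\<in>UNIV. lam ^ n * opt_val f (\<delta> s l))"
    by (rule sum_distrib_left)
  also have "\<dots> \<le> (\<Sum>l\<in>UNIV. \<Sum>w\<in>?W. opt_val f (run \<delta> s (l # w)))"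
  proof (rule sum_mono)
    fix l
    show "lam ^ n * opt_val f (\<delta> s l) \<le> (\<Sum>w\<in>?W. opt_val f (run \<delta> s (l # w)))"
      using Suc closed by (cases "\<delta> s l") auto
  qed
  also have "\<dots> = (\<Sum>(l, w)\<in>UNIV \<times> ?W. opt_val f (run \<delta> s (l # w)))"
    by (rule sum.cartesian_product)
  also have "\<dots> = (\<Sum>w | length w = Suc n. opt_val f (run \<delta> s w))"
    by (rule sum.reindex_bij_witness[of _ "\<lambda>w. (hd w, tl w)" "\<lambda>(l, w). l # w"])
      (auto simp: length_Suc_conv)
  finally show ?case .
qed simp

section \<open>Values of the words read by an automaton\<close>

context group
begin

text \<open>Letters multiply on the right while the elements of \<open>E\<close> appear on the left,
  so they accumulate without interfering. The elements \<open>rep s\<close> act as representatives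
  of cosets \<open>H g\<close>, where \<open>H\<close> is generated by \<open>E\<close>.\<close>

lemma run_val:
  assumes xy: "x \<in> carrier G" "y \<in> carrier G" and E: "E \<subseteq> carrier G"
    and rep: "\<And>s. s \<in> X \<Longrightarrow> rep s \<in> carrier G"
    and step: "\<And>s l t. s \<in> X \<Longrightarrow> \<delta> s l = Some t \<Longrightarrow> t \<in> X \<and>
      (\<exists>hs. set hs \<subseteq> E \<and> length hs \<le> K \<and> rep s \<otimes> letter_val G x y l = list_prod hs \<otimes> rep t)"
    and "s \<in> X" "run \<delta> s w = Some t"
  shows "t \<in> X \<and> (\<exists>hs. set hs \<subseteq> E \<and> length hs \<le> length w * K \<and>
    rep s \<otimes> word_val G x y w = list_prod hs \<otimes> rep t)"
  using assms(6,7)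
proof (induction w arbitrary: s)
  case Nil
  then show ?case by (auto intro!: exI[of _ "[]"] simp: rep)
next
  case (Cons l w)
  from Cons.prems obtain r where r: "\<delta> s l = Some r" "run \<delta> r w = Some t"
    by (auto split: option.splits)
  obtain hs where hs: "r \<in> X" "set hs \<subseteq> E" "length hs \<le> K"
      "rep s \<otimes> letter_val G x y l = list_prod hs \<otimes> rep r"
    using step[OF Cons.prems(1) r(1)] by blast
  obtain hs' where hs': "t \<in> X" "set hs' \<subseteq> E" "length hs' \<le> length w * K"
      "rep r \<otimes> word_val G x y w = list_prod hs' \<otimes> rep t"
    using Cons.IH[OF hs(1) r(2)] by blast
  have c: "list_prod hs \<in> carrier G" "list_prod hs' \<in> carrier G" "rep s \<in> carrier G"
      "rep r \<in> carrier G" "rep t \<in> carrier G"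
    using hs hs' E rep Cons.prems by (auto intro!: list_prod_closed)
  have "rep s \<otimes> word_val G x y (l # w) = (rep s \<otimes> letter_val G x y l) \<otimes> word_val G x y w"
    using c xy by (simp add: word_val_Cons m_assoc letter_val_closed word_val_closed)
  also have "\<dots> = list_prod hs \<otimes> (rep r \<otimes> word_val G x y w)"
    unfolding hs(4) using c xy by (simp add: m_assoc word_val_closed)
  also have "\<dots> = list_prod (hs @ hs') \<otimes> rep t"
    unfolding hs'(4) using c hs(2) hs'(2) E by (subst list_prod_append) (auto simp: m_assoc)
  finally show ?case
    using hs hs' by (intro conjI exI[of _ "hs @ hs'"]) auto
qed

theorem rho_ge_automaton:
  fixes lam :: real
  assumes xy: "x \<in> carrier G" "y \<in> carrier G"
    and E: "finite E" "E \<subseteq> carrier G" "\<And>g h. g \<in> E \<Longrightarrow> h \<in> E \<Longrightarrow> g \<otimes> h = h \<otimes> g"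
    and X: "finite X" "s0 \<in> X" and rep: "\<And>s. s \<in> X \<Longrightarrow> rep s \<in> carrier G"
    and step: "\<And>s l t. s \<in> X \<Longrightarrow> \<delta> s l = Some t \<Longrightarrow> t \<in> X \<and>
      (\<exists>hs. set hs \<subseteq> E \<and> rep s \<otimes> letter_val G x y l = list_prod hs \<otimes> rep t)"
    and f: "\<And>s. s \<in> X \<Longrightarrow> 0 \<le> f s" "0 < f s0" and lam: "0 < lam"
    and ineq: "\<And>s. s \<in> X \<Longrightarrow> lam * f s \<le> (\<Sum>l\<in>UNIV. opt_val f (\<delta> s l))"
  shows "ereal lam \<le> rho G x y"
proof -
  \<comment> \<open>One choice of factors for each transition. There are finitely many states and
    letters, so the sum \<open>K\<close> of all their lengths bounds the number of factors of any
    single step.\<close>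
  define H where "H s l = (SOME hs. set hs \<subseteq> E \<and>
    rep s \<otimes> letter_val G x y l = list_prod hs \<otimes> rep (the (\<delta> s l)))" for s l
  define K where "K = (\<Sum>s\<in>X. \<Sum>l\<in>UNIV. length (H s l))"
  have step': "t \<in> X \<and>
      (\<exists>hs. set hs \<subseteq> E \<and> length hs \<le> K \<and> rep s \<otimes> letter_val G x y l = list_prod hs \<otimes> rep t)"
    if s: "s \<in> X" and d: "\<delta> s l = Some t" for s l t
  proof -
    have "set (H s l) \<subseteq> E \<and> rep s \<otimes> letter_val G x y l = list_prod (H s l) \<otimes> rep (the (\<delta> s l))"
      unfolding H_def by (rule someI_ex) (use step[OF s d] d in auto)
    moreover have "length (H s l) \<le> (\<Sum>l\<in>UNIV. length (H s l))"
      by (rule member_le_sum) auto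
    moreover have "\<dots> \<le> K"
      unfolding K_def using X(1) s by (intro member_le_sum) auto
    ultimately show ?thesis using step[OF s d] d by auto
  qed
  define Fm where "Fm = (\<Sum>s\<in>X. f s)"
  have fle: "f s \<le> Fm" if "s \<in> X" for s
    unfolding Fm_def using that f X by (intro member_le_sum) auto
  have Fm: "0 < Fm" using fle[OF X(2)] f(2) by linarith
  have cX: "0 < card X" using X card_gt_0_iff by blast
  show ?thesis
  proof (rule rho_ge_of_growth)
    show "0 < f s0 / (Fm * card X)" using f(2) Fm cX by simp
    fix n
    define L where "L = {w. length w = n \<and> run \<delta> s0 w \<noteq> None}"
    define P where "P = {list_prod hs |hs. set hs \<subseteq> E \<and> length hs \<le> n * K}"
    define S where "S = (\<lambda>(g, t). inv (rep s0) \<otimes> (g \<otimes> rep t)) ` (P \<times> X)"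
    have P: "finite P" "card P \<le> (n * K + 1) ^ card E"
      using card_commuting_products[OF E, of "n * K"] unfolding P_def by auto
    have S: "finite S" "card S \<le> (n * K + 1) ^ card E * card X"
    proof -
      show "finite S" unfolding S_def using P(1) X(1) by simp
      have "card S \<le> card P * card X"
        unfolding S_def card_cartesian_product[symmetric] using P(1) X(1)
        by (intro card_image_le) simp
      then show "card S \<le> (n * K + 1) ^ card E * card X"
        using P(2) by (meson mult_le_mono1 order_trans)
    qed
    have sub: "word_val G x y ` L \<subseteq> S"
    proof (rule image_subsetI)
      fix w assume "w \<in> L"
      then obtain t where w: "length w = n" "run \<delta> s0 w = Some t" by (auto simp: L_def)
      obtain hs where hs: "t \<in> X" "set hs \<subseteq> E" "length hs \<le> n * K"
          "rep s0 \<otimes> word_val G x y w = list_prod hs \<otimes> rep t"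
        using run_val[OF xy E(2) rep step' X(2) w(2)] w(1) by blast
      have "word_val G x y w = inv (rep s0) \<otimes> (rep s0 \<otimes> word_val G x y w)"
        using rep[OF X(2)] xy by (simp add: m_assoc[symmetric] word_val_closed)
      also have "\<dots> = inv (rep s0) \<otimes> (list_prod hs \<otimes> rep t)" by (simp add: hs(4))
      finally show "word_val G x y w \<in> S"
        using hs unfolding S_def P_def by (intro image_eqI[of _ _ "(list_prod hs, t)"]) auto
    qed
    have "lam ^ n * f s0 \<le> (\<Sum>w | length w = n. opt_val f (run \<delta> s0 w))"
      using step lam by (intro run_growth[of X] ineq X(2)) auto
    also have "\<dots> = (\<Sum>w\<in>L. opt_val f (run \<delta> s0 w))"
      unfolding L_def by (intro sum.mono_neutral_right) auto
    also have "\<dots> \<le> (\<Sum>w\<in>L. Fm)"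
    proof (rule sum_mono)
      fix w assume "w \<in> L"
      then obtain t where w: "run \<delta> s0 w = Some t" by (auto simp: L_def)
      have "t \<in> X" using run_val[OF xy E(2) rep step' X(2) w] by (rule conjunct1)
      with w show "opt_val f (run \<delta> s0 w) \<le> Fm" by (simp add: fle)
    qed
    finally have cL: "lam ^ n * f s0 \<le> card L * Fm" by simp
    define M where "M = real ((n * K + 1) ^ card E)"
    have N: "M = (real n * real K + 1) ^ card E" "0 < M"
      by (simp_all add: M_def add.commute add_pos_nonneg)
    \<comment> \<open>The lower bound \<open>lam ^ n * f s0 / Fm\<close> for the number of accepted
      words, divided by the upper bound \<open>M * card X\<close> for the number of their
      values.\<close>
    define c where "c = f s0 / (Fm * card X) * lam ^ n / M"
    have c0: "0 \<le> c" using f(2) Fm lam N(2) by (simp add: c_def)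
    have "real (card S) * c \<le> M * card X * c"
      using S(2) c0 by (intro mult_right_mono) (simp_all only: M_def of_nat_mult[symmetric] of_nat_le_iff)
    also have "\<dots> = lam ^ n * f s0 / Fm"
      using cX N(2) by (simp add: c_def field_simps)
    also have "\<dots> \<le> card L"
      using cL Fm by (simp add: field_simps)
    finally have cS: "real (card S) * c \<le> card L" .
    have "L \<noteq> {}"
    proof
      assume "L = {}"
      with cL have "lam ^ n * f s0 \<le> 0" by simp
      moreover have "0 < lam ^ n * f s0" using lam f(2) by simp
      ultimately show False by simp
    qed
    then have "S \<noteq> {}" using sub by auto
    then have "c\<^sup>2 \<le> num_trivial G x y (2 * n)"
      using cS c0 by (intro num_trivial_double_ge[OF xy _ S(1) sub]) (auto simp: L_def)
    then show "(f s0 / (Fm * card X) * lam ^ n / (real n * real K + 1) ^ card E)\<^sup>2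
        \<le> num_trivial G x y (2 * n)"
      by (simp only: c_def N)
  qed (rule lam)
qed

end

text \<open>In a reachable state \<open>(s, u)\<close> the core has been left at \<open>s\<close>
  along a missing edge, and the reduced word \<open>rev u\<close> has been read since. Its last
  letter is the head of \<open>u\<close>, so that going back removes the head. Depths stay below
  \<open>N\<close>.\<close>

fun tree_step ::
    "('s \<Rightarrow> letter \<Rightarrow> 's option) \<Rightarrow> nat \<Rightarrow> 's \<times> word \<Rightarrow> letter \<Rightarrow> ('s \<times> word) option" where
  "tree_step \<delta> N (s, []) l =
     (case \<delta> s l of Some t \<Rightarrow> Some (t, []) | None \<Rightarrow> if 1 < N then Some (s, [l]) else None)"
| "tree_step \<delta> N (s, m # u) l =
     (if l = letter_inv m then Some (s, u)
      else if length (m # u) + 1 < N then Some (s, l # m # u) else None)"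

text \<open>If \<open>lam = al + 3 / al\<close>, then \<open>al ^ - k\<close> is an eigenfunction along the branches of a 4-regular
  tree; the linear factor cuts it off at depth \<open>N\<close> and keeps it subharmonic because
  \<open>al \<ge> 3 / al\<close>.\<close>

definition decay :: "real \<Rightarrow> nat \<Rightarrow> nat \<Rightarrow> real" where
  "decay al N k = (1 / al) ^ k * (1 - real k / real N)"

lemma decay_subharmonic:
  assumes al: "0 < al" "3 \<le> al\<^sup>2" and N: "0 < N"
  shows "(al + 3 / al) * decay al N (Suc k) \<le> decay al N k + 3 * decay al N (Suc (Suc k))"
proof -
  define p where "p = (1 / al) ^ Suc k"
  have p: "0 \<le> p" "(1 / al) ^ k = al * p" "(1 / al) ^ Suc (Suc k) = p / al"
    using al by (simp_all add: p_def)
  define q where "q = 1 / real N"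
  have dec: "decay al N k = al * p * (1 - k * q)" "decay al N (Suc k) = p * (1 - (k + 1) * q)"
      "decay al N (Suc (Suc k)) = p / al * (1 - (k + 2) * q)"
    unfolding decay_def p p_def[symmetric] by (simp_all add: q_def add.commute)
  have "decay al N k + 3 * decay al N (Suc (Suc k)) - (al + 3 / al) * decay al N (Suc k)
      = p * q * (al - 3 / al)"
    unfolding dec using al(1) by (simp add: field_simps)
  moreover have "3 / al \<le> al"
    using al by (simp add: divide_le_eq power2_eq_square)
  then have "0 \<le> p * q * (al - 3 / al)"
    using p(1) by (simp add: q_def)
  ultimately show ?thesis by linarith
qed

text \<open>A vertex \<open>s\<close> with \<open>d\<close> core edges gets \<open>4 - d\<close>
  trees, whose first vertices have weight close to \<open>f s / al\<close>. They supply the part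
  \<open>(4 - d) / al\<close> of the eigenvalue \<open>al + 3 / al\<close>, and
  \<open>al + (d - 1) / al\<close> is left for the core.\<close>

theorem (in group) rho_ge_core:
  fixes al :: real
  assumes xy: "x \<in> carrier G" "y \<in> carrier G"
    and E: "finite E" "E \<subseteq> carrier G" "\<And>g h. g \<in> E \<Longrightarrow> h \<in> E \<Longrightarrow> g \<otimes> h = h \<otimes> g"
    and X: "finite X" "s0 \<in> X" and rep: "\<And>s. s \<in> X \<Longrightarrow> rep s \<in> carrier G"
    and step: "\<And>s l t. s \<in> X \<Longrightarrow> \<delta> s l = Some t \<Longrightarrow> t \<in> X \<and>
      (\<exists>hs. set hs \<subseteq> E \<and> rep s \<otimes> letter_val G x y l = list_prod hs \<otimes> rep t)"
    and f: "\<And>s. s \<in> X \<Longrightarrow> 0 \<le> f s" "0 < f s0" and al: "0 < al" "3 \<le> al\<^sup>2"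
    and ineq: "\<And>s. s \<in> X \<Longrightarrow>
      (al + (real (card {l. \<delta> s l \<noteq> None}) - 1) / al) * f s \<le> (\<Sum>l\<in>UNIV. opt_val f (\<delta> s l))"
  shows "ereal (al + 3 / al) \<le> rho G x y"
proof -
  \<comment> \<open>Truncation at depth \<open>N\<close> lowers the weight of the first tree vertex
    from \<open>f s / al\<close> to \<open>(1 - 1 / N) * f s / al\<close>. At most four trees meet
    at a core vertex, so the eigenvalue drops by at most \<open>4 / (al * N)\<close>.\<close>
  have main: "ereal (al + 3 / al - 4 / (al * N)) \<le> rho G x y" if N: "1 < N" for N :: nat
  proof (rule rho_ge_automaton[where X = "X \<times> {u :: word. length u < N}" and ?s0.0 = "(s0, [])"
        and \<delta> = "tree_step \<delta> N" and rep = "\<lambda>(s, u). rep s \<otimes> word_val G x y (rev u)"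
        and f = "\<lambda>(s, u). f s * decay al N (length u)", OF xy E])
    have "{u :: word. length u < N} = (\<Union>k<N. {u. length u = k})" by auto
    then show "finite (X \<times> {u :: word. length u < N})" using X(1) by simp
    show "(s0, []) \<in> X \<times> {u :: word. length u < N}" using X(2) N by simp
    show "(case s of (s, u) \<Rightarrow> rep s \<otimes> word_val G x y (rev u)) \<in> carrier G"
      if "s \<in> X \<times> {u :: word. length u < N}" for s
      using that rep xy by (auto simp: word_val_closed)
    have dec0: "0 \<le> decay al N k" if "k \<le> N" for k
      using that al N by (auto simp: decay_def divide_le_eq)
    have decN: "decay al N N = 0" using N by (simp add: decay_def)
    show "0 \<le> (case s of (s, u) \<Rightarrow> f s * decay al N (length u))"
      if "s \<in> X \<times> {u :: word. length u < N}" for s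
      using that f(1) dec0 by auto
    show "0 < (case (s0, []) of (s, u) \<Rightarrow> f s * decay al N (length u))"
      using f(2) by (simp add: decay_def)
    have "4 / (al * N) \<le> 4 / al / 2"
      using N al by (simp add: field_simps)
    also have "\<dots> < 3 / al" using al by (simp add: field_simps)
    finally show "0 < al + 3 / al - 4 / (al * N)" using al by linarith
    show "t \<in> X \<times> {u :: word. length u < N} \<and>
        (\<exists>hs. set hs \<subseteq> E \<and>
          (case s of (s, u) \<Rightarrow> rep s \<otimes> word_val G x y (rev u)) \<otimes> letter_val G x y l =
          list_prod hs \<otimes> (case t of (s, u) \<Rightarrow> rep s \<otimes> word_val G x y (rev u)))"
      if s: "s \<in> X \<times> {u :: word. length u < N}" and t: "tree_step \<delta> N s l = Some t" for s l t
    proof -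
      obtain r u where su: "s = (r, u)" "r \<in> X" "length u < N" using s by auto
      have lv: "letter_val G x y k \<in> carrier G" for k using xy by (rule letter_val_closed)
      have stay: "set [] \<subseteq> E \<and> (rep r \<otimes> word_val G x y (rev u)) \<otimes> letter_val G x y l =
          list_prod [] \<otimes> (rep r \<otimes> word_val G x y (rev (l # u)))"
        using rep[OF su(2)] xy lv
        by (simp add: word_val_append word_val_Cons m_assoc word_val_closed)
      show ?thesis
      proof (cases u)
        case Nil
        show ?thesis
        proof (cases "\<delta> r l")
          case None
          with Nil t su stay N show ?thesis by (auto split: if_splits intro!: exI[of _ "[]"])
        next
          case (Some q)
          then have "t = (q, [])" using t su Nil by simp
          moreover obtain hs where "q \<in> X" "set hs \<subseteq> E"
              "rep r \<otimes> letter_val G x y l = list_prod hs \<otimes> rep q"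
            using step[OF su(2) Some] by blast
          ultimately show ?thesis
            using su Nil N rep by (auto intro!: exI[of _ hs])
        qed
      next
        case (Cons m v)
        show ?thesis
        proof (cases "l = letter_inv m")
          case True
          then have "t = (r, v)" using t su Cons by simp
          moreover have "(rep r \<otimes> word_val G x y (rev u)) \<otimes> letter_val G x y l
              = rep r \<otimes> word_val G x y (rev v)"
            using rep[OF su(2)] xy lv
            by (simp add: Cons True word_val_append word_val_Cons m_assoc word_val_closed letter_val_inv)
          ultimately show ?thesis
            using su Cons rep xy by (auto intro!: exI[of _ "[]"] simp: word_val_closed)
        next
          case False
          with t su Cons have "t = (r, l # u)" "length (l # u) < N" by (auto split: if_splits)
          with stay su show ?thesis by (auto intro!: exI[of _ "[]"])
        qed
      qed
    qed
    fix s assume "s \<in> X \<times> {u :: word. length u < N}"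
    then obtain r u where su: "s = (r, u)" "r \<in> X" "length u < N" by auto
    let ?f = "\<lambda>(s, u :: word). f s * decay al N (length u)"
    have fr: "0 \<le> f r" using f(1) su(2) .
    show "(al + 3 / al - 4 / (al * N)) * ?f s \<le> (\<Sum>l\<in>UNIV. opt_val ?f (tree_step \<delta> N s l))"
    proof (cases u)
      case Nil
      define D where "D = {l. \<delta> r l \<noteq> None}"
      have D: "card D \<le> 4"
        using card_mono[of "UNIV :: letter set" D] by (simp add: card_UNIV_letter)
      have d1: "decay al N 1 = (1 - 1 / N) / al" by (simp add: decay_def)
      have "opt_val ?f (tree_step \<delta> N s l)
          = opt_val f (\<delta> r l) + (if l \<in> - D then f r * decay al N 1 else 0)" for l
        using N by (cases "\<delta> r l") (simp_all add: su(1) Nil D_def decay_def)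
      then have "(\<Sum>l\<in>UNIV. opt_val ?f (tree_step \<delta> N s l))
          = (\<Sum>l\<in>UNIV. opt_val f (\<delta> r l)) + (\<Sum>l\<in>UNIV. if l \<in> - D then f r * decay al N 1 else 0)"
        by (simp add: sum.distrib)
      also have "(\<Sum>l\<in>UNIV. if l \<in> - D then f r * decay al N 1 else 0)
          = card (- D) * (f r * decay al N 1)"
        by (subst sum.If_cases) (simp_all add: Compl_eq)
      also have "card (- D) = 4 - card D"
        using card_Diff_subset[of D UNIV] by (simp add: Compl_eq_Diff_UNIV card_UNIV_letter)
      finally have eq: "(\<Sum>l\<in>UNIV. opt_val ?f (tree_step \<delta> N s l))
          = (\<Sum>l\<in>UNIV. opt_val f (\<delta> r l)) + (4 - real (card D)) * (f r * decay al N 1)"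
        using D by (simp add: of_nat_diff)
      define e where "e = (4 - real (card D)) / (al * N)"
      have "e \<le> 4 / (al * N)" unfolding e_def using al N by (intro divide_right_mono) auto
      then have "(al + 3 / al - 4 / (al * N)) * f r \<le> (al + 3 / al - e) * f r"
        by (intro mult_right_mono fr) simp
      also have "\<dots> = (al + (real (card D) - 1) / al) * f r + (4 - real (card D)) * (f r * decay al N 1)"
        unfolding d1 e_def using al N by (simp add: field_simps)
      also have "\<dots> \<le> (\<Sum>l\<in>UNIV. opt_val ?f (tree_step \<delta> N s l))"
        unfolding eq using ineq[OF su(2)] by (simp add: D_def)
      finally show ?thesis using Nil su by (simp add: decay_def)
    next
      case (Cons m v)
      \<comment> \<open>On the last level there are no outward transitions, in agreement with
        \<open>decay al N N = 0\<close>; so the formula needs no extra case.\<close>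
      have val: "opt_val ?f (tree_step \<delta> N s l)
          = f r * (if l = letter_inv m then decay al N (length v) else decay al N (Suc (length u)))" for l
        using su(3) decN by (auto simp: su(1) Cons dest!: less_antisym)
      have "0 \<le> 4 / (al * N)" using al by simp
      then have "(al + 3 / al - 4 / (al * N)) * ?f s \<le> (al + 3 / al) * ?f s"
        using fr dec0 su by (intro mult_right_mono) auto
      also have "\<dots> = f r * ((al + 3 / al) * decay al N (Suc (length v)))"
        by (simp add: su(1) Cons)
      also have "\<dots> \<le> f r * (decay al N (length v) + 3 * decay al N (Suc (length u)))"
        using decay_subharmonic[OF al, of N "length v"] N Cons fr by (intro mult_left_mono) auto
      also have "\<dots> = (\<Sum>l\<in>UNIV. opt_val ?f (tree_step \<delta> N s l))"
        unfolding val by (cases m) (simp_all add: sum_letters algebra_simps)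
      finally show ?thesis .
    qed
  qed
  have "(\<lambda>N. al + 3 / al - 4 / al * (1 / real N)) \<longlonglongrightarrow> al + 3 / al - 4 / al * 0"
    by (intro tendsto_intros lim_1_over_n)
  then have "(\<lambda>N. ereal (al + 3 / al - 4 / (al * real N))) \<longlonglongrightarrow> ereal (al + 3 / al)"
    by simp
  then show ?thesis
    by (rule LIMSEQ_le_const2) (use main in \<open>auto intro!: exI[of _ 2]\<close>)
qed

section \<open>Certificates given by lists of edges\<close>

lemma sum_map_of:
  fixes es :: "(letter \<times> 's) list"
  assumes "distinct (map fst es)"
  shows "(\<Sum>(l, t)\<leftarrow>es. f t) = (\<Sum>l\<in>UNIV. opt_val f (map_of es l))"
  using assms
proof (induction es)
  case (Cons e es)
  obtain l t where e: "e = (l, t)" by (cases e)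
  have "map_of es l = None" using Cons.prems by (simp add: e map_of_eq_None_iff)
  then have "opt_val f (map_of (e # es) k) = (if k = l then f t else 0) + opt_val f (map_of es k)" for k
    by (simp add: e)
  then show ?case using Cons by (simp add: e sum.distrib)
qed simp

text \<open>Edges that leave the support of \<open>f\<close> are dropped from the automaton. This
  leaves the sum of the neighbours unchanged and can only lower the degree, hence the left-hand
  side, so the inequality for the whole list is enough.\<close>

theorem (in group) rho_ge_edges:
  fixes al :: real and f :: "'s \<Rightarrow> real"
  assumes xy: "x \<in> carrier G" "y \<in> carrier G"
    and E: "finite E" "E \<subseteq> carrier G" "\<And>g h. g \<in> E \<Longrightarrow> h \<in> E \<Longrightarrow> g \<otimes> h = h \<otimes> g"
    and rep: "\<And>s. rep s \<in> carrier G"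
    and fin: "finite {s. 0 < f s}" and f: "\<And>s. 0 \<le> f s" "0 < f s0"
    and al: "0 < al" "3 \<le> al\<^sup>2"
    and edges: "\<And>s. 0 < f s \<Longrightarrow> \<exists>es. distinct (map fst es) \<and>
      (\<forall>(l, t)\<in>set es. \<exists>hs. set hs \<subseteq> E \<and> rep s \<otimes> letter_val G x y l = list_prod hs \<otimes> rep t) \<and>
      (al + (real (length es) - 1) / al) * f s \<le> (\<Sum>(l, t)\<leftarrow>es. f t)"
  shows "ereal (al + 3 / al) \<le> rho G x y"
proof -
  have "\<forall>s. \<exists>es. 0 < f s \<longrightarrow> distinct (map fst es) \<and>
      (\<forall>(l, t)\<in>set es. \<exists>hs. set hs \<subseteq> E \<and> rep s \<otimes> letter_val G x y l = list_prod hs \<otimes> rep t) \<and>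
      (al + (real (length es) - 1) / al) * f s \<le> (\<Sum>(l, t)\<leftarrow>es. f t)"
    using edges by blast
  then obtain es where es: "\<And>s. 0 < f s \<Longrightarrow> distinct (map fst (es s))"
      "\<And>s l t. 0 < f s \<Longrightarrow> (l, t) \<in> set (es s) \<Longrightarrow>
        \<exists>hs. set hs \<subseteq> E \<and> rep s \<otimes> letter_val G x y l = list_prod hs \<otimes> rep t"
      "\<And>s. 0 < f s \<Longrightarrow> (al + (real (length (es s)) - 1) / al) * f s \<le> (\<Sum>(l, t)\<leftarrow>es s. f t)"
    by (subst (asm) choice_iff) blast
  define \<delta> where "\<delta> s l = (case map_of (es s) l of None \<Rightarrow> None | Some t \<Rightarrow> if 0 < f t then Some t else None)" for s l
  show ?thesis
  proof (rule rho_ge_core[where X = "{s. 0 < f s}" and ?s0.0 = s0 and f = f and \<delta> = \<delta> and rep = rep, OF xy E])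
    show "t \<in> {s. 0 < f s} \<and>
        (\<exists>hs. set hs \<subseteq> E \<and> rep s \<otimes> letter_val G x y l = list_prod hs \<otimes> rep t)"
      if "s \<in> {s. 0 < f s}" "\<delta> s l = Some t" for s l t
    proof -
      have "0 < f t" "map_of (es s) l = Some t"
        using that(2) by (auto simp: \<delta>_def split: option.splits if_splits)
      then show ?thesis using es(2)[of s l t] that(1) map_of_SomeD by fastforce
    qed
    fix s assume "s \<in> {s. 0 < f s}"
    then have s: "0 < f s" by simp
    have "{l. \<delta> s l \<noteq> None} \<subseteq> set (map fst (es s))"
      by (auto simp: \<delta>_def split: option.splits dest!: map_of_SomeD intro: rev_image_eqI)
    then have "card {l. \<delta> s l \<noteq> None} \<le> length (es s)"
      by (metis List.finite_set card_length card_mono length_map order_trans)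
    then have "(al + (real (card {l. \<delta> s l \<noteq> None}) - 1) / al) * f s
        \<le> (al + (real (length (es s)) - 1) / al) * f s"
      using al s by (intro mult_right_mono add_left_mono divide_right_mono) auto
    also have "\<dots> \<le> (\<Sum>l\<in>UNIV. opt_val f (map_of (es s) l))"
      using es(3)[OF s] unfolding sum_map_of[OF es(1)[OF s]] .
    also have "\<dots> = (\<Sum>l\<in>UNIV. opt_val f (\<delta> s l))"
      using f(1) by (intro sum.cong) (auto simp: \<delta>_def antisym not_less split: option.splits)
    finally show "(al + (real (card {l. \<delta> s l \<noteq> None}) - 1) / al) * f s
        \<le> (\<Sum>l\<in>UNIV. opt_val f (\<delta> s l))" .
  qed (use fin f al rep in auto)
qed

section \<open>Baumslag-Solitar groups\<close>

text \<open>A coset of \<open>\<langle>b\<rangle>\<close> in \<open>BS(p, q)\<close> is given by its Britton normal form. The list of digits is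
  stored with the last digit first; the digit \<open>r < p\<close> stands for \<open>a b ^ r\<close> and the digit \<open>p + r\<close>
  for \<open>a\<inverse> b ^ r\<close>. Multiplication by \<open>b\<close> works like an odometer.\<close>

definition carry :: "int \<Rightarrow> int \<Rightarrow> int \<Rightarrow> int \<Rightarrow> int \<times> int" where
  "carry p q r c =
     (if r < p then ((r + c) div p * q, (r + c) mod p)
      else ((r - p + c) div q * p, p + (r - p + c) mod q))"

text \<open>Right multiplication by the power \<open>b ^ c\<close>: the carry \<open>c'\<close> is
  the power of \<open>b\<close> that has moved past the last digit and meets the digit before it. A
  power that has passed all digits is absorbed by the coset, so the empty list stays.\<close>

fun odometer :: "(int \<Rightarrow> int \<Rightarrow> int \<times> int) \<Rightarrow> int \<Rightarrow> int list \<Rightarrow> int list" where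
  "odometer T c [] = []"
| "odometer T c (r # t) = (case T r c of (c', r') \<Rightarrow> r' # (if c' = 0 then t else odometer T c' t))"

text \<open>The digit \<open>d\<close> is the new letter with no \<open>b\<close> after it, and
  \<open>e\<close> is its inverse with no \<open>b\<close> after it, the only last digit that it
  cancels.\<close>

fun toggle :: "int \<Rightarrow> int \<Rightarrow> int list \<Rightarrow> int list" where
  "toggle d e [] = [d]"
| "toggle d e (r # t) = (if r = e then t else d # r # t)"

fun bs_step :: "int \<Rightarrow> int \<Rightarrow> int list \<Rightarrow> letter \<Rightarrow> int list" where
  "bs_step p q t LA = toggle 0 p t"
| "bs_step p q t LA_inv = toggle p 0 t"
| "bs_step p q t LB = odometer (carry p q) 1 t"
| "bs_step p q t LB_inv = odometer (carry p q) (- 1) t"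

section \<open>Cosets of the powers of \<open>y\<close> when
  \<open>x \<otimes> y [^] p = y [^] q \<otimes> x\<close>\<close>

context group
begin

fun bs_rep :: "'a \<Rightarrow> 'a \<Rightarrow> int \<Rightarrow> int list \<Rightarrow> 'a" where
  "bs_rep x y p [] = \<one>"
| "bs_rep x y p (r # t) =
     bs_rep x y p t \<otimes> (if r < p then x \<otimes> y [^] r else inv x \<otimes> y [^] (r - p))"

lemma bs_rep_closed:
  assumes "x \<in> carrier G" "y \<in> carrier G"
  shows "bs_rep x y p t \<in> carrier G"
  by (induction t) (auto simp: assms)

lemma int_pow_in_list_prod:
  assumes "y \<in> carrier G"
  shows "\<exists>hs. set hs \<subseteq> {y, inv y} \<and> list_prod hs = y [^] (k :: int)"
proof -
  have rep: "list_prod (replicate n h) = h [^] n" if "h \<in> carrier G" for h and n :: nat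
  proof (induction n)
    case (Suc n)
    show ?case unfolding nat_pow_Suc2[OF that] by (simp add: Suc)
  qed simp
  show ?thesis
  proof (cases k rule: int_cases2)
    case (nonneg n)
    then have "list_prod (replicate n y) = y [^] k"
      using assms by (simp only: rep int_pow_int)
    then show ?thesis by (intro exI[of _ "replicate n y"]) auto
  next
    case (nonpos n)
    then have "list_prod (replicate n (inv y)) = y [^] k"
      using assms by (simp only: rep inv_closed int_pow_neg_int nat_pow_inv)
    then show ?thesis by (intro exI[of _ "replicate n (inv y)"]) auto
  qed
qed

context
  fixes x y :: 'a and p q :: int
  assumes xy: "x \<in> carrier G" "y \<in> carrier G" and pq: "0 < p" "0 < q"
    and rel: "x \<otimes> y [^] p = y [^] q \<otimes> x"
begin

lemma bs_commute: "x \<otimes> y [^] (p * c) = y [^] (q * c) \<otimes> x"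
proof -
  have nat: "x \<otimes> y [^] (p * int n) = y [^] (q * int n) \<otimes> x" for n
  proof (induction n)
    case (Suc n)
    have "p * int (Suc n) = p * int n + p" "q * int (Suc n) = q * int n + q"
      by (simp_all add: distrib_left)
    then have eq: "y [^] (p * int (Suc n)) = y [^] (p * int n) \<otimes> y [^] p"
        "y [^] (q * int (Suc n)) = y [^] (q * int n) \<otimes> y [^] q"
      by (simp_all only: int_pow_mult[OF xy(2)])
    have "x \<otimes> y [^] (p * int (Suc n)) = (x \<otimes> y [^] (p * int n)) \<otimes> y [^] p"
      unfolding eq using xy by (simp only: m_assoc int_pow_closed)
    also have "\<dots> = y [^] (q * int n) \<otimes> (x \<otimes> y [^] p)"
      unfolding Suc using xy by (simp only: m_assoc int_pow_closed)
    also have "\<dots> = y [^] (q * int (Suc n)) \<otimes> x"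
      unfolding eq rel using xy by (simp only: m_assoc int_pow_closed)
    finally show ?case .
  qed (use xy in simp)
  have neg: "x \<otimes> inv u = inv v \<otimes> x" if "x \<otimes> u = v \<otimes> x" "u \<in> carrier G" "v \<in> carrier G" for u v
  proof -
    have "inv v \<otimes> x = inv v \<otimes> (x \<otimes> u) \<otimes> inv u"
      using that(2,3) xy by (simp add: m_assoc)
    also have "\<dots> = (inv v \<otimes> v) \<otimes> (x \<otimes> inv u)"
      unfolding that(1) using that(2,3) xy by (simp only: m_assoc m_closed inv_closed)
    also have "\<dots> = x \<otimes> inv u" using that(2,3) xy by simp
    finally show ?thesis by simp
  qed
  show ?thesis
  proof (cases c rule: int_cases2)
    case (nonpos n)
    then show ?thesis
      using neg[OF nat[of n]] xy by (simp add: int_pow_neg)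
  qed (simp only: nat)
qed

lemma bs_commute_inv: "inv x \<otimes> y [^] (q * c) = y [^] (p * c) \<otimes> inv x"
proof -
  have "inv x \<otimes> y [^] (q * c) = inv x \<otimes> (y [^] (q * c) \<otimes> x) \<otimes> inv x"
    using xy by (simp add: m_assoc)
  also have "\<dots> = y [^] (p * c) \<otimes> inv x"
    unfolding bs_commute[symmetric] using xy by (simp add: m_assoc[symmetric])
  finally show ?thesis .
qed

lemma bs_rep_odometer:
  "\<exists>k :: int. bs_rep x y p t \<otimes> y [^] c = y [^] k \<otimes> bs_rep x y p (odometer (carry p q) c t)"
proof (induction t arbitrary: c)
  case Nil
  show ?case using xy by (intro exI[of _ c]) simp
next
  case (Cons r t)
  obtain c' r' where cr: "carry p q r c = (c', r')" by (cases "carry p q r c")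
  let ?g = "\<lambda>r. if r < p then x \<otimes> y [^] r else inv x \<otimes> y [^] (r - p)"
  \<comment> \<open>Division with remainder by \<open>p\<close> or \<open>q\<close>: the multiple of
    the modulus passes \<open>x\<close> or \<open>inv x\<close> and becomes the carry, while the
    remainder is the new digit.\<close>
  have g: "?g r \<otimes> y [^] c = y [^] c' \<otimes> ?g r'"
  proof (cases "r < p")
    case True
    then have *: "c' = q * ((r + c) div p)" "r' = (r + c) mod p" "r' < p"
      using cr pq by (auto simp: carry_def)
    have "x \<otimes> y [^] r \<otimes> y [^] c = x \<otimes> y [^] (p * ((r + c) div p) + r')"
      using xy by (simp add: m_assoc int_pow_mult[symmetric] *)
    also have "\<dots> = (x \<otimes> y [^] (p * ((r + c) div p))) \<otimes> y [^] r'"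
      using xy by (simp add: m_assoc int_pow_mult)
    also have "\<dots> = y [^] c' \<otimes> (x \<otimes> y [^] r')"
      using xy by (simp add: bs_commute * m_assoc)
    finally show ?thesis using True * by simp
  next
    case False
    then have *: "c' = p * ((r - p + c) div q)" "r' - p = (r - p + c) mod q" "\<not> r' < p"
      using cr pq by (auto simp: carry_def not_less)
    have "inv x \<otimes> y [^] (r - p) \<otimes> y [^] c = inv x \<otimes> y [^] (q * ((r - p + c) div q) + (r' - p))"
      using xy by (simp add: m_assoc int_pow_mult[symmetric] *(2))
    also have "\<dots> = (inv x \<otimes> y [^] (q * ((r - p + c) div q))) \<otimes> y [^] (r' - p)"
      using xy by (simp add: m_assoc int_pow_mult)
    also have "\<dots> = y [^] c' \<otimes> (inv x \<otimes> y [^] (r' - p))"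
      using xy by (simp add: bs_commute_inv *(1) m_assoc)
    finally show ?thesis using False *(3) by simp
  qed
  define t' where "t' = (if c' = 0 then t else odometer (carry p q) c' t)"
  obtain k :: int where k: "bs_rep x y p t \<otimes> y [^] c' = y [^] k \<otimes> bs_rep x y p t'"
  proof (cases "c' = 0")
    case True
    have "bs_rep x y p t \<otimes> y [^] c' = y [^] (0 :: int) \<otimes> bs_rep x y p t'"
      using xy by (simp add: True t'_def bs_rep_closed)
    then show ?thesis by (rule that)
  next
    case False
    then show ?thesis using Cons.IH[of c'] that by (auto simp: t'_def)
  qed
  have gc: "?g s \<in> carrier G" for s using xy by simp
  have "bs_rep x y p (r # t) \<otimes> y [^] c = bs_rep x y p t \<otimes> (?g r \<otimes> y [^] c)"
    using xy gc[of r] by (simp only: bs_rep.simps m_assoc bs_rep_closed int_pow_closed)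
  also have "\<dots> = (bs_rep x y p t \<otimes> y [^] c') \<otimes> ?g r'"
    unfolding g using xy gc[of r'] by (simp only: m_assoc bs_rep_closed int_pow_closed)
  also have "\<dots> = y [^] k \<otimes> bs_rep x y p (r' # t')"
    unfolding k bs_rep.simps using xy gc[of r'] by (simp only: m_assoc bs_rep_closed int_pow_closed)
  finally show ?case by (auto simp: cr t'_def)
qed

lemma bs_rep_step:
  "\<exists>hs. set hs \<subseteq> {y, inv y} \<and>
     bs_rep x y p t \<otimes> letter_val G x y l = list_prod hs \<otimes> bs_rep x y p (bs_step p q t l)"
proof -
  have stay: ?thesis if "bs_rep x y p t \<otimes> letter_val G x y l = bs_rep x y p (bs_step p q t l)"
    using that xy by (intro exI[of _ "[]"]) (simp add: bs_rep_closed)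
  have move: ?thesis
    if b: "bs_rep x y p t \<otimes> letter_val G x y l = y [^] k \<otimes> bs_rep x y p (bs_step p q t l)" for k :: int
  proof -
    obtain hs where "set hs \<subseteq> {y, inv y}" "list_prod hs = y [^] k"
      using int_pow_in_list_prod[OF xy(2), of k] by blast
    with b show ?thesis by auto
  qed
  show ?thesis
  proof (cases l)
    case LA
    show ?thesis
      by (rule stay) (use xy pq LA in \<open>cases t; auto simp: m_assoc bs_rep_closed\<close>)
  next
    case LA_inv
    show ?thesis
      by (rule stay) (use xy pq LA_inv in \<open>cases t; auto simp: m_assoc bs_rep_closed\<close>)
  next
    case LB
    then show ?thesis using bs_rep_odometer[of t 1] move xy by auto
  next
    case LB_inv
    have "y [^] (- 1 :: int) = inv y" using xy by (simp add: int_pow_neg)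
    with LB_inv show ?thesis using bs_rep_odometer[of t "- 1"] move xy by auto
  qed
qed

theorem rho_ge_bs:
  fixes f :: "int list \<Rightarrow> real"
  assumes fin: "finite {t. 0 < f t}" and f: "\<And>t. 0 \<le> f t" "0 < f t0"
    and al: "0 < al" "3 \<le> al\<^sup>2"
    and ineq: "\<And>t. 0 < f t \<Longrightarrow>
      \<exists>ls. distinct ls \<and> (al + (real (length ls) - 1) / al) * f t \<le> (\<Sum>l\<leftarrow>ls. f (bs_step p q t l))"
  shows "ereal (al + 3 / al) \<le> rho G x y"
proof (rule rho_ge_edges[where E = "{y, inv y}" and rep = "bs_rep x y p", OF xy _ _ _ _ fin f al])
  show "g \<otimes> h = h \<otimes> g" if "g \<in> {y, inv y}" "h \<in> {y, inv y}" for g h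
    using that xy by auto
  fix t assume "0 < f t"
  then obtain ls where ls: "distinct ls"
      "(al + (real (length ls) - 1) / al) * f t \<le> (\<Sum>l\<leftarrow>ls. f (bs_step p q t l))"
    using ineq by blast
  show "\<exists>es. distinct (map fst es) \<and>
      (\<forall>(l, u)\<in>set es. \<exists>hs. set hs \<subseteq> {y, inv y} \<and>
        bs_rep x y p t \<otimes> letter_val G x y l = list_prod hs \<otimes> bs_rep x y p u) \<and>
      (al + (real (length es) - 1) / al) * f t \<le> (\<Sum>(l, u)\<leftarrow>es. f u)"
    using ls bs_rep_step by (intro exI[of _ "map (\<lambda>l. (l, bs_step p q t l)) ls"]) (auto simp: o_def)
qed (use xy in \<open>auto simp: bs_rep_closed\<close>)

end
end

lemma BS_relation:
  shows "gen_a (BS_relators p q) \<otimes>\<^bsub>BS p q\<^esub> gen_b (BS_relators p q) [^]\<^bsub>BS p q\<^esub> int p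
    = gen_b (BS_relators p q) [^]\<^bsub>BS p q\<^esub> int q \<otimes>\<^bsub>BS p q\<^esub> gen_a (BS_relators p q)"
proof -
  let ?R = "BS_relators p q" and ?G = "BS p q"
  interpret group ?G unfolding BS_def by (rule group_presented_group)
  have pow: "gen_b ?R [^]\<^bsub>?G\<^esub> n = pres_class ?R (replicate n LB)" for n :: nat
    by (induction n) (simp_all add: BS_def presented_group_one presented_group_mult gen_b_def
        replicate_append_same)
  have "pres_eq ?R ([LA] @ replicate p LB) (replicate q LB @ [LA])"
  proof -
    let ?u = "[LA] @ replicate p LB" and ?v = "replicate q LB"
    have "pres_eq ?R (?u @ [LA_inv] @ word_inv ?v) []"
      using pres_relator[of "?u @ [LA_inv] @ word_inv ?v" ?R "[]" "[]"] by (simp add: BS_relators_def)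
    then have "pres_eq ?R ((?u @ [LA_inv] @ word_inv ?v) @ (?v @ [LA])) ([] @ (?v @ [LA]))"
      by (rule pres_eq_append) (rule pres_refl)
    moreover have "pres_eq ?R ((?u @ [LA_inv]) @ (word_inv ?v @ ?v) @ [LA]) ((?u @ [LA_inv]) @ [] @ [LA])"
      by (rule pres_eq_context) (rule pres_eq_left_inv)
    moreover have "pres_eq ?R (?u @ [LA_inv, letter_inv LA_inv] @ []) (?u @ [])"
      by (rule pres_cancel)
    ultimately show ?thesis
      by simp (meson pres_sym pres_trans)
  qed
  then show ?thesis
    by (simp add: int_pow_int pow) (simp add: BS_def gen_a_def presented_group_mult pres_class_eq_iff)
qed

section \<open>Finite tables\<close>

text \<open>A table is a finitely supported function on digit lists, stored as a trie with the first digit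
  at the root, whereas digit lists have the last digit first. The annotation of a node tells which of
  its edges are counted; for the Baumslag-Solitar groups it is a bit mask of letters.\<close>

datatype 'm trie = E | N int 'm "'m trie list"

fun look :: "'m trie \<Rightarrow> int list \<Rightarrow> int" where
  "look E xs = 0"
| "look (N f m ts) [] = f"
| "look (N f m ts) (r # xs) = (if 0 \<le> r \<and> nat r < length ts then look (ts ! nat r) xs else 0)"

text \<open>The path to the current node accumulates in \<open>t\<close> with the last digit first,
  so \<open>P\<close> receives it in the orientation of \<open>bs_step\<close> and
  \<open>path_step\<close>.\<close>

fun chk :: "(int list \<Rightarrow> int \<Rightarrow> 'm \<Rightarrow> bool) \<Rightarrow> int list \<Rightarrow> 'm trie \<Rightarrow> bool"
  and chks :: "(int list \<Rightarrow> int \<Rightarrow> 'm \<Rightarrow> bool) \<Rightarrow> int list \<Rightarrow> int \<Rightarrow> 'm trie list \<Rightarrow> bool" where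
  "chk P t E = True"
| "chk P t (N f m ts) = (P t f m \<and> chks P t 0 ts)"
| "chks P t i [] = True"
| "chks P t i (T # Ts) = (chk P (i # t) T \<and> chks P t (i + 1) Ts)"

text \<open>For an explicit table, simplifying the conclusion yields one equation
  \<open>F t = f\<close> per entry. As simp rules these evaluate a neighbour in a single rewriting
  step instead of a walk through the trie.\<close>

lemma chk_look:
  fixes T :: "'m trie" and Ts :: "'m trie list"
  shows "(\<And>xs. F (rev xs @ t) = look T xs) \<Longrightarrow> chk (\<lambda>t f m. F t = f) t T"
    and "(\<And>xs j. j < length Ts \<Longrightarrow> F (rev xs @ (i + int j) # t) = look (Ts ! j) xs) \<Longrightarrow>
     chks (\<lambda>t f m. F t = f) t i Ts"
proof (induction "\<lambda>t (f :: int) (m :: 'm). F t = f" t T and "\<lambda>t (f :: int) (m :: 'm). F t = f" t i Ts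
    rule: chk_chks.induct)
  case (2 t f m Ts)
  have "F (rev xs @ (0 + int j) # t) = look (Ts ! j) xs" if "j < length Ts" for xs j
    using 2(2)[of "int j # xs"] that by simp
  then show ?case using 2(1) 2(2)[of "[]"] by simp
next
  case (4 t i T Ts)
  have "F (rev xs @ i # t) = look T xs" for xs
    using 4(3)[of 0 xs] by simp
  moreover have "F (rev xs @ (i + 1 + int j) # t) = look (Ts ! j) xs" if "j < length Ts" for xs j
    using 4(3)[of "Suc j" xs] that by (simp add: algebra_simps)
  ultimately show ?case using 4(1,2) by simp
qed simp_all

text \<open>A nonzero value can only be found at a node of the trie, and every node has been visited
  by the check.\<close>

lemma chk_nonzero:
  "chk P t T \<Longrightarrow> look T xs \<noteq> 0 \<Longrightarrow> \<exists>m. P (rev xs @ t) (look T xs) m"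
  "chks P t i Ts \<Longrightarrow> j < length Ts \<Longrightarrow> look (Ts ! j) xs \<noteq> 0 \<Longrightarrow>
     \<exists>m. P (rev xs @ (i + int j) # t) (look (Ts ! j) xs) m"
proof (induction P t T and P t i Ts arbitrary: xs and j xs rule: chk_chks.induct)
  case (2 P t f m Ts)
  show ?case
  proof (cases xs)
    case Nil
    then show ?thesis using 2 by auto
  next
    case (Cons r ys)
    then show ?thesis using 2(1)[of "nat r" ys] 2(2,3) by (auto split: if_splits)
  qed
next
  case (4 P t i T Ts)
  show ?case
  proof (cases j)
    case 0
    then show ?thesis using 4(1)[of xs] 4(3,5) by simp
  next
    case (Suc k)
    then show ?thesis using 4(2)[of k xs] 4(3,4,5) by (simp add: algebra_simps)
  qed
qed simp_all

lemma finite_look: "finite {xs. look T xs \<noteq> 0}"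
proof (induction T)
  case (N f m Ts)
  have "{xs. look (N f m Ts) xs \<noteq> 0}
      \<subseteq> insert [] (\<Union>j<length Ts. (#) (int j) ` {xs. look (Ts ! j) xs \<noteq> 0})"
  proof
    fix xs assume xs: "xs \<in> {xs. look (N f m Ts) xs \<noteq> 0}"
    show "xs \<in> insert [] (\<Union>j<length Ts. (#) (int j) ` {xs. look (Ts ! j) xs \<noteq> 0})"
    proof (cases xs)
      case (Cons r ys)
      then show ?thesis
        using xs by (auto split: if_splits intro!: bexI[of _ "nat r"] image_eqI[of _ _ ys])
    qed simp
  qed
  moreover have "finite {xs. look (Ts ! j) xs \<noteq> 0}" if "j < length Ts" for j
    using N that by (simp add: nth_mem)
  ultimately show ?case by (auto intro: finite_subset)
qed simp

lemma finite_look_rev: "finite {t. 0 < real_of_int (look T (rev t))}"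
proof (rule finite_subset)
  show "{t. 0 < real_of_int (look T (rev t))} \<subseteq> rev ` {xs. look T xs \<noteq> 0}"
    by (auto intro!: image_eqI[of _ rev "rev _"])
qed (simp add: finite_look)

section \<open>The inequality at a vertex in integer form\<close>

definition mask_letters :: "int \<Rightarrow> letter list" where
  "mask_letters m =
     (if odd m then [LA] else []) @ (if odd (m div 2) then [LA_inv] else []) @
     (if odd (m div 4) then [LB] else []) @ (if odd (m div 8) then [LB_inv] else [])"

lemma mask_letters_simps:
  "mask_letters 0 = []" "mask_letters 1 = [LA]" "mask_letters 2 = [LA_inv]"
  "mask_letters 3 = [LA, LA_inv]" "mask_letters 4 = [LB]" "mask_letters 5 = [LA, LB]"
  "mask_letters 6 = [LA_inv, LB]" "mask_letters 7 = [LA, LA_inv, LB]"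
  "mask_letters 8 = [LB_inv]" "mask_letters 9 = [LA, LB_inv]" "mask_letters 10 = [LA_inv, LB_inv]"
  "mask_letters 11 = [LA, LA_inv, LB_inv]" "mask_letters 12 = [LB, LB_inv]"
  "mask_letters 13 = [LA, LB, LB_inv]" "mask_letters 14 = [LA_inv, LB, LB_inv]"
  "mask_letters 15 = [LA, LA_inv, LB, LB_inv]"
  by (simp_all add: mask_letters_def)

lemma distinct_mask_letters: "distinct (mask_letters m)"
  by (simp add: mask_letters_def)

text \<open>Like \<open>degree_weight\<close> below, a recursion that the simplifier can unfold on
  an explicit list of letters; \<open>nbr_sum_eq\<close> and \<open>degree_weight_eq\<close>
  translate back.\<close>

fun nbr_sum :: "('s \<Rightarrow> int) \<Rightarrow> (letter \<Rightarrow> 's) \<Rightarrow> letter list \<Rightarrow> int" where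
  "nbr_sum F g [] = 0"
| "nbr_sum F g (l # ls) = F (g l) + nbr_sum F g ls"

fun degree_weight :: "int \<Rightarrow> int \<Rightarrow> letter list \<Rightarrow> int" where
  "degree_weight c d [] = c"
| "degree_weight c d (l # ls) = d + degree_weight c d ls"

lemma nbr_sum_eq: "nbr_sum F g ls = (\<Sum>l\<leftarrow>ls. F (g l))"
  by (induction ls) auto

lemma degree_weight_eq: "degree_weight c d ls = c + int (length ls) * d"
  by (induction ls) (auto simp: algebra_simps)

text \<open>With \<open>al = P / Q\<close>, \<open>a = P Q\<close>, \<open>c = P\<^sup>2 - Q\<^sup>2\<close> and \<open>d = Q\<^sup>2\<close> this is the core inequality at \<open>t\<close>.\<close>

definition bs_ok ::
    "int \<Rightarrow> int \<Rightarrow> int \<Rightarrow> int \<Rightarrow> int \<Rightarrow> (int list \<Rightarrow> int) \<Rightarrow> int list \<Rightarrow> int \<Rightarrow> int \<Rightarrow> bool" where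
  "bs_ok p q a c d F t f m \<longleftrightarrow> 0 \<le> f \<and>
     f * degree_weight c d (mask_letters m) \<le> a * nbr_sum F (bs_step p q t) (mask_letters m)"

lemma ratio_square_ge:
  fixes P Q :: int
  assumes "0 < Q" "3 * Q\<^sup>2 \<le> P\<^sup>2"
  shows "3 \<le> (real_of_int P / real_of_int Q)\<^sup>2"
proof -
  have "real_of_int (3 * Q\<^sup>2) \<le> real_of_int (P\<^sup>2)" using assms(2) by (simp only: of_int_le_iff)
  then show ?thesis using assms(1) by (simp add: power_divide field_simps)
qed

text \<open>Multiplication by \<open>P * Q\<close> clears the denominators: with
  \<open>al = P / Q\<close>, the term \<open>al\<close> becomes \<open>P\<^sup>2\<close> and
  \<open>1 / al\<close> becomes \<open>Q\<^sup>2\<close>.\<close>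

lemma core_ineq_of_int:
  fixes P Q f s :: int and n :: nat
  assumes "0 < P" "0 < Q" and "f * (P\<^sup>2 - Q\<^sup>2 + int n * Q\<^sup>2) \<le> P * Q * s"
  shows "(real_of_int P / real_of_int Q + (real n - 1) / (real_of_int P / real_of_int Q)) * real_of_int f
    \<le> real_of_int s"
proof -
  let ?P = "real_of_int P" and ?Q = "real_of_int Q"
  have "real_of_int (f * (P\<^sup>2 - Q\<^sup>2 + int n * Q\<^sup>2)) \<le> real_of_int (P * Q * s)"
    using assms(3) by (simp only: of_int_le_iff)
  then have "real_of_int f * (?P\<^sup>2 - ?Q\<^sup>2 + n * ?Q\<^sup>2) \<le> ?P * ?Q * s" by simp
  then have "real_of_int f * (?P\<^sup>2 - ?Q\<^sup>2 + n * ?Q\<^sup>2) / (?P * ?Q) \<le> ?P * ?Q * s / (?P * ?Q)"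
    using assms by (intro divide_right_mono) auto
  moreover have "?P * ?Q * s / (?P * ?Q) = s" using assms by simp
  moreover have "(?P / ?Q + (real n - 1) / (?P / ?Q)) * real_of_int f
      = real_of_int f * (?P\<^sup>2 - ?Q\<^sup>2 + n * ?Q\<^sup>2) / (?P * ?Q)"
    using assms by (simp add: field_simps power2_eq_square)
  ultimately show ?thesis by simp
qed

lemma rho_BS_ge:
  fixes p q :: nat and P Q :: int and T :: "int trie"
  assumes pq: "0 < p" "0 < q" and PQ: "0 < P" "0 < Q" "3 * Q\<^sup>2 \<le> P\<^sup>2"
    and ok: "chk (bs_ok (int p) (int q) (P * Q) (P\<^sup>2 - Q\<^sup>2) (Q\<^sup>2) (\<lambda>t. look T (rev t))) [] T"
    and root: "look T [] \<noteq> 0"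
  shows "ereal (P / Q + 3 / (P / Q)) \<le> rho (BS p q) (gen_a (BS_relators p q)) (gen_b (BS_relators p q))"
proof -
  let ?R = "BS_relators p q" and ?G = "BS p q"
  interpret group ?G unfolding BS_def by (rule group_presented_group)
  have gens: "gen_a ?R \<in> carrier ?G" "gen_b ?R \<in> carrier ?G"
    by (simp_all add: BS_def gen_a_def gen_b_def pres_class_in_carrier)
  define F where "F t = look T (rev t)" for t
  have okF: "\<exists>m. bs_ok p q (P * Q) (P\<^sup>2 - Q\<^sup>2) (Q\<^sup>2) F t (F t) m" if "F t \<noteq> 0" for t
    using chk_nonzero(1)[OF ok, of "rev t"] that by (simp add: F_def[abs_def])
  have F0: "0 \<le> F t" for t
    using okF[of t] by (cases "F t = 0") (auto simp: bs_ok_def)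
  show ?thesis
  proof (rule rho_ge_bs[OF gens _ _ BS_relation, where f = "\<lambda>t. real_of_int (F t)" and ?t0.0 = "[]"])
    show "finite {t. 0 < real_of_int (F t)}" unfolding F_def by (rule finite_look_rev)
    show "0 < real_of_int (F [])" using root F0[of "[]"] by (simp add: F_def)
    show "3 \<le> (real_of_int P / real_of_int Q)\<^sup>2" by (rule ratio_square_ge[OF PQ(2,3)])
    fix t assume "0 < real_of_int (F t)"
    then obtain m where m: "bs_ok p q (P * Q) (P\<^sup>2 - Q\<^sup>2) (Q\<^sup>2) F t (F t) m"
      using okF[of t] by auto
    let ?ls = "mask_letters m"
    have sum_list: "real_of_int (\<Sum>l\<leftarrow>ls. h l) = (\<Sum>l\<leftarrow>ls. real_of_int (h l))"
      for ls :: "letter list" and h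
      by (induction ls) auto
    have "(real_of_int P / real_of_int Q + (real (length ?ls) - 1) / (real_of_int P / real_of_int Q)) * real_of_int (F t)
        \<le> real_of_int (\<Sum>l\<leftarrow>?ls. F (bs_step p q t l))"
      using m PQ by (intro core_ineq_of_int) (auto simp: bs_ok_def nbr_sum_eq degree_weight_eq)
    also have "\<dots> = (\<Sum>l\<leftarrow>?ls. real_of_int (F (bs_step p q t l)))"
      by (rule sum_list)
    finally show "\<exists>ls. distinct ls \<and>
        (real_of_int P / real_of_int Q + (real (length ls) - 1) / (real_of_int P / real_of_int Q)) * real_of_int (F t)
        \<le> (\<Sum>l\<leftarrow>ls. real_of_int (F (bs_step p q t l)))"
      using distinct_mask_letters by blast
  qed (use pq PQ F0 in auto)
qed

section \<open>The group BS(2, 2)\<close>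

text \<open>Here carries of \<open>b\<^sup>2\<close> act trivially, so the weight can be taken to be a product over the
  digits of a normal form, with factors depending on the parity of the digit and on the remaining
  depth. The factors solve, up to rounding, the recursion \<open>weights_ineq\<close> with a slightly larger constant
  than \<open>1567 / 418 = 57 / 22 + 3 / (57 / 22)\<close>.\<close>

definition even_weights :: "real list" where
  "even_weights = [0, 0.372, 0.487, 0.546, 0.586, 0.617, 0.645, 0.672, 0.702, 0.740, 0.796, 0.902]"

definition odd_weights :: "real list" where
  "odd_weights = [0, 0.198, 0.323, 0.393, 0.440, 0.478, 0.512, 0.545, 0.583, 0.630, 0.700, 0.835]"

lemma weights_nonneg: "k \<le> 11 \<Longrightarrow> 0 \<le> even_weights ! k" "k \<le> 11 \<Longrightarrow> 0 \<le> odd_weights ! k"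
proof -
  have "\<forall>w\<in>set even_weights \<union> set odd_weights. 0 \<le> w" "length even_weights = 12" "length odd_weights = 12"
    by (simp_all add: even_weights_def odd_weights_def)
  then show "k \<le> 11 \<Longrightarrow> 0 \<le> even_weights ! k" "k \<le> 11 \<Longrightarrow> 0 \<le> odd_weights ! k"
    by (simp_all add: nth_mem)
qed

text \<open>The inequality at a vertex, divided by the weight of the digits before the last one. At
  an even last digit the neighbours are the parent, with value 1, the odd sibling reached by both
  \<open>b\<close>-edges, and one child. At an odd one both \<open>b\<close>-edges lead to the even
  sibling, and both \<open>a\<close> and its inverse lead to children.\<close>

lemma weights_ineq:
  assumes "k < 11"
  shows "1567 / 418 * even_weights ! Suc k
      \<le> 1 + 2 * odd_weights ! Suc k + even_weights ! Suc k * even_weights ! k"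
    and "1567 / 418 * odd_weights ! Suc k
      \<le> 2 * even_weights ! Suc k + 2 * odd_weights ! Suc k * even_weights ! k"
proof -
  have "k = 0 \<or> k = 1 \<or> k = 2 \<or> k = 3 \<or> k = 4 \<or> k = 5 \<or> k = 6 \<or> k = 7 \<or> k = 8 \<or> k = 9 \<or> k = 10"
    using assms by presburger
  then show "1567 / 418 * even_weights ! Suc k
      \<le> 1 + 2 * odd_weights ! Suc k + even_weights ! Suc k * even_weights ! k"
    and "1567 / 418 * odd_weights ! Suc k
      \<le> 2 * even_weights ! Suc k + 2 * odd_weights ! Suc k * even_weights ! k"
    by (auto simp: even_weights_def odd_weights_def)
qed

text \<open>The conditions on \<open>take 1 t\<close> forbid a letter directly after its inverse, so
  the support consists of normal forms with at most 11 digits.\<close>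

fun bs22_weight :: "int list \<Rightarrow> real" where
  "bs22_weight [] = 1"
| "bs22_weight (r # t) =
     (if r \<in> {0, 1, 2, 3} \<and> length t < 11 \<and> (r \<le> 1 \<longrightarrow> take 1 t \<noteq> [2]) \<and> (2 \<le> r \<longrightarrow> take 1 t \<noteq> [0])
      then (if even r then even_weights else odd_weights) ! (11 - length t) * bs22_weight t else 0)"

lemma bs22_weight_nonneg: "0 \<le> bs22_weight t"
  by (induction t) (auto simp: weights_nonneg)

lemma bs22_weight_support: "bs22_weight t \<noteq> 0 \<Longrightarrow> set t \<subseteq> {0, 1, 2, 3} \<and> length t \<le> 11"
  by (induction t) (auto split: if_splits)

text \<open>In BS(2, 2) the element \<open>b\<^sup>2\<close> is central, so a carry of 2 or -2
  passes each digit and arrives unchanged at the next one.\<close>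

lemma odometer_22_even:
  "set t \<subseteq> {0, 1, 2, 3} \<Longrightarrow> c \<in> {- 2, 2} \<Longrightarrow> odometer (carry 2 2) c t = t"
  by (induction t) (auto simp: carry_def)

lemma odometer_22:
  assumes "set (r # t) \<subseteq> {0, 1, 2, 3}" "c \<in> {- 1, 1}"
  shows "odometer (carry 2 2) c (r # t) = (if even r then r + 1 else r - 1) # t"
  using assms odometer_22_even[of t 2] odometer_22_even[of t "- 2"] by (auto simp: carry_def)

lemma bs22_ineq:
  assumes "0 < bs22_weight t"
  shows "1567 / 418 * bs22_weight t \<le> (\<Sum>l\<leftarrow>[LA, LA_inv, LB, LB_inv]. bs22_weight (bs_step 2 2 t l))"
proof (cases t)
  case Nil
  \<comment> \<open>At the trivial coset both \<open>b\<close>-edges are loops of weight 1, and the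
    two \<open>a\<close>-edges lead to the digits 0 and 2 at full remaining depth.\<close>
  then show ?thesis by (simp add: even_weights_def)
next
  case (Cons r u)
  have set: "set (r # u) \<subseteq> {0, 1, 2, 3}" and len: "length u < 11"
    using bs22_weight_support[of t] assms by (auto simp: Cons)
  define g where "g = bs22_weight u"
  have g: "0 \<le> g" by (simp add: g_def bs22_weight_nonneg)
  define k where "k = 10 - length u"
  have k: "k < 11" "11 - length u = Suc k" using len by (auto simp: k_def)
  define e where "e = even_weights ! Suc k"
  define d where "d = odd_weights ! Suc k"
  define e' where "e' = even_weights ! k"
  have "r \<in> {0, 1, 2, 3} \<and> length u < 11 \<and> (r \<le> 1 \<longrightarrow> take 1 u \<noteq> [2]) \<and> (2 \<le> r \<longrightarrow> take 1 u \<noteq> [0])"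
    (is ?V)
  proof (rule ccontr)
    assume "\<not> ?V"
    then have "bs22_weight t = 0" unfolding Cons bs22_weight.simps by (rule if_not_P)
    with assms show False by simp
  qed
  then have valid: "r = 0 \<or> r = 1 \<or> r = 2 \<or> r = 3" "r \<le> 1 \<Longrightarrow> take 1 u \<noteq> [2]" "2 \<le> r \<Longrightarrow> take 1 u \<noteq> [0]"
    by auto
  have val: "bs22_weight (r # u) = (if even r then e else d) * g"
    using valid len k by (auto simp: e_def d_def g_def)
  have flip: "bs22_weight ((if even r then r + 1 else r - 1) # u) = (if even r then d else e) * g"
    using valid len k by (auto simp: e_def d_def g_def)
  have child: "bs22_weight (s # r # u) = e' * bs22_weight (r # u)"
    if "s \<in> {0, 2}" "s = 0 \<Longrightarrow> r \<noteq> 2" "s = 2 \<Longrightarrow> r \<noteq> 0" for s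
  \<comment> \<open>On the last level a further digit leaves the support, which matches the entry 0
    at the start of \<open>even_weights\<close>.\<close>
  proof (cases "length u = 10")
    case True
    then have "e' = 0" by (simp add: e'_def k_def even_weights_def)
    with True show ?thesis by simp
  next
    case False
    then have "11 - length (r # u) = k" "length (r # u) < 11" using len by (auto simp: k_def)
    then show ?thesis using that by (auto simp: e'_def)
  qed
  have step: "bs22_weight (bs_step 2 2 t LB) = (if even r then d else e) * g"
      "bs22_weight (bs_step 2 2 t LB_inv) = (if even r then d else e) * g"
    using odometer_22[OF set] flip by (simp_all add: Cons)
  have w: "1567 / 418 * e \<le> 1 + 2 * d + e * e'" "1567 / 418 * d \<le> 2 * e + 2 * d * e'"
    using weights_ineq[OF k(1)] by (simp_all add: e_def d_def e'_def)
  show ?thesis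
  proof (cases "even r")
    case True
    then have "r = 0 \<or> r = 2" using set by auto
    then have "bs22_weight (bs_step 2 2 t LA) + bs22_weight (bs_step 2 2 t LA_inv) = g + e' * (e * g)"
      using child[of 0] child[of 2] val True by (auto simp: Cons g_def)
    moreover have "1567 / 418 * e * g \<le> (1 + 2 * d + e * e') * g"
      using w(1) g by (rule mult_right_mono)
    ultimately show ?thesis using step val True by (simp add: Cons algebra_simps)
  next
    case False
    then have "r = 1 \<or> r = 3" using set by auto
    then have "bs22_weight (bs_step 2 2 t LA) + bs22_weight (bs_step 2 2 t LA_inv) = 2 * (e' * (d * g))"
      using child[of 0] child[of 2] val False by (auto simp: Cons)
    moreover have "1567 / 418 * d * g \<le> (2 * e + 2 * d * e') * g"
      using w(2) g by (rule mult_right_mono)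
    ultimately show ?thesis using step val False by (simp add: Cons algebra_simps)
  qed
qed

lemma rho_BS_2_2:
  "ereal (57 / 22 + 3 / (57 / 22)) \<le> rho (BS 2 2) (gen_a (BS_relators 2 2)) (gen_b (BS_relators 2 2))"
proof -
  let ?R = "BS_relators 2 2" and ?G = "BS 2 2"
  interpret group ?G unfolding BS_def by (rule group_presented_group)
  have gens: "gen_a ?R \<in> carrier ?G" "gen_b ?R \<in> carrier ?G"
    by (simp_all add: BS_def gen_a_def gen_b_def pres_class_in_carrier)
  have rel: "gen_a ?R \<otimes>\<^bsub>?G\<^esub> gen_b ?R [^]\<^bsub>?G\<^esub> (2 :: int) = gen_b ?R [^]\<^bsub>?G\<^esub> (2 :: int) \<otimes>\<^bsub>?G\<^esub> gen_a ?R"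
    using BS_relation[of 2 2] by simp
  show ?thesis
  proof (rule rho_ge_bs[OF gens _ _ rel, where f = bs22_weight and ?t0.0 = "[]"])
    show "finite {t. 0 < bs22_weight t}"
    proof (rule finite_subset)
      show "{t. 0 < bs22_weight t} \<subseteq> {t. set t \<subseteq> {0, 1, 2, 3} \<and> length t \<le> 11}"
      proof (rule Collect_mono, rule impI)
        fix t assume "0 < bs22_weight t"
        then have "bs22_weight t \<noteq> 0" by simp
        then show "set t \<subseteq> {0, 1, 2, 3} \<and> length t \<le> 11" by (rule bs22_weight_support)
      qed
    qed (rule finite_lists_length_le, simp)
    fix t assume "0 < bs22_weight t"
    then show "\<exists>ls. distinct ls \<and> (57 / 22 + (real (length ls) - 1) / (57 / 22)) * bs22_weight t
        \<le> (\<Sum>l\<leftarrow>ls. bs22_weight (bs_step 2 2 t l))"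
      using bs22_ineq by (intro exI[of _ "[LA, LA_inv, LB, LB_inv]"]) (simp del: sum_list.Cons list.map)
  qed (auto simp: bs22_weight_nonneg power2_eq_square)
qed

section \<open>The groups BS(2, 3) and BS(3, 5)\<close>

text \<open>The tables are integer approximations, rounded to satisfy the inequalities exactly, of the
  principal eigenvectors of finite subgraphs that were found by repeatedly deleting the cosets of
  smallest weight.\<close>

abbreviation "B f \<equiv> N f (12 :: int) []"
abbreviation "U f ts \<equiv> N f (15 :: int) ts"
abbreviation "V f ts \<equiv> N f (13 :: int) ts"
abbreviation "C f \<equiv> N f (13 :: int) []"
abbreviation "D f \<equiv> N f (14 :: int) []"

text \<open>The constants \<open>bs23_1\<close> to \<open>bs23_7\<close> are subtries of
  \<open>bs23_table\<close>. They are cut out so that each simplification has to deal with only part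
  of the entries.\<close>

definition bs23_1 :: "int trie" where
"bs23_1 = U 2251 [U 1812 [U 1266 [U 814 [U 482 [U 262 [D 127,B 79],V 177 [D 97,B 72]],U 347 [U 213 [D 109,B
73],V 171 [D 96,B 73],C 159,B 85,B 84]],U 617 [U 425 [U 245 [D 124,B 79],V 174 [D 99,B 75]],U 352
[U 224 [D 115,B 76],V 175 [D 102,B 76],C 162,B 88,B 88],C 284,B 153,B 152]],U 1006 [U 726 [U 445
[U 242 [D 119,B 69],V 165 [D 95,B 73]],U 330 [D 203,V 168 [D 96,B 71],C 151,B 82,B 83]],U 610 [U
411 [U 231 [D 117,B 75],V 163 [D 96,B 78]],U 327 [D 195,B 146,C 151,B 82,B 82],C 281,B 152,B
152],U 500 [E,E,C 220,B 108,B 88],U 303 [D 163,B 115,C 144,B 89,B 109],U 304 [D 164,B 115,C 144,B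
78,B 78]]],U 1567 [U 1193 [U 777 [U 463 [U 241 [N 109 6 [],B 71],V 160 [N 80 6 [],B 69]],U 340 [U
212 [D 110,B 73],B 161,C 156,B 84,B 83]],U 595 [U 404 [D 223,V 161 [D 93,B 74]],U 335 [D 192,B
142,C 154,B 83,B 83],C 275,B 150,B 152]],U 1007 [U 730 [U 445 [U 242 [D 119,B 76],B 160],U 332 [U
208 [N 97 6 [],B 68],V 175 [D 99,B 73],C 152,B 83,B 84]],U 605 [U 423 [U 244 [D 123,B 79],V 174 [D
102,B 82]],U 345 [U 223 [D 115,B 75],V 175 [D 102,B 76],C 159,B 86,B 86],C 279,B 151,B 151],U 501
[E,E,C 221,B 109,B 89],U 303 [D 163,B 115,C 144,B 88,B 108],U 303 [D 163,B 115,C 144,B 78,B 78]],U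
798 [E,E,C 353,B 175,B 145],U 502 [U 302 [D 154,B 100],V 226 [D 131,B 100],C 239,B 145,B 175],U
502 [U 302 [D 154,B 100],V 225 [D 130,B 100],C 239,B 130,B 130]],U 1204 [E,E,U 564 [E,E,C 244,B
115,B 83],U 309 [D 159,B 103,C 144,B 82,B 89],U 267 [D 145,B 98,N 123 9 []]],U 799 [U 521 [U 297
[D 149,B 95],V 209 [D 121,B 95]],U 407 [U 262 [D 135,B 90],V 209 [D 121,B 90],C 187,B 101,B 101],U
404 [E,E,N 174 5 [],B 90,B 82],U 268 [D 145,B 107,N 124 5 [],B 84,B 115],U 309 [D 159,B 107,C
144,B 78,B 78]],U 798 [U 521 [U 297 [D 149,B 95],V 209 [D 121,B 95]],U 407 [U 262 [D 135,B 90],V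
209 [D 121,B 90],C 187,B 101,B 101],U 403 [E,E,N 173 9 []],V 239 [D 135,B 98],V 239 [D 135,B
103]]]"

definition bs23_2 :: "int trie" where
"bs23_2 = U 2251 [U 1812 [U 1265 [U 811 [U 481 [U 262 [D 127,B 73],V 175 [D 99,B 74]],U 345 [U 213 [D 110,B
72],B 160,C 158,B 84,B 83]],U 612 [U 416 [U 234 [N 108 10 []],V 166 [D 96,B 75]],U 341 [U 212 [D
109,B 72],B 156,C 156,B 84,B 84],C 282,B 152,B 151]],U 1005 [U 725 [U 444 [U 238 [N 108 6 [],B
71],B 158],U 333 [U 208 [N 97 6 [],B 69],V 174 [D 99,B 75],C 153,B 83,B 84]],U 613 [U 416 [U 240
[D 122,B 79],V 172 [D 101,B 82]],U 332 [D 201,V 162 [D 93,B 72],C 153,B 83,B 83],C 282,B 153,B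
153],U 500 [E,E,C 220,B 108,B 89],U 304 [D 164,B 115,C 144,B 89,B 109],U 306 [D 165,B 116,C 145,B
78,B 78]]],U 1554 [U 1190 [U 780 [U 461 [U 241 [D 117,B 73],B 154],U 335 [D 201,V 165 [D 95,B
72],C 154,B 83,B 82]],U 603 [U 421 [U 243 [D 123,B 79],V 175 [D 102,B 81]],U 355 [U 224 [D 115,B
76],V 175 [D 101,B 76],C 163,B 88,B 88],C 278,B 151,B 152]],U 1006 [U 733 [U 455 [U 250 [N 114 10
[]],V 173 [D 99,B 76]],U 341 [U 220 [D 114,B 75],V 179 [D 100,B 69],C 157,B 85,B 85]],U 605 [U 419
[U 236 [N 108 10 []],V 167 [D 96,B 73]],U 341 [U 220 [D 113,B 73],V 170 [D 99,B 73],C 156,B 84,B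
84],C 279,B 151,B 151],U 500 [E,E,C 220,B 108,B 88],U 303 [D 163,B 114,C 144,B 89,B 109],U 303 [D
163,B 115,C 144,B 78,B 78]],U 793 [E,E,C 351,B 174,B 145],U 500 [U 301 [D 154,B 100],V 225 [D
130,B 100],C 238,B 145,B 174],U 500 [U 301 [D 154,B 100],V 225 [D 130,B 100],C 238,B 129,B 129]],U
1204 [E,E,U 564 [E,E,C 244,B 115,B 84],U 309 [D 159,B 103,C 144,B 82,B 90],U 268 [D 145,B 98,N 124
9 []]],U 799 [U 521 [U 297 [D 149,B 95],V 209 [D 121,B 95]],U 407 [U 262 [D 135,B 90],V 209 [D
121,B 90],C 187,B 101,B 101],U 404 [E,E,N 174 5 [],B 90,B 82],U 268 [D 145,B 107,N 124 5 [],B 84,B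
115],U 309 [D 159,B 107,C 144,B 78,B 78]],U 799 [U 521 [U 297 [D 149,B 95],V 209 [D 121,B 95]],U
407 [U 262 [D 135,B 90],V 209 [D 121,B 90],C 187,B 101,B 101],U 404 [E,E,N 174 9 []],V 239 [D
135,B 98],V 239 [D 135,B 103]]]"

definition bs23_3 :: "int trie" where
"bs23_3 = U 2956 [U 2552 [U 1900 [U 1300 [U 826 [U 493 [U 270 [D 133,B 82],V 183 [D 104,B 80]],U 356 [U 225
[D 116,B 77],V 180 [D 103,B 76],C 163,B 88,B 87]],U 618 [U 425 [U 245 [D 123,B 79],V 175 [D 102,B
81]],U 351 [U 223 [D 115,B 76],V 175 [D 101,B 76],C 161,B 87,B 87],C 284,B 153,B 152]],U 1019 [U
735 [U 454 [U 250 [N 114 10 []],V 172 [D 99,B 76]],U 337 [U 211 [D 109,B 71],B 161,C 155,B 84,B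
84]],U 614 [U 421 [U 242 [D 122,B 79],V 173 [D 101,B 81]],U 341 [U 220 [D 113,B 75],V 172 [D 100,B
75],C 156,B 84,B 84],C 283,B 153,B 153],U 505 [E,E,C 222,B 109,B 89],U 305 [D 164,B 115,C 145,B
89,B 109],U 304 [D 164,B 115,C 144,B 78,B 78]]],U 1554 [U 1190 [U 776 [U 462 [U 249 [D 123,B 76],B
160],U 333 [D 197,V 155 [N 78 10 []],C 153,B 82,B 82]],U 596 [U 403 [U 220 [D 111,B 72],B 147],U
336 [D 202,V 156 [N 79 10 []],C 154,B 83,B 83],C 275,B 150,B 151]],U 1022 [U 734 [U 457 [U 256 [D
127,B 80],V 179 [D 102,B 79]],U 342 [U 220 [D 113,B 76],V 182 [D 102,B 76],C 157,B 85,B 87]],U 603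
[U 418 [U 237 [D 120,B 78],V 165 [N 84 6 [],B 75]],U 342 [U 222 [D 115,B 76],V 175 [D 102,B 76],C
157,B 85,B 85],C 278,B 151,B 151],U 507 [E,E,C 223,B 110,B 90],U 307 [D 165,B 116,C 146,B 90,B
110],U 307 [D 165,B 115,C 146,B 78,B 78]],U 793 [E,E,C 351,B 174,B 145],U 500 [U 301 [D 154,B
100],V 225 [D 130,B 100],C 238,B 145,B 175],U 502 [U 302 [D 154,B 100],V 226 [D 131,B 100],C 239,B
130,B 130]]],bs23_2,U 1643 [E,E,U 794 [E,E,C 347,B 167,B 128],U 460 [U 265 [D 133,B 84],V 188 [D
108,B 82],C 215,B 124,B 137],U 411 [U 249 [D 127,B 82],V 183 [D 107,B 84],C 198,B 105,B 101]],U
1134 [U 780 [U 480 [U 268 [D 133,B 83],V 185 [D 106,B 82]],U 356 [U 228 [D 118,B 78],V 185 [D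
106,B 78],C 164,B 89,B 89]],U 622 [U 432 [U 250 [D 127,B 82],V 179 [D 104,B 83]],U 356 [U 228 [D
118,B 78],V 179 [D 104,B 78],C 164,B 89,B 89],C 287,B 156,B 156],U 599 [E,E,C 267,B 137,B 124],U
411 [U 249 [D 127,B 82],V 191 [D 108,B 81],C 198,B 128,B 167],U 460 [U 265 [D 133,B 84],V 191 [D
108,B 81],C 215,B 116,B 116]],U 1134 [U 780 [U 480 [U 268 [D 133,B 83],V 185 [D 106,B 82]],U 356
[U 228 [D 118,B 78],V 185 [D 106,B 78],C 164,B 89,B 89]],U 622 [U 432 [U 250 [D 127,B 82],V 179 [D
104,B 83]],U 356 [U 228 [D 118,B 78],V 179 [D 104,B 78],C 164,B 89,B 89],C 287,B 156,B 156],U 599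
[E,E,C 267,B 133,B 111],U 383 [U 239 [D 123,B 81],V 183 [D 107,B 84],C 183,B 111,B 133],U 383 [U
239 [D 123,B 81],V 188 [D 108,B 82],C 183,B 101,B 105]]]"

definition bs23_4 :: "int trie" where
"bs23_4 = U 2241 [U 1809 [U 1263 [U 804 [U 472 [U 254 [D 126,B 78],B 163],U 336 [D 198,V 163 [D 94,B 71],C
154,B 83,B 82]],U 605 [U 410 [U 232 [N 107 10 []],V 166 [D 97,B 77]],U 340 [U 218 [D 113,B 75],V
171 [D 99,B 74],C 155,B 84,B 84],C 279,B 151,B 150]],U 1008 [U 732 [U 456 [U 255 [D 125,B 79],V
178 [D 102,B 79]],U 343 [U 218 [D 112,B 75],V 179 [D 102,B 76],C 158,B 86,B 87]],U 615 [U 412 [U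
230 [D 116,B 75],V 159 [N 81 6 [],B 73]],U 329 [D 197,V 158 [D 92,B 70],C 151,B 82,B 82],C 283,B
153,B 153],U 501 [E,E,C 221,B 109,B 89],U 303 [D 163,B 115,C 144,B 89,B 109],U 304 [D 164,B 115,C
144,B 78,B 78]]],U 1570 [U 1196 [U 789 [U 479 [U 265 [D 131,B 81],V 180 [D 101,B 73]],U 352 [U 223
[D 115,B 75],V 176 [D 101,B 74],C 162,B 87,B 86]],U 608 [U 424 [U 244 [D 123,B 78],V 174 [D 99,B
75]],U 356 [U 224 [D 115,B 74],V 171 [D 99,B 73],C 163,B 88,B 88],C 280,B 153,B 155]],U 1005 [U
723 [U 441 [U 241 [D 118,B 69],V 165 [D 95,B 73]],U 327 [D 203,V 170 [D 97,B 72],C 151,B 82,B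
83]],U 595 [U 406 [D 215,B 143],U 334 [U 216 [D 111,B 73],V 168 [D 99,B 73],C 154,B 83,B 82],C
275,B 149,B 149],U 499 [E,E,C 219,B 108,B 88],U 302 [D 163,B 115,C 144,B 89,B 109],U 303 [D 163,B
115,C 144,B 78,B 78]],U 799 [E,E,C 353,B 175,B 145],U 503 [U 302 [D 154,B 100],V 226 [D 131,B
100],C 239,B 145,B 175],U 503 [U 302 [D 154,B 100],V 225 [D 130,B 100],C 239,B 130,B 130]],U 1201
[E,E,U 562 [E,E,C 243,B 115,B 84],U 309 [D 159,B 103,C 144,B 82,B 90],U 268 [D 145,B 98,N 124 9
[]]],U 798 [U 521 [U 297 [D 149,B 95],V 209 [D 121,B 95]],U 407 [U 262 [D 135,B 90],V 209 [D 121,B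
90],C 187,B 101,B 101],U 403 [E,E,N 173 5 [],B 89,B 82],U 267 [D 145,B 107,N 123 5 [],B 83,B
115],U 309 [D 159,B 107,C 144,B 78,B 78]],U 799 [U 521 [U 297 [D 149,B 95],V 209 [D 121,B 95]],U
407 [U 262 [D 135,B 90],V 209 [D 121,B 90],C 187,B 101,B 101],U 404 [E,E,N 174 9 []],V 239 [D
135,B 98],V 239 [D 135,B 103]]]"

definition bs23_5 :: "int trie" where
"bs23_5 = U 2241 [U 1809 [U 1264 [U 810 [U 483 [U 267 [D 132,B 82],V 182 [D 103,B 79]],U 349 [U 218 [D 112,B
75],V 176 [D 100,B 75],C 160,B 86,B 85]],U 609 [U 407 [U 225 [D 114,B 73],V 155 [N 78 6 [],B
69]],U 333 [D 201,V 156 [N 79 10 []],C 153,B 83,B 83],C 280,B 151,B 151]],U 1007 [U 735 [U 454 [U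
249 [N 113 6 [],B 74],V 175 [D 100,B 78]],U 341 [U 219 [D 113,B 76],V 179 [D 100,B 75],C 156,B
84,B 85]],U 623 [U 427 [U 245 [D 123,B 78],V 174 [D 101,B 80]],U 344 [U 220 [D 113,B 73],V 170 [D
99,B 73],C 158,B 85,B 85],C 287,B 155,B 155],U 501 [E,E,C 221,B 109,B 89],U 304 [D 164,B 115,C
144,B 89,B 109],U 306 [D 165,B 116,C 145,B 78,B 78]]],U 1554 [U 1191 [U 780 [U 465 [U 246 [N 112
10 []],V 164 [D 94,B 72]],U 339 [U 211 [D 109,B 71],B 159,C 155,B 83,B 82]],U 600 [U 415 [U 240 [D
122,B 78],V 172 [D 100,B 79]],U 343 [D 201,V 151 [N 77 10 []],C 157,B 85,B 85],C 277,B 151,B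
152]],U 1005 [U 727 [U 448 [U 246 [D 123,B 77],V 170 [D 98,B 76]],U 337 [U 219 [D 113,B 76],V 181
[D 103,B 76],C 155,B 84,B 85]],U 596 [U 402 [D 212,V 147 [N 75 6 [],B 67]],U 326 [U 201 [N 94 10
[]],B 150,C 150,B 81,B 81],C 275,B 149,B 150],U 500 [E,E,C 220,B 108,B 88],U 303 [D 163,B 114,C
144,B 88,B 108],U 303 [D 163,B 115,C 144,B 78,B 78]],U 793 [E,E,C 351,B 174,B 145],U 500 [U 301 [D
154,B 100],V 225 [D 130,B 100],C 238,B 145,B 174],U 500 [U 301 [D 154,B 100],V 225 [D 130,B 100],C
238,B 129,B 129]],U 1201 [E,E,U 562 [E,E,C 243,B 114,B 83],U 309 [D 159,B 103,C 144,B 82,B 89],U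
267 [D 145,B 98,N 123 9 []]],U 798 [U 521 [U 297 [D 149,B 95],V 209 [D 121,B 95]],U 407 [U 262 [D
135,B 90],V 209 [D 121,B 90],C 187,B 101,B 101],U 403 [E,E,N 173 5 [],B 89,B 82],U 267 [D 145,B
107,N 123 5 [],B 83,B 114],U 309 [D 159,B 107,C 144,B 78,B 78]],U 798 [U 521 [U 297 [D 149,B 95],V
209 [D 121,B 95]],U 407 [U 262 [D 135,B 90],V 209 [D 121,B 90],C 187,B 101,B 101],U 403 [E,E,N 173
9 []],V 239 [D 135,B 98],V 239 [D 135,B 103]]]"

definition bs23_6 :: "int trie" where
"bs23_6 = U 2956 [U 2552 [U 1899 [U 1297 [U 819 [U 484 [U 266 [D 131,B 81],V 179 [D 100,B 72]],U 346 [U 220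
[D 113,B 75],V 176 [D 101,B 75],C 158,B 85,B 84]],U 609 [U 410 [U 228 [D 113,B 67],V 154 [N 76 6
[],B 63]],U 335 [D 201,V 155 [N 78 10 []],C 154,B 83,B 83],C 280,B 151,B 150]],U 1017 [U 728 [U
442 [U 241 [D 118,B 69],V 165 [D 95,B 74]],U 324 [D 191,B 152,C 149,B 81,B 82]],U 611 [U 419 [U
236 [N 109 6 [],B 74],V 171 [D 100,B 82]],U 342 [U 220 [D 114,B 76],V 173 [D 100,B 76],C 157,B
85,B 85],C 281,B 152,B 152],U 504 [E,E,C 222,B 109,B 89],U 304 [D 164,B 115,C 144,B 88,B 108],U
303 [D 163,B 114,C 144,B 78,B 78]]],U 1554 [U 1192 [U 786 [U 478 [U 264 [D 129,B 81],V 181 [D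
103,B 79]],U 351 [U 223 [D 115,B 75],V 179 [D 102,B 76],C 161,B 87,B 86]],U 604 [U 411 [U 225 [N
103 6 [],B 70],B 154],U 345 [U 213 [D 110,B 73],V 167 [D 97,B 73],C 158,B 85,B 85],C 279,B 152,B
153]],U 1023 [U 733 [U 452 [U 243 [D 119,B 69],V 160 [N 79 10 []]],U 339 [U 220 [D 113,B 75],V 181
[D 103,B 75],C 155,B 84,B 84]],U 601 [U 412 [U 231 [D 117,B 75],V 162 [D 95,B 76]],U 332 [U 208 [N
97 10 []],V 159 [N 81 10 []],C 152,B 82,B 82],C 277,B 150,B 150],U 507 [E,E,C 223,B 110,B 90],U
307 [D 165,B 116,C 146,B 90,B 110],U 307 [D 165,B 115,C 146,B 78,B 78]],U 793 [E,E,C 351,B 174,B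
145],U 500 [U 301 [D 154,B 100],V 225 [D 130,B 100],C 238,B 145,B 175],U 502 [U 302 [D 154,B
100],V 226 [D 131,B 100],C 239,B 130,B 130]]],bs23_5,U 1643 [E,E,U 794 [E,E,C 347,B 167,B 128],U
460 [U 265 [D 133,B 84],V 188 [D 108,B 82],C 215,B 124,B 137],U 411 [U 249 [D 127,B 82],V 183 [D
107,B 84],C 198,B 105,B 101]],U 1134 [U 780 [U 480 [U 268 [D 133,B 83],V 185 [D 106,B 82]],U 356
[U 228 [D 118,B 78],V 185 [D 106,B 78],C 164,B 89,B 89]],U 622 [U 432 [U 250 [D 127,B 82],V 179 [D
104,B 83]],U 356 [U 228 [D 118,B 78],V 179 [D 104,B 78],C 164,B 89,B 89],C 287,B 156,B 156],U 599
[E,E,C 267,B 137,B 124],U 411 [U 249 [D 127,B 82],V 191 [D 108,B 81],C 198,B 128,B 167],U 460 [U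
265 [D 133,B 84],V 191 [D 108,B 81],C 215,B 116,B 116]],U 1134 [U 780 [U 480 [U 268 [D 133,B 83],V
185 [D 106,B 82]],U 356 [U 228 [D 118,B 78],V 185 [D 106,B 78],C 164,B 89,B 89]],U 622 [U 432 [U
250 [D 127,B 82],V 179 [D 104,B 83]],U 356 [U 228 [D 118,B 78],V 179 [D 104,B 78],C 164,B 89,B
89],C 287,B 156,B 156],U 599 [E,E,C 267,B 133,B 111],U 383 [U 239 [D 123,B 81],V 183 [D 107,B
84],C 183,B 111,B 133],U 383 [U 239 [D 123,B 81],V 188 [D 108,B 82],C 183,B 101,B 105]]]"

definition bs23_7 :: "int trie" where
"bs23_7 = U 3445 [U 3276 [U 2647 [U 1937 [U 1314 [U 833 [U 495 [U 271 [D 134,B 82],V 182 [D 101,B 73]],U 354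
[U 223 [D 115,B 75],V 176 [D 100,B 73],C 162,B 87,B 85]],U 620 [U 421 [U 236 [N 108 10 []],V 167
[D 97,B 76]],U 348 [U 220 [D 113,B 75],V 172 [D 98,B 74],C 159,B 85,B 85],C 285,B 153,B 152]],U
1021 [U 729 [U 448 [U 252 [D 126,B 79],V 175 [D 100,B 78]],U 327 [D 191,B 152,C 151,B 82,B 83]],U
606 [U 408 [U 227 [D 114,B 73],V 156 [N 78 6 [],B 66]],U 329 [U 206 [D 106,B 70],V 160 [D 94,B
70],C 151,B 82,B 82],C 279,B 151,B 151],U 507 [E,E,C 223,B 109,B 89],U 306 [D 165,B 115,C 145,B
89,B 108],U 304 [D 164,B 115,C 144,B 78,B 78]]],U 1567 [U 1193 [U 781 [U 472 [U 259 [D 126,B 79],V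
177 [D 99,B 78]],U 346 [U 219 [D 113,B 75],V 176 [D 99,B 75],C 158,B 85,B 85]],U 600 [U 413 [U 233
[D 116,B 76],V 164 [N 83 6 [],B 73]],U 344 [D 209,V 167 [D 97,B 73],C 158,B 85,B 86],C 277,B 151,B
152]],U 1019 [U 738 [U 460 [U 258 [D 128,B 79],V 179 [D 100,B 73]],U 345 [U 223 [D 115,B 76],V 183
[D 104,B 76],C 159,B 87,B 88]],U 607 [U 417 [U 235 [N 108 6 [],B 73],V 170 [D 99,B 80]],U 339 [U
217 [D 111,B 73],V 169 [D 98,B 72],C 155,B 84,B 84],C 280,B 152,B 152],U 505 [E,E,C 222,B 109,B
89],U 305 [D 164,B 115,C 145,B 89,B 109],U 305 [D 164,B 115,C 145,B 78,B 78]],U 798 [E,E,C 353,B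
175,B 145],U 502 [U 302 [D 154,B 100],V 225 [D 130,B 100],C 239,B 145,B 174],U 500 [U 301 [D 154,B
100],V 225 [D 130,B 100],C 238,B 129,B 129]]],bs23_4],bs23_6,U 1923 [E,E,U 931 [E,E,C 407,B 196,B
151],U 540 [U 312 [D 157,B 100],V 221 [D 127,B 97],C 253,B 146,B 162],U 483 [U 292 [D 149,B 97],V
215 [D 127,B 100],C 233,B 124,B 119]],U 1334 [U 926 [U 572 [U 321 [D 160,B 100],V 222 [D 127,B
98]],U 425 [U 274 [D 142,B 94],V 222 [D 127,B 94],C 195,B 106,B 106]],U 744 [U 517 [U 300 [D 152,B
98],V 215 [D 125,B 100]],U 425 [U 274 [D 142,B 94],V 215 [D 125,B 94],C 195,B 106,B 106],C 356,V
207 [D 111,B 78],V 207 [D 111,B 78]],U 705 [E,E,C 315,B 162,B 146],U 483 [U 292 [D 149,B 97],V 225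
[D 128,B 96],C 233,B 151,B 196],U 540 [U 312 [D 157,B 100],V 225 [D 128,B 96],C 253,B 137,B
137]],U 1334 [U 926 [U 572 [U 321 [D 160,B 100],V 222 [D 127,B 98]],U 425 [U 274 [D 142,B 94],V
222 [D 127,B 94],C 195,B 106,B 106]],U 744 [U 517 [U 300 [D 152,B 98],V 215 [D 125,B 100]],U 425
[U 274 [D 142,B 94],V 215 [D 125,B 94],C 195,B 106,B 106],C 356,V 207 [D 111,B 78],V 207 [D 111,B
78]],U 705 [E,E,C 315,B 157,B 131],U 451 [U 281 [D 145,B 96],V 215 [D 127,B 100],C 215,B 131,B
157],U 451 [U 281 [D 145,B 96],V 221 [D 127,B 97],C 215,B 119,B 124]]]"

definition bs23_table :: "int trie" where
"bs23_table = U 3356 [U 3712 [U 3357 [U 2677 [U 1947 [U 1315 [U 824 [U 478 [U 253 [N 112 10 []],V 168 [D 94,B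
73]],U 339 [U 208 [D 107,B 71],B 158,C 155,B 83,B 82]],U 614 [U 416 [U 235 [N 108 6 [],B 72],V 170
[D 99,B 79]],U 343 [U 212 [D 109,B 73],V 167 [D 95,B 73],C 157,B 85,B 85],C 282,B 152,B 150]],U
1024 [U 738 [U 460 [U 259 [D 129,B 81],V 180 [D 103,B 79]],U 345 [U 222 [D 115,B 76],V 181 [D
103,B 76],C 159,B 86,B 87]],U 617 [U 425 [U 245 [D 124,B 80],V 175 [D 102,B 83]],U 345 [U 222 [D
114,B 75],V 174 [D 101,B 76],C 159,B 86,B 86],C 284,B 154,B 154],U 507 [E,E,C 223,B 109,B 89],U
306 [D 165,B 115,C 145,B 89,B 108],U 304 [D 164,B 115,C 144,B 78,B 78]]],U 1570 [U 1196 [U 786 [U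
475 [U 263 [D 130,B 81],V 180 [D 103,B 79]],U 345 [U 212 [D 107,B 65],B 160,C 158,B 85,B 84]],U
605 [U 417 [U 235 [N 108 10 []],V 167 [D 97,B 76]],U 347 [U 215 [D 111,B 72],B 157,C 159,B 85,B
85],C 279,B 152,B 153]],U 1017 [U 725 [U 440 [U 231 [N 103 10 []],B 149],U 327 [U 203 [N 94 6 [],B
66],V 169 [D 94,B 66],C 151,B 82,B 83]],U 596 [U 407 [U 228 [D 115,B 75],V 159 [N 81 6 [],B 72]],U
331 [U 210 [D 109,B 73],V 167 [D 98,B 74],C 152,B 82,B 82],C 275,B 149,B 149],U 504 [E,E,C 222,B
109,B 89],U 305 [D 164,B 115,C 145,B 89,B 109],U 305 [D 164,B 115,C 145,B 78,B 78]],U 799 [E,E,C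
353,B 175,B 145],U 502 [U 302 [D 154,B 100],V 225 [D 130,B 100],C 239,B 145,B 174],U 500 [U 301 [D
154,B 100],V 225 [D 130,B 100],C 238,B 129,B 129]]],bs23_1],bs23_3],bs23_7,U 1874 [E,E,U 906
[E,E,C 395,B 190,B 146],U 525 [U 303 [D 152,B 97],V 215 [D 124,B 95],C 245,B 141,B 157],U 470 [U
285 [D 146,B 95],V 210 [D 124,B 97],C 226,B 120,B 115]],U 1301 [U 904 [U 558 [U 312 [D 155,B 97],V
215 [D 123,B 95]],U 414 [U 266 [D 137,B 91],V 215 [D 123,B 91],C 190,B 103,B 103]],U 726 [U 504 [U
292 [D 148,B 95],V 209 [D 122,B 97]],U 414 [U 266 [D 137,B 91],V 209 [D 122,B 91],C 190,B 103,B
103],C 348,V 203 [D 109,B 76],V 203 [D 109,B 76]],U 686 [E,E,C 306,B 157,B 141],U 470 [U 285 [D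
146,B 95],V 219 [D 125,B 94],C 226,B 146,B 190],U 525 [U 303 [D 152,B 97],V 219 [D 125,B 94],C
245,B 133,B 133]],U 1301 [U 904 [U 558 [U 312 [D 155,B 97],V 215 [D 123,B 95]],U 414 [U 266 [D
137,B 91],V 215 [D 123,B 91],C 190,B 103,B 103]],U 726 [U 504 [U 292 [D 148,B 95],V 209 [D 122,B
97]],U 414 [U 266 [D 137,B 91],V 209 [D 122,B 91],C 190,B 103,B 103],C 348,V 203 [D 109,B 76],V
203 [D 109,B 76]],U 686 [E,E,C 306,B 152,B 127],U 439 [U 274 [D 142,B 94],V 210 [D 124,B 97],C
209,B 127,B 152],U 439 [U 274 [D 142,B 94],V 215 [D 124,B 95],C 209,B 115,B 120]]]"

section \<open>Verification of the table for BS(2, 3)\<close>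

definition "bs23_val t = look bs23_table (rev t)"

lemma bs23_entries: "chk (\<lambda>t f m. bs23_val t = f) [] bs23_table"
  by (rule chk_look) (simp add: bs23_val_def)

text \<open>One rewrite rule per entry outside the pieces. A piece stays folded here, in a fact such
  as \<open>chk ... [1] bs23_7\<close>, and unfolding that fact in turn gives the rules for its own
  entries.\<close>

lemmas bs23_table_entries' [simp] = bs23_entries[unfolded bs23_table_def, simplified]

lemma bs23_7_entries: "chk (\<lambda>t f m. bs23_val t = f) [1] bs23_7" by simp

lemmas bs23_7_entries' [simp] = bs23_7_entries[unfolded bs23_7_def, simplified]

lemma bs23_6_entries: "chk (\<lambda>t f m. bs23_val t = f) [1,1] bs23_6" by simp

lemmas bs23_6_entries' [simp] = bs23_6_entries[unfolded bs23_6_def, simplified]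

lemma bs23_5_entries: "chk (\<lambda>t f m. bs23_val t = f) [1,1,1] bs23_5" by simp

lemmas bs23_5_entries' [simp] = bs23_5_entries[unfolded bs23_5_def, simplified]

lemma bs23_4_entries: "chk (\<lambda>t f m. bs23_val t = f) [1,0,1] bs23_4" by simp

lemmas bs23_4_entries' [simp] = bs23_4_entries[unfolded bs23_4_def, simplified]

lemma bs23_3_entries: "chk (\<lambda>t f m. bs23_val t = f) [1,0] bs23_3" by simp

lemmas bs23_3_entries' [simp] = bs23_3_entries[unfolded bs23_3_def, simplified]

lemma bs23_2_entries: "chk (\<lambda>t f m. bs23_val t = f) [1,1,0] bs23_2" by simp

lemmas bs23_2_entries' [simp] = bs23_2_entries[unfolded bs23_2_def, simplified]

lemma bs23_1_entries: "chk (\<lambda>t f m. bs23_val t = f) [1,0,0] bs23_1" by simp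

lemmas bs23_1_entries' [simp] = bs23_1_entries[unfolded bs23_1_def, simplified]

text \<open>The constants belong to \<open>al = 131 / 54\<close>: \<open>7074 = 131 * 54\<close>,
  \<open>14245 = 131\<^sup>2 - 54\<^sup>2\<close>, \<open>2916 = 54\<^sup>2\<close>. Every letter of
  a mask leads to another entry, so the rules above evaluate all neighbours. Inner pieces come
  before the tables that contain them, where they serve as simp rules.\<close>

lemma bs23_1_ok [simp]: "chk (bs_ok 2 3 7074 14245 2916 bs23_val) [1,0,0] bs23_1"
  by (simp add: bs23_1_def bs_ok_def mask_letters_simps carry_def)

lemma bs23_2_ok [simp]: "chk (bs_ok 2 3 7074 14245 2916 bs23_val) [1,1,0] bs23_2"
  by (simp add: bs23_2_def bs_ok_def mask_letters_simps carry_def)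

lemma bs23_3_ok [simp]: "chk (bs_ok 2 3 7074 14245 2916 bs23_val) [1,0] bs23_3"
  by (simp add: bs23_3_def bs_ok_def mask_letters_simps carry_def)

lemma bs23_4_ok [simp]: "chk (bs_ok 2 3 7074 14245 2916 bs23_val) [1,0,1] bs23_4"
  by (simp add: bs23_4_def bs_ok_def mask_letters_simps carry_def)

lemma bs23_5_ok [simp]: "chk (bs_ok 2 3 7074 14245 2916 bs23_val) [1,1,1] bs23_5"
  by (simp add: bs23_5_def bs_ok_def mask_letters_simps carry_def)

lemma bs23_6_ok [simp]: "chk (bs_ok 2 3 7074 14245 2916 bs23_val) [1,1] bs23_6"
  by (simp add: bs23_6_def bs_ok_def mask_letters_simps carry_def)

lemma bs23_7_ok [simp]: "chk (bs_ok 2 3 7074 14245 2916 bs23_val) [1] bs23_7"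
  by (simp add: bs23_7_def bs_ok_def mask_letters_simps carry_def)

lemma bs23_table_ok [simp]: "chk (bs_ok 2 3 7074 14245 2916 bs23_val) [] bs23_table"
  by (simp add: bs23_table_def bs_ok_def mask_letters_simps carry_def)

lemma rho_BS_2_3:
  "ereal (131 / 54 + 3 / (131 / 54))
    \<le> rho (BS 2 3) (gen_a (BS_relators 2 3)) (gen_b (BS_relators 2 3))"
proof -
  have val: "(\<lambda>t. look bs23_table (rev t)) = bs23_val" by (simp add: bs23_val_def fun_eq_iff)
  have "look bs23_table [] \<noteq> 0" by (simp add: bs23_table_def)
  moreover have "chk (bs_ok (int 2) (int 3) (131 * 54) (131\<^sup>2 - 54\<^sup>2) (54\<^sup>2) bs23_val) [] bs23_table"
    using bs23_table_ok by simp
  ultimately show ?thesis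
    using rho_BS_ge[of 2 3 131 54 bs23_table] unfolding val by simp
qed

definition bs35_1 :: "int trie" where
"bs35_1 = U 10133 [U 7624 [U 4993 [U 2945 [U 1609 [D 831,B 457,B 335],V 942 [N 497 6 [],B 326,B 335],B
751],V 1880 [U 1115 [N 574 10 []],B 740,B 773],V 1642 [D 963,B 617,B 610]],U 3496 [U 2253 [D
1242,B 744,B 656],V 1622 [D 952,B 654,B 715],V 1716 [D 1008,V 663 [N 382 6 [],B 311,B 412],B
621],C 1800,V 981 [D 556,B 352,B 342],B 620,B 599,V 907 [D 523,B 337,B 337]],U 3251 [U 2131 [D
1180,B 732,B 686],V 1503 [D 925,B 683,B 816],V 1503 [D 931,B 627,V 668 [N 384 10 []]],C 1685,V 927
[D 533,B 342,B 339],B 594,B 589,V 907 [D 522,B 339,B 342]]],U 5846 [U 4213 [U 2575 [U 1428 [D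
745,B 415,B 315],V 850 [N 454 6 [],B 307,B 329],B 698],V 1701 [U 1024 [N 532 10 []],B 687,B 728],V
1560 [D 928,B 599,B 599]],U 3235 [U 2125 [D 1178,B 717,B 650],V 1560 [D 927,B 654,B 740],V 1682 [U
1017 [N 530 6 [],B 335,B 326],V 680 [N 398 6 [],B 335,B 457],B 648],C 1671,V 917 [D 520,B 328,B
317],B 592,B 592,V 917 [N 485 10 []]],U 3371 [U 2187 [D 1210,B 755,B 715],V 1530 [D 956,B 730,V
906 [N 480 10 []]],V 1498 [D 934,B 639,V 695 [N 397 10 []]],C 1736,V 948 [D 539,B 343,B 337],B
601,B 584,V 888 [N 472 10 []]],C 3058,V 1714 [D 979,B 627,B 620],V 1162 [D 665,B 427,B 424],V 1148
[D 658,B 424,B 424],V 1662 [D 956,B 618,B 620]],U 5670 [U 4111 [U 2525 [U 1397 [D 730,B 413,B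
324],V 844 [N 454 6 [],B 314,B 348],B 709],V 1692 [U 1015 [N 525 10 []],B 686,B 734],V 1592 [D
940,B 610,B 617]],U 3082 [U 2081 [D 1154,B 706,B 646],V 1587 [D 935,B 646,B 713],V 1798 [U 1069 [N
552 6 [],B 339,B 312],V 696 [N 398 6 [],B 319,B 417],B 645],C 1560,B 824,B 540,B 554,V 873 [N 465
6 [],B 312,B 331]],U 3090 [U 2089 [D 1159,B 718,B 671],V 1508 [D 951,B 705,V 846 [N 454 10 []]],V
1535 [D 958,B 640,V 675 [N 393 10 []]],C 1584,V 879 [D 508,B 333,B 341],B 575,B 587,V 921 [N 486 6
[],B 320,B 331]],C 2975,V 1675 [D 962,B 620,B 618],V 1144 [D 657,B 424,B 424],V 1140 [D 655,B
424,B 427],V 1659 [D 955,B 620,B 627]]]"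

definition bs35_2 :: "int trie" where
"bs35_2 = U 8708 [U 7014 [U 4701 [U 2800 [U 1539 [D 798,B 441,B 327],V 907 [N 481 6 [],B 319,B 332],B 731],V
1800 [U 1070 [N 552 10 []],B 716,B 756],V 1591 [D 937,B 604,B 603]],U 3351 [U 2195 [U 1231 [N 623
10 []],B 739,B 653],V 1591 [D 940,B 650,B 717],V 1692 [U 1015 [N 525 6 [],B 324,B 302],V 668 [N
384 6 [],B 311,B 409],B 627],C 1707,V 910 [N 481 10 []],B 572,B 548,B 827],U 3185 [U 2104 [D
1169,B 728,B 687],V 1489 [D 921,B 685,B 825],V 1491 [D 929,B 629,V 674 [N 388 10 []]],C 1638,V 897
[D 516,B 331,B 329],B 568,B 551,B 837]],U 5672 [U 4114 [U 2526 [U 1398 [D 731,B 407,B 307],B 816,B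
683],V 1682 [U 1017 [N 530 10 []],B 686,B 732],V 1561 [D 927,B 598,B 598]],U 3185 [U 2105 [D
1170,B 716,B 656],V 1561 [D 929,B 660,B 753],V 1701 [U 1024 [N 532 6 [],B 334,B 320],V 683 [N 397
6 [],B 329,B 442],B 651],C 1629,V 883 [N 470 6 [],B 315,B 333],B 581,B 598,V 945 [D 533,B 342,B
339]],U 3356 [U 2197 [U 1232 [N 623 6 [],B 358,B 290],B 774,B 741],V 1550 [D 972,B 751,V 942 [N
497 10 []]],V 1534 [D 965,V 684 [N 382 6 [],B 290,B 358],V 729 [N 413 10 []]],C 1721,V 943 [D
536,B 344,B 342],B 605,B 599,V 922 [D 524,B 337,B 336]],C 2976,V 1680 [D 964,B 625,B 629],V 1157
[D 663,B 428,B 428],V 1167 [D 667,B 428,B 426],V 1716 [D 980,B 628,B 621]],U 5847 [U 4214 [U 2575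
[U 1418 [D 740,B 415,B 319],V 850 [N 455 6 [],B 311,B 338],B 705],V 1726 [U 1030 [N 533 10 []],B
691,B 732],V 1630 [D 956,B 615,B 612]],U 3164 [U 2139 [D 1186,B 725,B 662],V 1642 [D 963,B 662,B
725],V 1880 [U 1115 [N 574 6 [],B 348,B 315],V 729 [N 413 6 [],B 324,B 413],V 684 [N 382 10 []]],C
1641,V 907 [D 522,B 339,B 342],B 589,B 594,V 927 [D 533,B 348,B 355]],U 3136 [U 2113 [D 1171,B
726,B 680],V 1525 [D 948,B 707,V 854 [N 457 10 []]],V 1566 [D 973,B 649,V 682 [N 396 10 []]],C
1630,V 907 [D 524,B 344,B 353],B 599,B 620,V 981 [D 556,B 355,B 349]],C 3058,V 1716 [D 980,B 629,B
624],V 1167 [D 667,B 428,B 425],V 1157 [D 663,B 426,B 424],V 1680 [D 964,B 620,B 618]],U 4780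
[E,E,E,C 2356,B 1183,B 661,B 503,B 621],U 2875 [U 1816 [D 991,B 595,B 527],V 1261 [D 748,B 527,B
595],V 1261 [D 748,B 483,B 483],C 1442,B 757,B 488,B 488,B 757],U 2076 [U 1271 [D 684,B 402,B
342],V 856 [N 470 6 [],B 342,B 402],V 856 [N 470 10 []],C 1081,B 621,B 503,B 661,B 1183],U 2076 [U
1271 [D 684,B 402,B 342],V 856 [N 470 6 [],B 342,B 402],V 856 [N 470 10 []],C 1081,B 583,B 405,B
450,B 742],U 2875 [U 1816 [D 991,B 595,B 527],V 1261 [D 748,B 527,B 595],V 1261 [D 748,B 483,B
483],C 1442,B 742,B 450,B 405,B 583]]"

definition bs35_3 :: "int trie" where
"bs35_3 = U 8708 [U 7013 [U 4702 [U 2798 [U 1538 [D 797,B 441,B 328],V 909 [N 482 6 [],B 320,B 334],B 738],V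
1804 [U 1073 [N 554 10 []],B 723,B 771],V 1602 [D 942,B 609,B 612]],U 3373 [U 2190 [D 1212,B 730,B
649],V 1585 [D 935,B 648,B 717],V 1683 [D 992,V 656 [N 378 6 [],B 308,B 407],B 620],C 1736,V 948
[D 535,B 342,B 339],B 605,B 594,V 909 [D 523,B 339,B 342]],U 3237 [U 2126 [D 1178,B 731,B 685],V
1503 [D 931,B 694,V 839 [N 447 10 []]],V 1503 [D 925,B 620,V 655 [N 377 10 []]],C 1674,V 920 [D
528,B 340,B 339],B 590,B 585,V 901 [D 520,B 342,B 352]]],U 5591 [U 4124 [U 2529 [U 1407 [D 735,B
410,B 311],V 840 [N 448 6 [],B 302,B 324],B 694],V 1683 [U 1015 [N 528 10 []],B 685,B 731],V 1562
[D 926,B 598,B 598]],U 3252 [U 2131 [D 1180,B 716,B 647],V 1562 [D 926,B 649,B 729],V 1683 [U 1015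
[N 528 6 [],B 331,B 318],V 675 [N 393 6 [],B 327,B 441],B 640],C 1685,V 933 [D 535,B 349,B 355],B
611,B 625,V 983 [D 557,B 353,B 343]],U 3499 [U 2263 [U 1260 [N 636 6 [],B 363,B 290],B 781,B
731],V 1572 [D 976,B 740,V 910 [N 482 10 []]],V 1529 [D 949,B 645,V 696 [N 398 10 []]],C 1801,V
983 [D 557,B 355,B 348],B 625,B 611,V 933 [D 535,B 342,B 339]],C 2938,V 1659 [D 955,B 618,B 620],V
1140 [D 655,B 424,B 426],V 1144 [D 657,B 425,B 428],V 1675 [D 962,B 624,B 629]],U 5591 [U 4124 [U
2528 [U 1404 [D 733,B 412,B 317],V 841 [N 451 6 [],B 310,B 339],B 696],V 1682 [D 991,B 669,B
715],V 1583 [D 934,B 603,B 603]],U 3137 [U 2117 [D 1175,B 715,B 648],V 1606 [D 945,B 649,B 709],V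
1809 [U 1083 [N 558 6 [],B 341,B 311],V 712 [N 405 6 [],B 321,B 414],V 672 [N 377 10 []]],C 1630,V
901 [D 520,B 335,B 335],B 584,B 589,V 917 [D 522,B 330,B 319]],U 3164 [U 2139 [D 1186,B 734,B
686],V 1534 [D 965,B 710,V 845 [N 455 10 []]],V 1550 [D 972,B 648,V 680 [N 398 10 []]],C 1642,V
910 [D 524,B 341,B 345],B 594,B 605,V 948 [D 535,B 333,B 315]],C 2938,V 1662 [D 956,B 621,B 628],V
1148 [D 658,B 426,B 428],V 1162 [D 665,B 428,B 428],V 1714 [D 979,B 629,B 625]],U 4780 [E,E,E,C
2356,B 1183,B 661,B 503,B 621],U 2875 [U 1816 [D 991,B 595,B 527],V 1261 [D 748,B 527,B 595],V
1261 [D 748,B 483,B 483],C 1442,B 757,B 488,B 488,B 757],U 2076 [U 1271 [D 684,B 402,B 342],V 856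
[N 470 6 [],B 342,B 402],V 856 [N 470 10 []],C 1081,B 621,B 503,B 661,B 1183],U 2076 [U 1271 [D
684,B 402,B 342],V 856 [N 470 6 [],B 342,B 402],V 856 [N 470 10 []],C 1081,B 583,B 405,B 450,B
742],U 2875 [U 1816 [D 991,B 595,B 527],V 1261 [D 748,B 527,B 595],V 1261 [D 748,B 483,B 483],C
1442,B 742,B 450,B 405,B 583]]"

definition bs35_table :: "int trie" where
"bs35_table = U 10604 [bs35_1,bs35_2,bs35_3,U 5962 [E,E,E,C 2982,V 1542 [D 819,B 464,B 364],B 877,B 693,V 891 [D
543,B 356,B 365]],U 3694 [U 2409 [U 1372 [D 721,B 408,B 320],V 848 [N 454 6 [],B 309,B 335],B
747],V 1704 [U 1056 [N 545 10 []],B 747,V 848 [N 454 10 []]],V 1704 [U 1056 [N 545 6 [],B 335,B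
309],V 720 [N 408 6 [],B 320,B 408],V 720 [N 408 10 []]],C 1887,V 1014 [N 536 6 [],B 353,B 364],B
654,B 654,V 1014 [N 536 10 []]],U 2736 [U 1727 [D 942,B 566,B 501],V 1199 [D 711,B 501,B 566],V
1199 [D 711,B 459,B 459],C 1467,V 891 [D 543,B 400,B 478],B 693,B 877,V 1542 [D 819,B 478,B
400]],U 2736 [U 1727 [D 942,B 566,B 501],V 1199 [D 711,B 501,B 566],V 1199 [D 711,B 459,B 459],C
1467,V 824 [N 466 10 []],B 567,B 621,V 1016 [D 575,B 364,B 353]],U 3694 [U 2409 [U 1372 [D 721,B
408,B 320],V 848 [N 454 6 [],B 309,B 335],B 747],V 1704 [U 1056 [N 545 10 []],B 747,V 848 [N 454
10 []]],V 1704 [U 1056 [N 545 6 [],B 335,B 309],V 720 [N 408 6 [],B 320,B 408],V 720 [N 408 10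
[]]],C 1887,V 1016 [D 575,B 365,B 356],B 621,B 567,V 824 [N 466 6 [],B 364,B 464]]]"

section \<open>Verification of the table for BS(3, 5)\<close>

definition "bs35_val t = look bs35_table (rev t)"

lemma bs35_entries: "chk (\<lambda>t f m. bs35_val t = f) [] bs35_table"
  by (rule chk_look) (simp add: bs35_val_def)

lemmas bs35_table_entries' [simp] = bs35_entries[unfolded bs35_table_def, simplified]

lemma bs35_3_entries: "chk (\<lambda>t f m. bs35_val t = f) [2] bs35_3" by simp

lemmas bs35_3_entries' [simp] = bs35_3_entries[unfolded bs35_3_def, simplified]

lemma bs35_2_entries: "chk (\<lambda>t f m. bs35_val t = f) [1] bs35_2" by simp

lemmas bs35_2_entries' [simp] = bs35_2_entries[unfolded bs35_2_def, simplified]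

lemma bs35_1_entries: "chk (\<lambda>t f m. bs35_val t = f) [0] bs35_1" by simp

lemmas bs35_1_entries' [simp] = bs35_1_entries[unfolded bs35_1_def, simplified]

text \<open>Here \<open>al = 97 / 47\<close>, with \<open>4559 = 97 * 47\<close>,
  \<open>7200 = 97\<^sup>2 - 47\<^sup>2\<close> and \<open>2209 = 47\<^sup>2\<close>.\<close>

lemma bs35_1_ok [simp]: "chk (bs_ok 3 5 4559 7200 2209 bs35_val) [0] bs35_1"
  by (simp add: bs35_1_def bs_ok_def mask_letters_simps carry_def)

lemma bs35_2_ok [simp]: "chk (bs_ok 3 5 4559 7200 2209 bs35_val) [1] bs35_2"
  by (simp add: bs35_2_def bs_ok_def mask_letters_simps carry_def)

lemma bs35_3_ok [simp]: "chk (bs_ok 3 5 4559 7200 2209 bs35_val) [2] bs35_3"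
  by (simp add: bs35_3_def bs_ok_def mask_letters_simps carry_def)

lemma bs35_table_ok [simp]: "chk (bs_ok 3 5 4559 7200 2209 bs35_val) [] bs35_table"
  by (simp add: bs35_table_def bs_ok_def mask_letters_simps carry_def)

lemma rho_BS_3_5:
  "ereal (97 / 47 + 3 / (97 / 47))
    \<le> rho (BS 3 5) (gen_a (BS_relators 3 5)) (gen_b (BS_relators 3 5))"
proof -
  have val: "(\<lambda>t. look bs35_table (rev t)) = bs35_val" by (simp add: bs35_val_def fun_eq_iff)
  have "look bs35_table [] \<noteq> 0" by (simp add: bs35_table_def)
  moreover have "chk (bs_ok (int 3) (int 5) (97 * 47) (97\<^sup>2 - 47\<^sup>2) (47\<^sup>2) bs35_val) [] bs35_table"
    using bs35_table_ok by simp
  ultimately show ?thesis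
    using rho_BS_ge[of 3 5 97 47 bs35_table] unfolding val by simp
qed

section \<open>Thompson's group\<close>

text \<open>Words over the generators \<open>x\<^sub>0, x\<^sub>1, \<dots>\<close> of the infinite presentation; \<open>(True, i)\<close> stands for
  \<open>x\<^sub>i\<close> and \<open>(False, i)\<close> for its inverse. The pair \<open>(P, Q)\<close> below stands for \<open>P Q\<inverse>\<close>, with \<open>P\<close> read
  backwards.\<close>

type_synonym xword = "(bool \<times> nat) list"

text \<open>Moves the generator of index \<open>i\<close> to the left through the inverse of the
  positive word \<open>Q\<close>, whose nearest factor is the inverse of the head of
  \<open>Q\<close>. Each step is a form of \<open>x_n x_k = x_k x_(n+1)\<close> for
  \<open>k < n\<close>: the larger of the two indices rises by 1, and equal indices cancel, which
  leaves the first component empty.\<close>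

fun pull :: "nat \<Rightarrow> nat list \<Rightarrow> nat list \<times> nat list" where
  "pull i [] = ([i], [])"
| "pull i (j # Q) =
     (if i = j then ([], Q)
      else if j < i then apsnd ((#) j) (pull (Suc i) Q)
      else apsnd ((#) (Suc j)) (pull i Q))"

fun append_gen :: "bool \<times> nat \<Rightarrow> nat list \<times> nat list \<Rightarrow> nat list \<times> nat list" where
  "append_gen (True, i) (P, Q) = apfst (\<lambda>p. p @ P) (pull i Q)"
| "append_gen (False, i) (P, Q) = (P, i # Q)"

text \<open>Sorts by the same relation: a generator that moves right past a smaller index gains 1.
  Nondecreasing index lists are the normal forms of the positive monoid.\<close>

fun insert_gen :: "nat \<Rightarrow> nat list \<Rightarrow> nat list" where
  "insert_gen i [] = [i]"
| "insert_gen i (k # L) = (if k < i then k # insert_gen (Suc i) L else i # k # L)"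

fun sort_rev :: "nat list \<Rightarrow> nat list \<Rightarrow> nat list" where
  "sort_rev [] L = L"
| "sort_rev (i # P) L = sort_rev P (insert_gen i L)"

fun sort_word :: "nat list \<Rightarrow> nat list" where
  "sort_word [] = []"
| "sort_word (i # Q) = insert_gen i (sort_word Q)"

fun trivial_pair :: "nat list \<times> nat list \<Rightarrow> bool" where
  "trivial_pair (P, Q) \<longleftrightarrow> sort_rev P [] = sort_word Q"

fun append_word :: "xword \<Rightarrow> nat list \<times> nat list \<Rightarrow> nat list \<times> nat list" where
  "append_word [] S = S"
| "append_word (s # w) S = append_word w (append_gen s S)"

definition trivial_xword :: "xword \<Rightarrow> bool" where
  "trivial_xword w \<longleftrightarrow> trivial_pair (append_word w ([], []))"

fun xword_inv :: "xword \<Rightarrow> xword" where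
  "xword_inv [] = []"
| "xword_inv (s # w) = xword_inv w @ [(\<not> fst s, snd s)]"

context group
begin

lemma commute_inv:
  assumes "g \<otimes> h = h \<otimes> g" "g \<in> carrier G" "h \<in> carrier G"
  shows "inv g \<otimes> h = h \<otimes> inv g"
proof -
  have "inv g \<otimes> h = inv g \<otimes> (h \<otimes> g) \<otimes> inv g"
    using assms(2,3) by (simp add: m_assoc)
  also have "\<dots> = (inv g \<otimes> g) \<otimes> (h \<otimes> inv g)"
    unfolding assms(1)[symmetric] using assms(2,3) by (simp only: m_assoc m_closed inv_closed)
  also have "\<dots> = h \<otimes> inv g" using assms by simp
  finally show ?thesis .
qed

section \<open>The relations of the infinite presentation, derived from the two relators\<close>

fun xgen :: "'a \<Rightarrow> 'a \<Rightarrow> nat \<Rightarrow> 'a" where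
  "xgen x y 0 = x"
| "xgen x y (Suc 0) = y"
| "xgen x y (Suc (Suc n)) = inv x \<otimes> xgen x y (Suc n) \<otimes> x"

definition sgen :: "'a \<Rightarrow> 'a \<Rightarrow> bool \<times> nat \<Rightarrow> 'a" where
  "sgen x y s = (if fst s then xgen x y (snd s) else inv (xgen x y (snd s)))"

definition xval :: "'a \<Rightarrow> 'a \<Rightarrow> xword \<Rightarrow> 'a" where
  "xval x y w = list_prod (map (sgen x y) w)"

context
  fixes x y :: 'a
  assumes xy: "x \<in> carrier G" "y \<in> carrier G"
begin

lemma xgen_closed [simp]: "xgen x y n \<in> carrier G"
proof (induction n)
  case (Suc n)
  then show ?case by (cases n) (simp_all add: xy)
qed (simp add: xy)

lemma sgen_closed [simp]: "sgen x y s \<in> carrier G"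
  by (simp add: sgen_def)

lemma xval_closed [simp]: "xval x y w \<in> carrier G"
  unfolding xval_def by (rule list_prod_closed) auto

lemma xval_simps: "xval x y [] = \<one>" "xval x y (s # w) = sgen x y s \<otimes> xval x y w"
  by (simp_all add: xval_def)

lemma xval_append: "xval x y (v @ w) = xval x y v \<otimes> xval x y w"
  unfolding xval_def map_append by (rule list_prod_append) auto

lemma xval_inv: "xval x y (xword_inv w) = inv (xval x y w)"
  by (induction w) (auto simp: xval_append xval_simps inv_mult_group sgen_def)

abbreviation xprod :: "nat list \<Rightarrow> 'a" where
  "xprod L \<equiv> list_prod (map (xgen x y) L)"

lemma xprod_closed [simp]: "xprod L \<in> carrier G"
  by (rule list_prod_closed) auto

context
  assumes comm2: "(x \<otimes> inv y) \<otimes> xgen x y 2 = xgen x y 2 \<otimes> (x \<otimes> inv y)"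
    and comm3: "(x \<otimes> inv y) \<otimes> xgen x y 3 = xgen x y 3 \<otimes> (x \<otimes> inv y)"
begin

text \<open>Conjugation by \<open>x\<close> raises every positive index by 1 and fixes
  \<open>x\<close> itself, whence the \<open>Suc\<close> on both indices.\<close>

lemma xgen_shift:
  assumes "xgen x y (Suc n) \<otimes> xgen x y (Suc k) = xgen x y (Suc k) \<otimes> xgen x y (Suc (Suc n))"
  shows "xgen x y (Suc (Suc n)) \<otimes> xgen x y (Suc (Suc k))
    = xgen x y (Suc (Suc k)) \<otimes> xgen x y (Suc (Suc (Suc n)))"
proof -
  have conj: "(inv x \<otimes> g \<otimes> x) \<otimes> (inv x \<otimes> h \<otimes> x) = inv x \<otimes> (g \<otimes> h) \<otimes> x"
    if "g \<in> carrier G" "h \<in> carrier G" for g h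
  proof -
    have "(inv x \<otimes> g \<otimes> x) \<otimes> (inv x \<otimes> h \<otimes> x) = inv x \<otimes> g \<otimes> (x \<otimes> inv x) \<otimes> h \<otimes> x"
      using that xy by (simp only: m_assoc m_closed inv_closed)
    then show ?thesis using that xy by (simp add: m_assoc)
  qed
  have s: "xgen x y (Suc (Suc m)) = inv x \<otimes> xgen x y (Suc m) \<otimes> x" for m
    by simp
  have "xgen x y (Suc (Suc n)) \<otimes> xgen x y (Suc (Suc k))
      = inv x \<otimes> (xgen x y (Suc n) \<otimes> xgen x y (Suc k)) \<otimes> x"
    unfolding s[of n] s[of k] by (rule conj) (rule xgen_closed)+
  also have "\<dots> = inv x \<otimes> (xgen x y (Suc k) \<otimes> xgen x y (Suc (Suc n))) \<otimes> x"
    by (simp only: assms)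
  also have "\<dots> = (inv x \<otimes> xgen x y (Suc k) \<otimes> x) \<otimes> (inv x \<otimes> xgen x y (Suc (Suc n)) \<otimes> x)"
    by (rule conj[symmetric]) (rule xgen_closed)+
  also have "\<dots> = xgen x y (Suc (Suc k)) \<otimes> xgen x y (Suc (Suc (Suc n)))"
    by (simp only: s[of k] s[of "Suc n"])
  finally show ?thesis .
qed

text \<open>If \<open>g\<close> commutes with \<open>x \<otimes> inv y\<close>, then conjugation by
  \<open>x\<close> and conjugation by \<open>y\<close> agree on \<open>g\<close>. For
  \<open>g\<close> of index 2 and 3 this gives the first two relations with
  \<open>y\<close>.\<close>

lemma xgen_rel1:
  assumes "(x \<otimes> inv y) \<otimes> g = g \<otimes> (x \<otimes> inv y)" and g: "g \<in> carrier G"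
  shows "g \<otimes> y = y \<otimes> (inv x \<otimes> g \<otimes> x)"
proof -
  have "y \<otimes> (inv x \<otimes> g \<otimes> x) = y \<otimes> inv x \<otimes> (g \<otimes> (x \<otimes> inv y)) \<otimes> y"
    using xy g by (simp add: m_assoc)
  also have "\<dots> = y \<otimes> (inv x \<otimes> x) \<otimes> inv y \<otimes> g \<otimes> y"
    unfolding assms(1)[symmetric] using xy g by (simp only: m_assoc m_closed inv_closed)
  also have "\<dots> = g \<otimes> y" using xy g by simp
  finally show ?thesis by simp
qed

lemma xgen_rel_Suc:
  assumes "xgen x y (Suc (Suc 0)) \<otimes> y = y \<otimes> xgen x y (Suc (Suc (Suc 0)))"
  shows "xgen x y (Suc (Suc n)) \<otimes> xgen x y (Suc n) = xgen x y (Suc n) \<otimes> xgen x y (Suc (Suc (Suc n)))"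
proof (induction n)
  case 0
  show ?case using assms by simp
next
  case (Suc n)
  show ?case by (rule xgen_shift[OF Suc])
qed

text \<open>The relators are the cases 0 and 1. Later, \<open>x_(m+4)\<close> is brought past
  \<open>y\<close> by means of \<open>x_(m+3) x_(m+2) = x_(m+2) x_(m+4)\<close>: both factors on the
  left pass \<open>y\<close> by induction, the same relation one index higher reorders the result,
  and \<open>x_(m+2)\<close> cancels.\<close>

lemma xgen_rel_y: "xgen x y (Suc (Suc n)) \<otimes> y = y \<otimes> xgen x y (Suc (Suc (Suc n)))"
proof (induction n rule: less_induct)
  case (less n)
  have base: "xgen x y (Suc (Suc 0)) \<otimes> y = y \<otimes> xgen x y (Suc (Suc (Suc 0)))"
    using xgen_rel1[OF comm2 xgen_closed] by (simp add: numeral_2_eq_2)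
  consider "n = 0" | "n = Suc 0" | m where "n = Suc (Suc m)"
    using not0_implies_Suc by blast
  then show ?case
  proof cases
    case 1
    then show ?thesis using base by simp
  next
    case 2
    then show ?thesis using xgen_rel1[OF comm3 xgen_closed] by (simp add: numeral_3_eq_3)
  next
    case 3
    define X where "X k = xgen x y (Suc (Suc (k + m)))" for k
    have c: "X k \<in> carrier G" for k unfolding X_def by (rule xgen_closed)
    have l: "m < n" "Suc m < n" using 3 by auto
    have r: "X 0 \<otimes> y = y \<otimes> X 1" "X 1 \<otimes> y = y \<otimes> X 2"
      using less[OF l(1)] less[OF l(2)]
      by (simp_all only: X_def numeral_2_eq_2 One_nat_def add_Suc add_0)
    have s: "X 1 \<otimes> X 0 = X 0 \<otimes> X 2" "X 2 \<otimes> X 1 = X 1 \<otimes> X 3"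
      using xgen_rel_Suc[OF base, of "Suc m"] xgen_rel_Suc[OF base, of "Suc (Suc m)"]
      by (simp_all only: X_def numeral_2_eq_2 numeral_3_eq_3 One_nat_def add_Suc add_0)
    have "X 0 \<otimes> (X 2 \<otimes> y) = (X 0 \<otimes> X 2) \<otimes> y" using c xy by (simp add: m_assoc)
    also have "\<dots> = (X 1 \<otimes> X 0) \<otimes> y" by (simp only: s(1))
    also have "\<dots> = X 1 \<otimes> (X 0 \<otimes> y)" using c xy by (simp add: m_assoc)
    also have "\<dots> = (X 1 \<otimes> y) \<otimes> X 1" unfolding r(1) using c xy by (simp add: m_assoc)
    also have "\<dots> = y \<otimes> (X 2 \<otimes> X 1)" unfolding r(2) using c xy by (simp add: m_assoc)
    also have "\<dots> = (X 0 \<otimes> y) \<otimes> X 3" unfolding s(2) r(1) using c xy by (simp add: m_assoc)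
    also have "\<dots> = X 0 \<otimes> (y \<otimes> X 3)" using c xy by (simp add: m_assoc)
    finally have "X 2 \<otimes> y = y \<otimes> X 3" using c xy by simp
    then show ?thesis by (simp only: 3 X_def numeral_2_eq_2 numeral_3_eq_3 add_Suc add_0)
  qed
qed

text \<open>Index 0 is the definition of \<open>xgen\<close>, index 1 is \<open>xgen_rel_y\<close>,
  and conjugation by \<open>x\<close> reaches the rest.\<close>

lemma xgen_rel: "k < n \<Longrightarrow> xgen x y n \<otimes> xgen x y k = xgen x y k \<otimes> xgen x y (Suc n)"
proof (induction k arbitrary: n)
  case 0
  then obtain m where "n = Suc m" using not0_implies_Suc by blast
  then show ?case using xy by (simp add: m_assoc[symmetric])
next
  case (Suc k)
  then obtain m where n: "n = Suc m" "k < m" by (cases n) auto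
  show ?case
  proof (cases k)
    case 0
    with n obtain j where "m = Suc j" by (cases m) auto
    then show ?thesis using xgen_rel_y[of j] by (simp only: n 0 xgen.simps(2))
  next
    case (Suc j)
    obtain i where i: "m = Suc i" using n by (cases m) auto
    show ?thesis using xgen_shift[of i j] Suc.IH[of m] n(2) by (simp only: n(1) i Suc)
  qed
qed

lemma pull_val:
  "pull i Q = (p, Q') \<Longrightarrow> inv (xprod Q) \<otimes> xgen x y i = xprod p \<otimes> inv (xprod Q')"
proof (induction i Q arbitrary: p Q' rule: pull.induct)
  case (2 i j Q)
  have flip: "inv u \<otimes> v = w \<otimes> inv u'" if "v \<otimes> u' = u \<otimes> w"
    "u \<in> carrier G" "v \<in> carrier G" "w \<in> carrier G" "u' \<in> carrier G" for u v w u'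
  proof -
    have "inv u \<otimes> v = inv u \<otimes> (v \<otimes> u') \<otimes> inv u'" using that(2-) by (simp add: m_assoc)
    also have "\<dots> = (inv u \<otimes> u) \<otimes> (w \<otimes> inv u')"
      unfolding that(1) using that(2-) by (simp only: m_assoc m_closed inv_closed)
    finally show ?thesis using that(2-) by simp
  qed
  consider "i = j" | "j < i" | "i < j" by linarith
  then show ?case
  proof cases
    case 1
    then show ?thesis using 2(3) by (auto simp: inv_mult_group m_assoc)
  next
    case 2
    then obtain Q'' where q: "pull (Suc i) Q = (p, Q'')" "Q' = j # Q''"
      using "2.prems" by (cases "pull (Suc i) Q") auto
    have "inv (xprod (j # Q)) \<otimes> xgen x y i = inv (xprod Q) \<otimes> (inv (xgen x y j) \<otimes> xgen x y i)"
      by (simp add: inv_mult_group m_assoc)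
    also have "inv (xgen x y j) \<otimes> xgen x y i = xgen x y (Suc i) \<otimes> inv (xgen x y j)"
      by (rule flip) (simp_all add: xgen_rel 2)
    also have "inv (xprod Q) \<otimes> \<dots> = (inv (xprod Q) \<otimes> xgen x y (Suc i)) \<otimes> inv (xgen x y j)"
      by (simp add: m_assoc)
    also have "\<dots> = xprod p \<otimes> inv (xprod (j # Q''))"
      using "2.IH"(1)[OF _ 2 q(1)] 2 by (simp add: inv_mult_group m_assoc)
    finally show ?thesis by (simp only: q)
  next
    case 3
    then obtain Q'' where q: "pull i Q = (p, Q'')" "Q' = Suc j # Q''"
      using "2.prems" by (cases "pull i Q") auto
    have "inv (xprod (j # Q)) \<otimes> xgen x y i = inv (xprod Q) \<otimes> (inv (xgen x y j) \<otimes> xgen x y i)"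
      by (simp add: inv_mult_group m_assoc)
    also have "inv (xgen x y j) \<otimes> xgen x y i = xgen x y i \<otimes> inv (xgen x y (Suc j))"
      by (rule flip) (simp_all add: xgen_rel 3)
    also have "inv (xprod Q) \<otimes> \<dots> = (inv (xprod Q) \<otimes> xgen x y i) \<otimes> inv (xgen x y (Suc j))"
      by (simp add: m_assoc)
    also have "\<dots> = xprod p \<otimes> inv (xprod (Suc j # Q''))"
      using "2.IH"(2)[OF _ _ q(1)] 3 by (simp add: inv_mult_group m_assoc)
    finally show ?thesis by (simp only: q)
  qed
qed simp

lemma insert_gen_val: "xprod (insert_gen i L) = xgen x y i \<otimes> xprod L"
proof (induction i L rule: insert_gen.induct)
  case (2 i k L)
  show ?case
  proof (cases "k < i")
    case True
    have "xprod (insert_gen i (k # L)) = (xgen x y k \<otimes> xgen x y (Suc i)) \<otimes> xprod L"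
      using True 2 by (simp add: m_assoc)
    then show ?thesis by (simp add: xgen_rel[OF True, symmetric] m_assoc)
  qed simp
qed simp

lemma sort_rev_val: "xprod (sort_rev P L) = xprod (rev P) \<otimes> xprod L"
proof (induction P L rule: sort_rev.induct)
  case (2 i P L)
  then show ?case by (simp add: insert_gen_val list_prod_append image_subset_iff m_assoc)
qed simp

lemma sort_word_val: "xprod (sort_word Q) = xprod Q"
  by (induction Q) (simp_all add: insert_gen_val)

definition pair_val :: "nat list \<times> nat list \<Rightarrow> 'a" where
  "pair_val S = xprod (rev (fst S)) \<otimes> inv (xprod (snd S))"

lemma append_gen_val: "pair_val (append_gen s S) = pair_val S \<otimes> sgen x y s"
proof (cases "(s, S)" rule: append_gen.cases)
  case (1 i P Q)
  obtain p Q' where p: "pull i Q = (p, Q')" by (cases "pull i Q")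
  \<comment> \<open>The first component is stored backwards, and \<open>append_gen\<close> puts
    \<open>p\<close> in front of it unreversed; this is right because \<open>p\<close> is empty or a
    single generator.\<close>
  have "length p \<le> 1"
    using p by (induction i Q arbitrary: p Q' rule: pull.induct)
      (auto split: if_splits prod.splits simp: apsnd_def map_prod_def)
  then have "rev p = p" by (cases p) auto
  then have "pair_val (append_gen s S) = xprod (rev P) \<otimes> (xprod p \<otimes> inv (xprod Q'))"
    using 1 p by (simp add: pair_val_def list_prod_append image_subset_iff m_assoc)
  also have "\<dots> = xprod (rev P) \<otimes> (inv (xprod Q) \<otimes> xgen x y i)"
    by (simp only: pull_val[OF p])
  finally show ?thesis using 1 by (simp add: pair_val_def sgen_def m_assoc)
next
  case (2 i P Q)
  then show ?thesis by (simp add: pair_val_def sgen_def inv_mult_group m_assoc)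
qed

lemma pair_val_closed [simp]: "pair_val S \<in> carrier G"
  by (simp add: pair_val_def)

lemma append_word_val: "pair_val (append_word w S) = pair_val S \<otimes> xval x y w"
  by (induction w S rule: append_word.induct) (simp_all add: append_gen_val xval_simps m_assoc)

lemma trivial_xword: "trivial_xword w \<Longrightarrow> xval x y w = \<one>"
proof -
  assume w: "trivial_xword w"
  obtain P Q where PQ: "append_word w ([], []) = (P, Q)" by (cases "append_word w ([], [])")
  have "xprod (rev P) = xprod Q"
    using w sort_rev_val[of P "[]"] sort_word_val[of Q] by (simp add: trivial_xword_def PQ)
  then have "pair_val (P, Q) = \<one>" by (simp add: pair_val_def)
  then show ?thesis using append_word_val[of w "([], [])"] by (simp add: PQ pair_val_def)
qed

end
end
end

text \<open>Cosets are represented by paths in a spanning tree, last letter first, with letters coded by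
  \<open>0, \<dots>, 3\<close>. A jump \<open>(c, p, hs)\<close> at a path \<open>t\<close> stands for the relation
  \<open>t c = h p\<close>, where \<open>h\<close> is the product of the elements \<open>bump_pow i\<close> for \<open>i\<close> in \<open>hs\<close>.\<close>

definition code_letter :: "int \<Rightarrow> letter" where
  "code_letter c = (if c = 0 then LA else if c = 1 then LA_inv else if c = 2 then LB else LB_inv)"

definition code_gen :: "int \<Rightarrow> bool \<times> nat" where
  "code_gen c = (if c = 0 then (True, 0) else if c = 1 then (False, 0)
     else if c = 2 then (True, Suc 0) else (False, Suc 0))"

fun path_word :: "int list \<Rightarrow> xword" where
  "path_word [] = []"
| "path_word (c # t) = path_word t @ [code_gen c]"

fun path_inv :: "int list \<Rightarrow> xword" where
  "path_inv [] = []"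
| "path_inv (c # t) = apfst Not (code_gen c) # path_inv t"

fun path_step :: "int list \<Rightarrow> letter \<Rightarrow> int list" where
  "path_step t LA = toggle 0 1 t"
| "path_step t LA_inv = toggle 1 0 t"
| "path_step t LB = toggle 2 3 t"
| "path_step t LB_inv = toggle 3 2 t"

text \<open>The copies of \<open>x\<^sub>0\<close> on the intervals \<open>[0, 1/4]\<close>, \<open>[1/4, 1/2]\<close>, \<open>[1/2, 3/4]\<close>, \<open>[3/4, 1]\<close>.\<close>

definition bump :: "int \<Rightarrow> xword" where
  "bump i =
     (if i = 1 then [(True, 0), (True, 0), (True, 0), (False, Suc 0), (False, 0), (False, 0)]
      else if i = 2 then [(True, 0), (True, Suc 0), (True, Suc 0), (False, Suc (Suc 0)), (False, Suc 0), (False, 0)]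
      else if i = 3 then [(True, Suc 0), (True, Suc 0), (False, Suc (Suc 0)), (False, Suc 0)]
      else if i = 4 then [(True, Suc (Suc 0))]
      else [])"

text \<open>Signed indices let an integer list encode a product of bumps and their inverses; 0 and
  all indices beyond 4 in absolute value give the empty word.\<close>

definition bump_pow :: "int \<Rightarrow> xword" where
  "bump_pow i = (if i < 0 then xword_inv (bump (- i)) else bump i)"

lemma bump_pow_simps:
  "bump_pow 1 = [(True, 0), (True, 0), (True, 0), (False, Suc 0), (False, 0), (False, 0)]"
  "bump_pow 2 = [(True, 0), (True, Suc 0), (True, Suc 0), (False, Suc (Suc 0)), (False, Suc 0), (False, 0)]"
  "bump_pow 3 = [(True, Suc 0), (True, Suc 0), (False, Suc (Suc 0)), (False, Suc 0)]"
  "bump_pow 4 = [(True, Suc (Suc 0))]"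
  "bump_pow (- 1) = [(True, 0), (True, 0), (True, Suc 0), (False, 0), (False, 0), (False, 0)]"
  "bump_pow (- 2) = [(True, 0), (True, Suc 0), (True, Suc (Suc 0)), (False, Suc 0), (False, Suc 0), (False, 0)]"
  "bump_pow (- 3) = [(True, Suc 0), (True, Suc (Suc 0)), (False, Suc 0), (False, Suc 0)]"
  "bump_pow (- 4) = [(False, Suc (Suc 0))]"
  by (simp_all add: bump_pow_def bump_def)

fun bumps_inv :: "int list \<Rightarrow> xword" where
  "bumps_inv [] = []"
| "bumps_inv (i # hs) = bumps_inv hs @ bump_pow (- i)"

type_synonym jump = "int \<times> int list \<times> int list"

fun jumps_ok :: "int list \<Rightarrow> jump list \<Rightarrow> bool" where
  "jumps_ok t [] = True"
| "jumps_ok t ((c, p, hs) # js) \<longleftrightarrow>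
     trivial_xword (path_word t @ code_gen c # path_inv p @ bumps_inv hs) \<and> jumps_ok t js"

fun jump_edges :: "jump list \<Rightarrow> (letter \<times> int list) list" where
  "jump_edges [] = []"
| "jump_edges ((c, p, hs) # js) = (code_letter c, p) # jump_edges js"

fun edges :: "int list \<Rightarrow> letter list \<Rightarrow> jump list \<Rightarrow> (letter \<times> int list) list" where
  "edges t [] js = jump_edges js"
| "edges t (l # ls) js = (l, path_step t l) # edges t ls js"

fun edge_sum :: "('s \<Rightarrow> int) \<Rightarrow> (letter \<times> 's) list \<Rightarrow> int" where
  "edge_sum F [] = 0"
| "edge_sum F ((l, t) # es) = F t + edge_sum F es"

text \<open>Distinctness of the letters prevents an edge from being counted both along the spanning
  tree and as a jump.\<close>

definition edges_ok :: "int \<Rightarrow> int \<Rightarrow> int \<Rightarrow> ('s \<Rightarrow> int) \<Rightarrow> int \<Rightarrow> (letter \<times> 's) list \<Rightarrow> bool" where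
  "edges_ok a c d F f es \<longleftrightarrow> distinct (map fst es) \<and>
     f * degree_weight c d (map fst es) \<le> a * edge_sum F es"

text \<open>The annotation \<open>m\<close> of a node pairs the bit mask of its counted spanning
  tree edges with the list of its jumps.\<close>

definition thompson_ok ::
    "int \<Rightarrow> int \<Rightarrow> int \<Rightarrow> (int list \<Rightarrow> int) \<Rightarrow> int list \<Rightarrow> int \<Rightarrow> int \<times> jump list \<Rightarrow> bool" where
  "thompson_ok a c d F t f m \<longleftrightarrow> 0 \<le> f \<and> jumps_ok t (snd m) \<and>
     edges_ok a c d F f (edges t (mask_letters (fst m)) (snd m))"

lemma edge_sum_eq: "edge_sum F es = (\<Sum>(l, t)\<leftarrow>es. F t)"
  by (induction es) auto

lemma mem_edges:
  "(l, u) \<in> set (edges t ls js) \<Longrightarrow> u = path_step t l \<or> (\<exists>c hs. l = code_letter c \<and> (c, u, hs) \<in> set js)"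
proof (induction ls)
  case Nil
  have "(l, u) \<in> set (jump_edges js) \<Longrightarrow> \<exists>c hs. l = code_letter c \<and> (c, u, hs) \<in> set js"
    by (induction js rule: jump_edges.induct) auto
  with Nil show ?case by simp
qed auto

lemma jumps_ok_mem:
  "jumps_ok t js \<Longrightarrow> (c, p, hs) \<in> set js \<Longrightarrow>
     trivial_xword (path_word t @ code_gen c # path_inv p @ bumps_inv hs)"
  by (induction t js rule: jumps_ok.induct) auto

section \<open>From a checked table to a bound for \<open>rho\<close>\<close>

context group
begin

context
  fixes x y :: 'a
  assumes xy: "x \<in> carrier G" "y \<in> carrier G"
begin

lemma sgen_code_gen: "sgen x y (code_gen c) = letter_val G x y (code_letter c)"
  by (simp add: sgen_def code_gen_def code_letter_def)

lemma sgen_Not: "sgen x y (apfst Not s) = inv (sgen x y s)"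
  by (cases s) (simp add: sgen_def xgen_closed[OF xy])

lemma xval_path_inv: "xval x y (path_inv t) = inv (xval x y (path_word t))"
  by (induction t)
    (simp_all add: xval_simps xval_append xy sgen_Not inv_mult_group)

lemma xval_bump_pow_neg: "xval x y (bump_pow (- i)) = inv (xval x y (bump_pow i))"
proof (cases i "0 :: int" rule: linorder_cases)
  case equal
  then show ?thesis by (simp add: bump_pow_def bump_def xval_simps xy)
qed (simp_all add: bump_pow_def xval_inv xy)

lemma xval_bumps_inv:
  "xval x y (bumps_inv hs) = inv (list_prod (map (\<lambda>i. xval x y (bump_pow i)) hs))"
proof (induction hs)
  case (Cons i hs)
  have "list_prod (map (\<lambda>i. xval x y (bump_pow i)) hs) \<in> carrier G"
    by (rule list_prod_closed) (auto simp: xy)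
  with Cons show ?case by (simp add: xval_append xval_bump_pow_neg inv_mult_group xy)
qed (simp add: xval_simps xy)

lemma path_word_path_step:
  "xval x y (path_word (path_step t l)) = xval x y (path_word t) \<otimes> letter_val G x y l"
proof -
  have "xval x y (path_word (toggle d e t)) = xval x y (path_word t) \<otimes> sgen x y (code_gen d)"
    if "sgen x y (code_gen e) = inv (sgen x y (code_gen d))" for d e
    using that by (cases t) (auto simp: xval_append xval_simps xy m_assoc)
  then show ?thesis
    by (cases l) (simp_all add: sgen_code_gen code_letter_def xy)
qed

context
  assumes comm2: "(x \<otimes> inv y) \<otimes> xgen x y 2 = xgen x y 2 \<otimes> (x \<otimes> inv y)"
    and comm3: "(x \<otimes> inv y) \<otimes> xgen x y 3 = xgen x y 3 \<otimes> (x \<otimes> inv y)"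
begin

text \<open>As homeomorphisms, bumps on different quarters have disjoint supports. In the abstract
  group, the word procedure confirms the sixteen commutators of positive indices; negative indices
  follow with \<open>commute_inv\<close>, and all other indices give the identity.\<close>

lemma bumps_commute:
  "xval x y (bump_pow i) \<otimes> xval x y (bump_pow j) = xval x y (bump_pow j) \<otimes> xval x y (bump_pow i)"
proof -
  have triv: "trivial_xword (bump_pow i @ bump_pow j @ bump_pow (- i) @ bump_pow (- j))"
    if "i \<in> {1, 2, 3, 4}" "j \<in> {1, 2, 3, 4}" for i j
    using that by (auto simp: bump_pow_simps trivial_xword_def)
  have base: "xval x y (bump_pow i) \<otimes> xval x y (bump_pow j) = xval x y (bump_pow j) \<otimes> xval x y (bump_pow i)"
    if ij: "i \<in> {1, 2, 3, 4}" "j \<in> {1, 2, 3, 4}" for i j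
  proof -
    let ?g = "xval x y (bump_pow i)" and ?h = "xval x y (bump_pow j)"
    have "?g \<otimes> ?h \<otimes> inv (?h \<otimes> ?g) = \<one>"
      using trivial_xword[OF xy comm2 comm3 triv[OF ij]]
      by (simp add: xval_append xval_bump_pow_neg xy inv_mult_group m_assoc)
    then show ?thesis using xy by (simp add: inv_equality[symmetric] inv_solve_right')
  qed
  have one: "xval x y (bump_pow i) = \<one>" if "i \<notin> {1, 2, 3, 4}" "- i \<notin> {1, 2, 3, 4}" for i
    using that by (simp add: bump_pow_def bump_def xval_simps xy)
  have c: "xval x y (bump_pow i) \<in> carrier G" for i using xy by simp
  have neg: "xval x y (bump_pow i) = inv (xval x y (bump_pow (- i)))" for i
    using xval_bump_pow_neg[of "- i"] by simp
  have half: "xval x y (bump_pow i) \<otimes> xval x y (bump_pow j) = xval x y (bump_pow j) \<otimes> xval x y (bump_pow i)"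
    if i: "i \<in> {1, 2, 3, 4}" for i j
  proof -
    consider "j \<in> {1, 2, 3, 4}" | "- j \<in> {1, 2, 3, 4}" | "j \<notin> {1, 2, 3, 4}" "- j \<notin> {1, 2, 3, 4}"
      by blast
    then show ?thesis
    proof cases
      case 1
      then show ?thesis by (rule base[OF i])
    next
      case 2
      show ?thesis unfolding neg[of j] by (rule commute_inv[OF base[OF 2 i] c c, symmetric])
    next
      case 3
      show ?thesis by (simp only: one[OF 3] l_one r_one c)
    qed
  qed
  consider "i \<in> {1, 2, 3, 4}" | "- i \<in> {1, 2, 3, 4}" | "i \<notin> {1, 2, 3, 4}" "- i \<notin> {1, 2, 3, 4}"
    by blast
  then show ?thesis
  proof cases
    case 1
    then show ?thesis by (rule half)
  next
    case 2
    show ?thesis unfolding neg[of i] by (rule commute_inv[OF half[OF 2] c c])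
  next
    case 3
    show ?thesis by (simp only: one[OF 3] l_one r_one c)
  qed
qed

lemma rho_ge_thompson_table:
  fixes P Q :: int and T :: "(int \<times> jump list) trie"
  assumes PQ: "0 < P" "0 < Q" "3 * Q\<^sup>2 \<le> P\<^sup>2"
    and ok: "chk (thompson_ok (P * Q) (P\<^sup>2 - Q\<^sup>2) (Q\<^sup>2) (\<lambda>t. look T (rev t))) [] T"
    and root: "look T [] \<noteq> 0"
  shows "ereal (P / Q + 3 / (P / Q)) \<le> rho G x y"
proof -
  define F where "F t = look T (rev t)" for t
  let ?h = "\<lambda>i. xval x y (bump_pow i)" and ?rep = "\<lambda>t. xval x y (path_word t)"
  have okF: "\<exists>m. thompson_ok (P * Q) (P\<^sup>2 - Q\<^sup>2) (Q\<^sup>2) F t (F t) m" if "F t \<noteq> 0" for t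
    using chk_nonzero(1)[OF ok, of "rev t"] that by (simp add: F_def[abs_def])
  have F0: "0 \<le> F t" for t
    using okF[of t] by (cases "F t = 0") (auto simp: thompson_ok_def)
  show ?thesis
  proof (rule rho_ge_edges[where E = "range ?h" and rep = ?rep and f = "\<lambda>t. real_of_int (F t)"
        and ?s0.0 = "[]", OF xy])
    \<comment> \<open>Outside \<open>{- 4..4}\<close> only the empty word occurs, so
      \<open>E\<close> is finite although it is indexed by all integers.\<close>
    have "range bump_pow \<subseteq> bump_pow ` {- 4..4}"
    proof (rule image_subsetI)
      fix i :: int
      show "bump_pow i \<in> bump_pow ` {- 4..4}"
      proof (cases "i \<in> {- 4..4}")
        case False
        then have "bump_pow i = bump_pow 0" by (auto simp: bump_pow_def bump_def)
        then show ?thesis by auto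
      qed auto
    qed
    then have "finite (range bump_pow)" by (rule finite_subset) simp
    then have "finite (xval x y ` range bump_pow)" by (rule finite_imageI)
    then show "finite (range ?h)" by (simp add: image_image)
    show "range ?h \<subseteq> carrier G" using xy by auto
    show "g \<otimes> h = h \<otimes> g" if "g \<in> range ?h" "h \<in> range ?h" for g h
      using that bumps_commute by auto
    show "finite {t. 0 < real_of_int (F t)}" unfolding F_def by (rule finite_look_rev)
    show "0 < real_of_int (F [])" using root F0[of "[]"] by (simp add: F_def)
    show "3 \<le> (real_of_int P / real_of_int Q)\<^sup>2" by (rule ratio_square_ge[OF PQ(2,3)])
    fix t assume "0 < real_of_int (F t)"
    then obtain m where m: "thompson_ok (P * Q) (P\<^sup>2 - Q\<^sup>2) (Q\<^sup>2) F t (F t) m"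
      using okF[of t] by auto
    define es where "es = edges t (mask_letters (fst m)) (snd m)"
    have "distinct (map fst es)" using m by (simp add: thompson_ok_def edges_ok_def es_def)
    moreover have "\<exists>hs. set hs \<subseteq> range ?h \<and> ?rep t \<otimes> letter_val G x y l = list_prod hs \<otimes> ?rep u"
      if "(l, u) \<in> set es" for l u
      using mem_edges[OF that[unfolded es_def]]
    proof (elim disjE exE conjE)
      assume "u = path_step t l"
      then show ?thesis using xy by (intro exI[of _ "[]"]) (simp add: path_word_path_step letter_val_closed)
    next
      fix c hs assume l: "l = code_letter c" and "(c, u, hs) \<in> set (snd m)"
      then have "trivial_xword (path_word t @ code_gen c # path_inv u @ bumps_inv hs)"
        using m jumps_ok_mem by (auto simp: thompson_ok_def)
      then have "xval x y (path_word t @ code_gen c # path_inv u @ bumps_inv hs) = \<one>"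
        by (rule trivial_xword[OF xy comm2 comm3])
      moreover define g where "g = list_prod (map ?h hs)"
      have g: "g \<in> carrier G" unfolding g_def using xy by (intro list_prod_closed) auto
      moreover have lv: "letter_val G x y l \<in> carrier G" using xy by (rule letter_val_closed)
      ultimately have "(?rep t \<otimes> letter_val G x y l) \<otimes> inv (g \<otimes> ?rep u) = \<one>"
        using xy by (simp add: xval_append xval_simps xval_path_inv xval_bumps_inv l sgen_code_gen
            inv_mult_group m_assoc flip: g_def)
      then have "?rep t \<otimes> letter_val G x y l = g \<otimes> ?rep u"
        using g lv xy by (simp add: inv_solve_right')
      then show ?thesis unfolding g_def by (intro exI[of _ "map ?h hs"]) auto
    qed
    moreover have "(real_of_int P / real_of_int Q + (real (length es) - 1) / (real_of_int P / real_of_int Q))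
        * real_of_int (F t) \<le> (\<Sum>(l, u)\<leftarrow>es. real_of_int (F u))"
    proof -
      have "real_of_int (\<Sum>(l, u)\<leftarrow>es. F u) = (\<Sum>(l, u)\<leftarrow>es. real_of_int (F u))"
        for es :: "(letter \<times> int list) list"
        by (induction es) auto
      moreover have "(real_of_int P / real_of_int Q + (real (length es) - 1) / (real_of_int P / real_of_int Q))
          * real_of_int (F t) \<le> real_of_int (\<Sum>(l, u)\<leftarrow>es. F u)"
        using m PQ
        by (intro core_ineq_of_int)
          (auto simp: thompson_ok_def edges_ok_def edge_sum_eq degree_weight_eq es_def)
      ultimately show ?thesis by simp
    qed
    ultimately show "\<exists>es. distinct (map fst es) \<and>
        (\<forall>(l, u)\<in>set es. \<exists>hs. set hs \<subseteq> range ?h \<and> ?rep t \<otimes> letter_val G x y l = list_prod hs \<otimes> ?rep u) \<and>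
        (real_of_int P / real_of_int Q + (real (length es) - 1) / (real_of_int P / real_of_int Q))
          * real_of_int (F t) \<le> (\<Sum>(l, u)\<leftarrow>es. real_of_int (F u))"
      by blast
  qed (use PQ F0 xy in auto)
qed

end
end
end

lemma rho_thompson_ge:
  fixes P Q :: int and T :: "(int \<times> jump list) trie"
  assumes "0 < P" "0 < Q" "3 * Q\<^sup>2 \<le> P\<^sup>2"
    and "chk (thompson_ok (P * Q) (P\<^sup>2 - Q\<^sup>2) (Q\<^sup>2) (\<lambda>t. look T (rev t))) [] T"
    and "look T [] \<noteq> 0"
  shows "ereal (P / Q + 3 / (P / Q)) \<le> rho thompson_F (gen_a thompson_relators) (gen_b thompson_relators)"
proof -
  let ?R = thompson_relators and ?G = thompson_F
  let ?x = "gen_a ?R" and ?y = "gen_b ?R"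
  interpret group ?G unfolding thompson_F_def by (rule group_presented_group)
  have xy: "?x \<in> carrier ?G" "?y \<in> carrier ?G"
    by (simp_all add: thompson_F_def gen_a_def gen_b_def pres_class_in_carrier)
  have comm: "word_val ?G ?x ?y u \<otimes>\<^bsub>?G\<^esub> word_val ?G ?x ?y v = word_val ?G ?x ?y v \<otimes>\<^bsub>?G\<^esub> word_val ?G ?x ?y u"
    if "word_comm u v \<in> ?R" for u v
  proof -
    have "pres_eq ?R (word_comm u v) []"
      using pres_relator[OF that, of "[]" "[]"] by simp
    then have "word_val ?G ?x ?y (word_comm u v) = \<one>\<^bsub>?G\<^esub>"
      unfolding thompson_F_def word_val_eq_one_iff .
    then have "(word_val ?G ?x ?y u \<otimes>\<^bsub>?G\<^esub> word_val ?G ?x ?y v) \<otimes>\<^bsub>?G\<^esub>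
        inv\<^bsub>?G\<^esub> (word_val ?G ?x ?y v \<otimes>\<^bsub>?G\<^esub> word_val ?G ?x ?y u) = \<one>\<^bsub>?G\<^esub>"
      using xy by (simp add: word_comm_def word_val_append word_val_word_inv word_val_closed
          inv_mult_group m_assoc)
    then show ?thesis using xy by (simp add: inv_solve_right' word_val_closed)
  qed
  \<comment> \<open>The words in the two relators spell \<open>x \<otimes> inv y\<close> and the
    generators of index 2 and 3, so the relators are the hypotheses \<open>comm2\<close> and
    \<open>comm3\<close>.\<close>
  have v: "word_val ?G ?x ?y [LA, LB_inv] = ?x \<otimes>\<^bsub>?G\<^esub> inv\<^bsub>?G\<^esub> ?y"
      "word_val ?G ?x ?y [LA_inv, LB, LA] = xgen ?x ?y 2"
      "word_val ?G ?x ?y [LA_inv, LA_inv, LB, LA, LA] = xgen ?x ?y 3"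
    using xy by (simp_all add: word_val_Cons m_assoc numeral_2_eq_2 numeral_3_eq_3)
  have "(?x \<otimes>\<^bsub>?G\<^esub> inv\<^bsub>?G\<^esub> ?y) \<otimes>\<^bsub>?G\<^esub> xgen ?x ?y 2 = xgen ?x ?y 2 \<otimes>\<^bsub>?G\<^esub> (?x \<otimes>\<^bsub>?G\<^esub> inv\<^bsub>?G\<^esub> ?y)"
      "(?x \<otimes>\<^bsub>?G\<^esub> inv\<^bsub>?G\<^esub> ?y) \<otimes>\<^bsub>?G\<^esub> xgen ?x ?y 3 = xgen ?x ?y 3 \<otimes>\<^bsub>?G\<^esub> (?x \<otimes>\<^bsub>?G\<^esub> inv\<^bsub>?G\<^esub> ?y)"
    using comm[of "[LA, LB_inv]" "[LA_inv, LB, LA]"]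
      comm[of "[LA, LB_inv]" "[LA_inv, LA_inv, LB, LA, LA]"]
    unfolding v by (simp_all add: thompson_relators_def)
  then show ?thesis using assms by (intro rho_ge_thompson_table[OF xy])
qed

lemmas thompson_ok_simps = thompson_ok_def edges_ok_def mask_letters_simps code_letter_def code_gen_def
  trivial_xword_def bump_pow_simps

section \<open>The table for Thompson's group\<close>

abbreviation j :: "int \<Rightarrow> int list \<Rightarrow> jump" where
  "j c p \<equiv> (c, p, [])"

abbreviation Z :: "int \<Rightarrow> int \<Rightarrow> (int \<times> jump list) trie list \<Rightarrow> (int \<times> jump list) trie" where
  "Z f m ts \<equiv> N f (m, []) ts"

abbreviation H :: "int \<Rightarrow> int \<Rightarrow> jump list \<Rightarrow> (int \<times> jump list) trie" where
  "H f m js \<equiv> N f (m, js) []"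

text \<open>For a coset fixed by \<open>b\<close>: with \<open>p\<close> the path of the node
  itself, both \<open>b\<close>-edges return to it and contribute a bump or its inverse. For
  example, \<open>a\<inverse> b\<close> equals \<open>a\<inverse> b a\<close>, which is bump 4,
  times \<open>a\<inverse>\<close>.\<close>

abbreviation loop :: "int list \<Rightarrow> int \<Rightarrow> jump list" where
  "loop p i \<equiv> [(2, p, [i]), (3, p, [- i])]"

definition thompson_1 :: "(int \<times> jump list) trie" where
"thompson_1 = Z 7046 15 [N 5260 (11,[(2,[0,0,2,0],[-1])]) [H 3993 2 [(3,[0,2,0],[1])],E,E,Z 3663 15 [Z 1735 10
[E,E,E,Z 907 6 [E,Z 655 13 [E,E,H 515 8 [(0,[3,0,3,0,2,2,0],[-2])],Z 605 7 [H 664 2 [j 2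
[0,0,3,1,3,0,2,0]],H 553 1 (loop [1,3,1,3,0,3,0,2,0] 4)]]]],Z 3605 15 [E,Z 3529 15 [E,H 3226 1
(loop [1,1,1,3,0,2,0] 4),N 3747 (14,[j 0 [1,3,0,2,0,2]]) [E,Z 2900 15 [E,H 2651 1 (loop
[1,1,2,1,1,3,0,2,0] 4),N 2467 (10,[(0,[2,2,1,1,3,0,2,0],[-3])]) [E,Z 1607 7 [E,H 1469 1 (loop
[1,1,2,1,2,1,1,3,0,2,0] 4),H 1037 8 [(0,[1,2,2,2,1,1,3,0,2,0],[-3,-3])]]],Z 1443 5 [H 903 2 [j 0
[1,3,0,2,0,0,3,1,2]]]],N 3127 (12,[j 0 [1,3,0,2,0,2,2],(1,[2,1,2,1,1,3,0,2,0],[3])]) [E,E,N 1930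
(14,[j 0 [1,3,0,2,0,2,2,2]]) [E,H 1126 1 [(1,[2,1,2,1,2,1,1,3,0,2,0],[3,3])],H 992 8 [j 0
[1,3,0,2,0,2,2,2,2]]]]],N 1964 (12,[j 0 [1,3,0,2,0,3]]) [E,E,E,H 993 4 [j 0 [1,3,0,2,0,3,3]]]],N
2810 (14,[(0,[3,0,2,2,0],[-2])]) [E,Z 2050 15 [E,Z 1866 15 [E,H 1705 1 (loop [1,1,1,2,1,3,0,2,0]
4),N 1863 (14,[j 0 [1,2,1,3,0,2,0,2]]) [E,Z 1346 7 [E,H 1230 1 (loop [1,1,2,1,1,2,1,3,0,2,0] 4),H
1072 8 [(0,[2,2,1,1,2,1,3,0,2,0],[-3])]],N 1478 (12,[j 0
[1,2,1,3,0,2,0,2,2],(1,[2,1,2,1,1,2,1,3,0,2,0],[3])]) [E,E,H 850 8 [j 0 [1,2,1,3,0,2,0,2,2,2]]]],H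
1015 4 [j 0 [1,2,1,3,0,2,0,3]]],H 1142 8 [(0,[1,3,0,2,2,2,0],[-2,-2])],Z 1469 7 [N 1154
(10,[(0,[3,0,2,0,3,1,2,0],[-2])]) [E,E,E,Z 791 7 [H 571 2 [j 2 [0,0,3,0,3,1,2,1,2,0]],H 723 1
(loop [1,3,0,3,1,2,1,3,0,2,0] 4)]],H 1342 1 (loop [1,3,1,2,1,3,0,2,0] 4)]],Z 1518 13 [H 1139 2 [j
2 [0,0,2,2,1,2,0]],E,Z 748 9 [H 453 2 [j 2 [0,0,2,2,2,1,2,0]]]]],Z 2810 15 [N 2355 (11,[j 2
[0,0,3,1,2,0]]) [H 1146 2 [j 3 [0,3,1,3,0,3,0,2,0]],E,E,Z 1369 6 [E,H 1251 1 (loop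
[1,3,0,3,1,3,0,2,0] 4)]],H 2568 1 (loop [1,3,1,3,0,2,0] 4),E,Z 1459 5 [H 1034 2 [j 2
[0,0,3,3,1,2,0]]]]],E,Z 2420 14 [E,Z 2419 15 [E,H 2211 1 (loop [1,1,3,3,0,2,0] 4),N 2575 (14,[j 0
[3,3,0,2,0,2]]) [E,Z 2000 15 [E,H 1828 1 (loop [1,1,2,1,3,3,0,2,0] 4),N 1714
(10,[(0,[2,2,1,3,3,0,2,0],[-3])]) [E,Z 1121 7 [E,H 1024 1 (loop [1,1,2,1,2,1,3,3,0,2,0] 4),H 731 8
[(0,[1,2,2,2,1,3,3,0,2,0],[-3,-3])]]],Z 992 5 [H 615 2 [j 0 [3,3,0,2,0,0,3,1,2]]]],N 2184 (12,[j 0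
[3,3,0,2,0,2,2],(1,[2,1,2,1,3,3,0,2,0],[3])]) [E,E,N 1392 (14,[j 0 [3,3,0,2,0,2,2,2]]) [E,H 806 1
[(1,[2,1,2,1,2,1,3,3,0,2,0],[3,3])],H 754 8 [j 0 [3,3,0,2,0,2,2,2,2]]]]],N 1391 (12,[j 0
[3,3,0,2,0,3]]) [E,E,E,H 739 4 [j 0 [3,3,0,2,0,3,3]]]],E,Z 1406 6 [E,H 1285 1 (loop
[1,3,3,3,0,2,0] 4)]]]],Z 7178 15 [E,Z 7358 15 [E,H 6723 1 (loop [1,1,1,2,0] 4),N 8157 (14,[j 0
[1,2,0,2]]) [E,Z 6645 15 [E,H 6072 1 (loop [1,1,2,1,1,2,0] 4),N 5901 (14,[(0,[2,2,1,1,2,0],[-3])])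
[E,Z 4173 15 [E,H 3814 1 (loop [1,1,2,1,2,1,1,2,0] 4),N 2950 (14,[(0,[1,2,2,2,1,1,2,0],[-3,-3])])
[E,Z 1829 7 [E,H 1671 1 (loop [1,1,2,1,2,1,2,1,1,2,0] 4),H 1038 8
[(0,[1,1,2,2,2,2,1,1,2,0],[-3,-3,-3])]],Z 1506 9 [H 1019 2 [(0,[2,0,2,2,1,2,1,1,2,0],[-3])]]],Z
2167 13 [H 1469 2 [(0,[2,0,3,1,2,1,1,2,0],[-3])],E,E,Z 1064 5 [H 638 2
[(0,[2,0,3,3,1,2,1,1,2,0],[-3])]]]],Z 3070 11 [N 1943 (6,[j 0 [1,2,0,0,2,2,1,2]]) [E,E,H 1178 8 [j
0 [1,2,0,2,0,2,2,1,2],(1,[0,2,2,1,2,1,2,1,1,2,0],[3])]],Z 1656 11 [E,Z 1093 7 [E,H 999 1 (loop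
[1,1,1,2,2,1,2,1,1,2,0] 4),H 727 8 [(0,[1,2,1,2,2,2,1,1,2,0],[-3,-3])]],E,Z 962 6 [E,H 879 1 (loop
[1,3,1,2,2,1,2,1,1,2,0] 4)]]]],Z 3488 13 [N 2448 (6,[j 0 [1,2,0,0,3,1,2]]) [E,E,H 1703 8 [j 0
[1,2,0,2,0,3,1,2],(1,[0,3,1,2,1,2,1,1,2,0],[3])]],E,E,Z 1699 5 [N 989 (6,[j 0 [1,2,0,0,3,3,1,2]])
[E,E,H 617 8 [(1,[0,3,3,1,2,1,2,1,1,2,0],[3])]]]]],N 7085 (12,[j 0
[1,2,0,2,2],(1,[2,1,2,1,1,2,0],[3])]) [E,E,N 4586 (14,[j 0 [1,2,0,2,2,2]]) [E,N 2977
(13,[(1,[2,1,2,1,2,1,1,2,0],[3,3])]) [E,E,Z 1442 10 [E,H 823 1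
[(1,[2,1,1,2,2,1,2,1,1,2,0],[3,3])]],Z 1604 14 [E,Z 1054 7 [E,H 963 1 (loop
[1,1,3,1,2,2,2,1,1,2,0] 4),H 694 8 [(0,[3,1,2,2,2,2,1,1,2,0],[-3])]],E,Z 932 6 [E,H 851 1 (loop
[1,3,3,1,2,2,2,1,1,2,0] 4)]]],N 2493 (10,[j 0 [1,2,0,2,2,2,2]]) [E,Z 1349 11 [E,H 906 1
[(1,[2,1,2,1,2,1,2,1,1,2,0],[3,3,3])],E,H 775 4 [(1,[2,1,3,1,2,2,2,1,1,2,0],[3])]]]]]],N 4094
(12,[j 0 [1,2,0,3]]) [E,E,E,H 2121 4 [j 0 [1,2,0,3,3]]]],N 5969 (14,[(0,[2,2,0],[-2])]) [E,Z 4996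
15 [E,Z 4935 15 [E,H 4510 1 (loop [1,1,1,2,1,2,0] 4),N 5285 (14,[j 0 [1,2,1,2,0,2]]) [E,Z 4138 15
[E,H 3782 1 (loop [1,1,2,1,1,2,1,2,0] 4),N 3545 (14,[(0,[2,2,1,1,2,1,2,0],[-3])]) [E,Z 2309 7 [E,H
2110 1 (loop [1,1,2,1,2,1,1,2,1,2,0] 4),H 1489 8 [(0,[1,2,2,2,1,1,2,1,2,0],[-3,-3])]],Z 1711 9 [H
964 2 [j 0 [1,2,1,2,0,0,2,2,1,2]]]],Z 2095 5 [N 1381 (6,[j 0 [1,2,1,2,0,0,3,1,2]]) [E,E,H 765 8 [j
0 [1,2,1,2,0,2,0,3,1,2]]]]],N 4443 (12,[j 0 [1,2,1,2,0,2,2],(1,[2,1,2,1,1,2,1,2,0],[3])]) [E,E,N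
2760 (14,[j 0 [1,2,1,2,0,2,2,2]]) [E,H 1613 1 [(1,[2,1,2,1,2,1,1,2,1,2,0],[3,3])],H 1444 8 [j 0
[1,2,1,2,0,2,2,2,2]]]]],N 2748 (12,[j 0 [1,2,1,2,0,3]]) [E,E,E,H 1403 4 [j 0 [1,2,1,2,0,3,3]]]],N
3307 (14,[(0,[1,2,2,2,0],[-2,-2])]) [E,Z 2300 15 [E,Z 2121 15 [E,H 1938 1 (loop
[1,1,1,2,1,2,1,2,0] 4),N 2133 (14,[j 0 [1,2,1,2,1,2,0,2]]) [E,Z 1544 7 [E,H 1411 1 (loop
[1,1,2,1,1,2,1,2,1,2,0] 4),H 1235 8 [(0,[2,2,1,1,2,1,2,1,2,0],[-3])]],N 1709 (12,[j 0
[1,2,1,2,1,2,0,2,2],(1,[2,1,2,1,1,2,1,2,1,2,0],[3])]) [E,E,H 996 8 [j 0 [1,2,1,2,1,2,0,2,2,2]]]],H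
1168 4 [j 0 [1,2,1,2,1,2,0,3]]],H 1214 8 [(0,[1,1,2,2,2,2,0],[-2,-2,-2])],Z 1534 7 [N 1045
(10,[(0,[1,2,2,0,3,1,2,0],[-2,-2])]) [E,E,E,Z 607 6 [E,H 554 1 (loop [1,3,0,3,1,2,1,2,1,2,0]
4)]],H 1402 1 (loop [1,3,1,2,1,2,1,2,0] 4)]],Z 1670 9 [H 1092 2 [(0,[2,0,2,2,1,2,0],[-2])]]],Z
3546 15 [N 2629 (14,[(0,[2,0,3,1,2,0],[-2])]) [E,E,Z 1341 10 [E,H 905 1 [j 1 [3,1,1,2,2,1,2,0]]],Z
1609 7 [Z 881 3 [N 713 (3,[(2,[0,0,0,3,0,3,1,2,1,2,0],[-1]),j 3 [0,3,0,3,1,2,1,3,0,2,0]]) [H 541 2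
[(3,[0,0,3,0,3,1,2,1,2,0],[1])]]],H 1470 1 (loop [1,3,0,3,1,2,1,2,0] 4)]],H 3241 1 (loop
[1,3,1,2,1,2,0] 4),E,Z 1737 5 [H 1030 2 [(0,[2,0,3,3,1,2,0],[-2])]]]],Z 3129 15 [Z 1881 7 [N 1483
(3,[(2,[0,0,0,2,2,1,2,0],[-1]),j 3 [0,2,2,1,3,0,2,0]]) [H 1126 2 [(3,[0,0,2,2,1,2,0],[1])]],E,N
1208 (9,[(1,[0,2,2,1,2,1,2,0],[2])]) [N 766 (3,[(2,[0,0,2,0,2,2,1,2,0],[-1])]) [H 581 2
[(3,[0,2,0,2,2,1,2,0],[1])]]]],Z 1810 11 [E,Z 1370 15 [E,Z 1177 7 [E,H 1075 1 (loop
[1,1,1,1,2,2,1,2,0] 4),N 1198 (14,[j 0 [1,1,2,2,1,2,0,2]]) [E,Z 857 7 [E,H 783 1 (loop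
[1,1,2,1,1,1,2,2,1,2,0] 4),H 672 8 [(0,[2,2,1,1,1,2,2,1,2,0],[-3])]],H 914 8 [j 0
[1,1,2,2,1,2,0,2,2],(1,[2,1,2,1,1,1,2,2,1,2,0],[3])]]],H 839 8 [(0,[1,2,1,2,2,2,0],[-2,-2])],N
1043 (6,[j 0 [1,2,0,3,1,2,1,2,0]]) [E,H 953 1 (loop [1,3,1,1,2,2,1,2,0] 4)]],E,Z 1102 14 [E,Z 961
7 [E,H 878 1 (loop [1,1,3,1,2,2,1,2,0] 4),N 994 (14,[j 0 [3,1,2,2,1,2,0,2]]) [E,Z 715 7 [E,H 653 1
(loop [1,1,2,1,3,1,2,2,1,2,0] 4),H 566 8 [(0,[2,2,1,3,1,2,2,1,2,0],[-3])]],H 776 8 [j 0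
[3,1,2,2,1,2,0,2,2],(1,[2,1,2,1,3,1,2,2,1,2,0],[3])]]],E,Z 640 6 [E,H 585 1 (loop
[1,3,3,1,2,2,1,2,0] 4)]]],Z 1463 9 [Z 725 3 [H 447 2 [j 3 [0,2,2,2,1,3,0,2,0]]]]]],Z 5137 15 [Z
3849 15 [N 3047 (3,[(2,[0,0,0,3,1,2,0],[-1]),j 3 [0,3,1,3,0,2,0]]) [H 2313 2
[(3,[0,0,3,1,2,0],[1])]],E,N 2848 (13,[(1,[0,3,1,2,1,2,0],[2])]) [N 2043
(11,[(2,[0,0,2,0,3,1,2,0],[-1])]) [H 1551 2 [(3,[0,2,0,3,1,2,0],[1])],E,E,N 1311
(12,[(1,[0,3,1,2,1,3,0,2,0],[2])]) [E,E,E,H 860 4 [j 1 [3,1,3,3,0,2,2,0]]]],E,Z 1602 11 [N 1016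
(3,[(2,[0,0,2,2,0,3,1,2,0],[-1])]) [H 771 2 [(3,[0,2,2,0,3,1,2,0],[1])]],N 1093
(9,[(1,[0,3,1,2,1,2,1,2,0],[2,2])]) [E,E,E,H 735 4 [j 1 [3,1,3,1,2,2,2,0]]]]],Z 2648 15 [N 1819
(11,[(2,[0,0,3,0,3,1,2,0],[-1])]) [H 1381 2 [(3,[0,3,0,3,1,2,0],[1])],E,E,Z 1057 6 [E,H 966 1
(loop [1,3,0,3,0,3,1,2,0] 4)]],H 2420 1 (loop [1,3,0,3,1,2,0] 4),E,Z 1323 5 [N 839
(3,[(2,[0,0,3,3,0,3,1,2,0],[-1])]) [H 637 2 [(3,[0,3,3,0,3,1,2,0],[1])]]]]],H 4694 1 (loop
[1,3,1,2,0] 4),E,Z 2536 5 [Z 1544 7 [N 1266 (3,[(2,[0,0,0,3,3,1,2,0],[-1]),j 3 [0,3,3,1,3,0,2,0]])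
[H 961 2 [(3,[0,0,3,3,1,2,0],[1])]],E,H 977 8 [(1,[0,3,3,1,2,1,2,0],[2])]]]]],N 5911
(13,[(1,[2,1,2,0],[2])]) [N 4287 (11,[(2,[0,0,2,2,0],[-1])]) [H 3255 2 [(3,[0,2,2,0],[1])],E,E,N
2816 (13,[(1,[2,1,3,0,2,0],[2])]) [Z 1335 10 [E,E,E,H 702 4 [(1,[2,1,3,0,3,0,2,0],[2])]],E,E,Z
1576 14 [E,Z 1222 15 [E,Z 1038 7 [E,H 948 1 (loop [1,1,1,3,3,0,2,2,0] 4),N 1043 (14,[j 0
[1,3,3,0,2,2,0,2]]) [E,Z 745 7 [E,H 681 1 (loop [1,1,2,1,1,3,3,0,2,2,0] 4),H 582 8
[(0,[2,2,1,1,3,3,0,2,2,0],[-3])]],H 788 8 [j 0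
[1,3,3,0,2,2,0,2,2],(1,[2,1,2,1,1,3,3,0,2,2,0],[3])]]],H 774 8 [(0,[3,3,0,2,2,2,0],[-2])],N 955
(6,[j 0 [3,3,0,2,0,3,1,2,0]]) [E,H 873 1 (loop [1,3,1,3,3,0,2,2,0] 4)]],E,Z 839 6 [E,Z 634 7 [E,H
579 1 (loop [1,1,3,3,3,0,2,2,0] 4),H 544 8 [j 0 [3,3,3,0,2,2,0,2]]]]]]],E,Z 3707 15 [N 2500
(11,[(2,[0,0,2,2,2,0],[-1])]) [H 1898 2 [(3,[0,2,2,2,0],[1])],E,E,Z 1382 14 [E,H 958 1
[(1,[2,1,2,1,3,0,2,0],[2,2])],E,H 818 4 [(1,[2,1,3,3,0,2,2,0],[2])]]],N 2789
(13,[(1,[2,1,2,1,2,0],[2,2])]) [E,E,Z 1378 10 [E,H 841 1 [(1,[2,1,1,2,2,1,2,0],[2,2])]],Z 1520 14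
[E,Z 1106 15 [E,Z 883 7 [E,H 807 1 (loop [1,1,1,3,1,2,2,2,0] 4),N 819 (14,[j 0 [1,3,1,2,2,2,0,2]])
[E,Z 476 3 [E,H 435 1 (loop [1,1,2,1,1,3,1,2,2,2,0] 4)],H 547 8 [j 0 [1,3,1,2,2,2,0,2,2]]]],H 684
8 [(0,[3,1,2,2,2,2,0],[-2])],N 844 (6,[j 0 [3,1,2,2,0,3,1,2,0]]) [E,H 771 1 (loop
[1,3,1,3,1,2,2,2,0] 4)]],E,Z 809 6 [E,Z 611 7 [E,H 558 1 (loop [1,1,3,3,1,2,2,2,0] 4),H 524 8 [j 0
[3,3,1,2,2,2,0,2]]]]]],Z 1976 11 [N 1254 (3,[(2,[0,0,2,2,2,2,0],[-1])]) [H 952 2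
[(3,[0,2,2,2,2,0],[1])]],Z 1154 11 [E,H 899 1 [(1,[2,1,2,1,2,1,2,0],[2,2,2])],E,H 697 4
[(1,[2,1,3,1,2,2,2,0],[2])]]]]]]"

definition thompson_2 :: "(int \<times> jump list) trie" where
"thompson_2 = Z 7630 15 [N 5699 (11,[(2,[0,0,0,2],[-1])]) [H 4326 2 [(3,[0,0,2],[1])],E,E,N 3972 (13,[j 1
[2,1,3,0,0]]) [Z 1957 10 [E,E,E,H 1183 4 [j 1 [2,1,3,0,3,0,0]]],E,E,Z 2333 14 [E,Z 1893 15 [E,H
1730 1 (loop [1,1,3,3,0,0,2] 4),N 1604 (14,[(0,[3,3,0,0,2,2],[-3])]) [E,Z 1021 7 [E,H 933 1 (loop
[1,1,2,1,3,3,0,0,2] 4),H 623 8 [(0,[1,3,3,0,0,2,2,2],[-3,-3])]],Z 892 9 [H 746 2 [j 2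
[3,0,0,0,2,2,1,2]]]],Z 1061 5 [H 902 2 [j 2 [3,0,0,0,3,1,2]]]],E,Z 1356 6 [E,H 1239 1 (loop
[1,3,3,3,0,0,2] 4)]]]],E,Z 7786 15 [N 5737 (11,[(2,[0,0,2,0,2],[-1])]) [H 4355 2
[(3,[0,2,0,2],[1])],E,E,Z 3894 14 [E,N 3762 (13,[j 1 [2,1,1,3,0,2,0]]) [E,E,N 2864
(14,[(0,[3,0,2,2,0,2],[-2])]) [E,N 1931 (13,[j 1 [2,1,1,2,1,3,0,2,0]]) [E,E,H 1097 8
[(0,[1,3,0,2,2,2,0,2],[-2,-2])],Z 1039 5 [H 806 2 [(0,[3,0,2,0,3,1,2,0,2],[-2])]]],Z 1576 13 [H
1194 2 [j 2 [0,0,2,2,1,2,0,2]],E,Z 820 9 [H 585 2 [j 2 [0,0,2,2,2,1,2,0,2]]]]],Z 2867 15 [H 2243 2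
[j 2 [0,0,3,1,2,0,2]],Z 2089 15 [E,H 1909 1 (loop [1,1,3,1,3,0,2,0,2] 4),H 1566 8
[(0,[3,1,3,0,2,0,2,2],[-3])],Z 1083 5 [H 766 2 [j 2 [1,3,0,2,0,0,3,1,2]]]],E,Z 2096 15 [H 1579 2
[j 2 [0,0,3,3,1,2,0,2]],H 1916 1 (loop [1,3,3,1,3,0,2,0,2] 4),E,Z 1088 5 [H 771 2 [j 2
[0,0,3,3,3,1,2,0,2]]]]]],E,N 2549 (12,[j 1 [2,1,3,3,0,2,0]]) [E,E,E,Z 1419 14 [E,Z 1018 7 [E,H 930
1 (loop [1,1,3,3,3,0,2,0,2] 4),H 801 8 [(0,[3,3,3,0,2,0,2,2],[-3])]],E,Z 825 6 [E,H 754 1 (loop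
[1,3,3,3,3,0,2,0,2] 4)]]]]],N 7902 (13,[j 1 [2,1,1,2,0]]) [E,E,N 6450 (14,[(0,[2,2,0,2],[-2])])
[E,N 5267 (13,[j 1 [2,1,1,2,1,2,0]]) [E,E,N 3401 (14,[(0,[1,2,2,2,0,2],[-2,-2])]) [E,N 2207 (13,[j
1 [2,1,1,2,1,2,1,2,0]]) [E,E,H 1179 8 [(0,[1,1,2,2,2,2,0,2],[-2,-2,-2])],Z 1133 5 [H 779 2
[(0,[1,2,2,0,3,1,2,0,2],[-2,-2])]]],Z 1723 9 [H 1138 2 [(0,[2,0,2,2,1,2,0,2],[-2])]]],Z 3583 15 [N
2437 (6,[(0,[2,0,3,1,2,0,2],[-2])]) [E,E,Z 1213 10 [E,H 758 1 [j 1 [3,1,1,2,2,1,2,0,2]]]],Z 2640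
15 [E,H 2413 1 (loop [1,1,3,1,2,1,2,0,2] 4),H 1979 8 [(0,[3,1,2,1,2,0,2,2],[-3])],Z 1408 5 [H 1071
2 [j 2 [1,2,1,2,0,0,3,1,2]]]],E,Z 2391 15 [H 1552 2 [(0,[2,0,3,3,1,2,0,2],[-2])],H 2185 1 (loop
[1,3,3,1,2,1,2,0,2] 4),E,Z 1179 5 [H 716 2 [(0,[2,0,3,3,3,1,2,0,2],[-2])]]]]],Z 3354 15 [Z 2004 7
[N 1570 (3,[(2,[0,0,0,2,2,1,2,0,2],[-1]),j 3 [0,2,2,1,3,0,2,0,2]]) [H 1192 2
[(3,[0,0,2,2,1,2,0,2],[1])]],E,N 1277 (9,[(1,[0,2,2,1,2,1,2,0,2],[2])]) [N 810
(3,[(2,[0,0,2,0,2,2,1,2,0,2],[-1])]) [H 615 2 [(3,[0,2,0,2,2,1,2,0,2],[1])]]]],Z 1857 11 [E,N 1311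
(13,[j 1 [2,1,1,1,2,2,1,2,0]]) [E,E,H 820 8 [(0,[1,2,1,2,2,2,0,2],[-2,-2])],H 785 4 [j 0
[1,2,0,3,1,2,1,2,0,2]]],E,H 1082 4 [j 1 [2,1,3,1,2,2,1,2,0]]],Z 1609 9 [Z 884 3 [N 721
(3,[(2,[0,0,0,2,2,2,1,2,0,2],[-1]),j 3 [0,2,2,2,1,3,0,2,0,2]]) [H 547 2
[(3,[0,0,2,2,2,1,2,0,2],[1])]]]]]],Z 5692 15 [Z 3948 15 [N 3041 (3,[(2,[0,0,0,3,1,2,0,2],[-1]),j 3
[0,3,1,3,0,2,0,2]]) [H 2309 2 [(3,[0,0,3,1,2,0,2],[1])]],E,N 2745 (13,[(1,[0,3,1,2,1,2,0,2],[2])])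
[N 1882 (11,[(2,[0,0,2,0,3,1,2,0,2],[-1])]) [H 1429 2 [(3,[0,2,0,3,1,2,0,2],[1])],E,E,N 1086
(12,[(1,[0,3,1,2,1,3,0,2,0,2],[2])]) [E,E,E,H 672 4 [j 1 [3,1,3,3,0,2,2,0,2]]]],E,Z 1489 11 [N 944
(3,[(2,[0,0,2,2,0,3,1,2,0,2],[-1])]) [H 716 2 [(3,[0,2,2,0,3,1,2,0,2],[1])]],N 919
(9,[(1,[0,3,1,2,1,2,1,2,0,2],[2,2])]) [E,E,E,H 576 4 [j 1 [3,1,3,1,2,2,2,0,2]]]]],Z 2553 15 [N
1620 (3,[(2,[0,0,3,0,3,1,2,0,2],[-1])]) [H 1230 2 [(3,[0,3,0,3,1,2,0,2],[1])]],Z 1856 15 [E,H 1696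
1 (loop [1,1,3,0,3,1,2,0,2] 4),H 1356 8 [(0,[3,0,3,1,2,0,2,2],[-3])],Z 992 5 [H 758 2 [j 2
[0,0,3,1,3,1,2,0,2]]]],E,Z 1651 7 [N 1047 (3,[(2,[0,0,3,3,0,3,1,2,0,2],[-1])]) [H 795 2
[(3,[0,3,3,0,3,1,2,0,2],[1])]],H 1509 1 (loop [1,3,3,0,3,1,2,0,2] 4)]]],Z 4508 15 [E,H 4120 1
(loop [1,1,3,1,2,0,2] 4),N 3750 (14,[(0,[3,1,2,0,2,2],[-3])]) [E,Z 2433 15 [E,H 2224 1 (loop
[1,1,2,1,3,1,2,0,2] 4),H 1438 8 [(0,[1,3,1,2,0,2,2,2],[-3,-3])],Z 1236 5 [H 823 2
[(0,[3,1,2,0,2,0,3,1,2],[-3])]]],Z 1960 9 [H 1413 2 [j 2 [1,2,0,0,2,2,1,2]]]],Z 2460 13 [N 1890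
(3,[j 2 [1,2,0,0,3,1,2]]) [H 1005 2 [j 3 [0,3,1,3,0,3,1,2,0,2]]],E,E,Z 1216 5 [H 744 2 [j 2
[1,2,0,0,3,3,1,2]]]]],E,Z 3872 15 [Z 2626 15 [N 2065 (3,[(2,[0,0,0,3,3,1,2,0,2],[-1]),j 3
[0,3,3,1,3,0,2,0,2]]) [H 1568 2 [(3,[0,0,3,3,1,2,0,2],[1])]],E,N 1698
(9,[(1,[0,3,3,1,2,1,2,0,2],[2])]) [N 1076 (3,[(2,[0,0,2,0,3,3,1,2,0,2],[-1])]) [H 817 2
[(3,[0,2,0,3,3,1,2,0,2],[1])]]],Z 1698 7 [N 1076 (3,[(2,[0,0,3,0,3,3,1,2,0,2],[-1])]) [H 817 2
[(3,[0,3,0,3,3,1,2,0,2],[1])]],H 1552 1 (loop [1,3,0,3,3,1,2,0,2] 4)]],H 3539 1 (loop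
[1,3,3,1,2,0,2] 4),E,Z 1906 5 [Z 1149 7 [N 943 (3,[(2,[0,0,0,3,3,3,1,2,0,2],[-1]),j 3
[0,3,3,3,1,3,0,2,0,2]]) [H 716 2 [(3,[0,0,3,3,3,1,2,0,2],[1])]],E,H 708 8
[(1,[0,3,3,3,1,2,1,2,0,2],[2])]]]]]],N 6402 (13,[(1,[2,1,2,0,2],[2])]) [N 4574
(11,[(2,[0,0,2,2,0,2],[-1])]) [H 3473 2 [(3,[0,2,2,0,2],[1])],E,E,N 2910
(12,[(1,[2,1,3,0,2,0,2],[2])]) [E,E,E,Z 1566 14 [E,N 1136 (13,[j 1 [2,1,1,3,3,0,2,2,0]]) [E,E,H
744 8 [(0,[3,3,0,2,2,2,0,2],[-2])],H 686 4 [j 0 [3,3,0,2,0,3,1,2,0,2]]],E,H 801 4 [j 1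
[2,1,3,3,3,0,2,2,0]]]]],E,Z 3944 15 [N 2639 (11,[(2,[0,0,2,2,2,0,2],[-1])]) [H 2003 2
[(3,[0,2,2,2,0,2],[1])],E,E,Z 1429 14 [E,H 959 1 [(1,[2,1,2,1,3,0,2,0,2],[2,2])],E,H 825 4
[(1,[2,1,3,3,0,2,2,0,2],[2])]]],N 2890 (13,[(1,[2,1,2,1,2,0,2],[2,2])]) [E,E,Z 1419 10 [E,H 850 1
[(1,[2,1,1,2,2,1,2,0,2],[2,2])]],Z 1508 14 [E,N 1005 (13,[j 1 [2,1,1,3,1,2,2,2,0]]) [E,E,H 646 8
[(0,[3,1,2,2,2,2,0,2],[-2])],H 600 4 [j 0 [3,1,2,2,0,3,1,2,0,2]]],E,H 771 4 [j 1
[2,1,3,3,1,2,2,2,0]]]],Z 2087 11 [N 1324 (3,[(2,[0,0,2,2,2,2,0,2],[-1])]) [H 1005 2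
[(3,[0,2,2,2,2,0,2],[1])]],Z 1190 11 [E,H 899 1 [(1,[2,1,2,1,2,1,2,0,2],[2,2,2])],E,H 697 4
[(1,[2,1,3,1,2,2,2,0,2],[2])]]]]]],Z 5663 15 [N 3911 (11,[(2,[0,0,3,0,2],[-1])]) [H 2969 2
[(3,[0,3,0,2],[1])],E,E,Z 2300 14 [E,Z 1869 15 [E,H 1708 1 (loop [1,1,3,0,3,0,2] 4),N 1544
(14,[(0,[3,0,3,0,2,2],[-3])]) [E,Z 897 3 [E,H 819 1 (loop [1,1,2,1,3,0,3,0,2] 4)],Z 902 9 [H 833 2
[j 2 [0,0,2,2,1,3,0,2]]]],Z 1091 5 [H 1005 2 [j 2 [0,0,3,1,3,0,2]]]],E,Z 1336 6 [E,H 1221 1 (loop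
[1,3,3,0,3,0,2] 4)]]],Z 4691 15 [E,H 4287 1 (loop [1,1,3,0,2] 4),N 4087 (14,[(0,[3,0,2,2],[-3])])
[E,Z 2752 15 [E,H 2515 1 (loop [1,1,2,1,3,0,2] 4),N 1763 (14,[(0,[1,3,0,2,2,2],[-3,-3])]) [E,Z
1024 3 [E,H 936 1 (loop [1,1,2,1,2,1,3,0,2] 4)],Z 897 9 [H 601 2 [(0,[3,0,2,0,2,2,1,2],[-3])]]],Z
1416 5 [H 978 2 [(0,[3,0,2,0,3,1,2],[-3])]]],Z 2285 11 [N 1802 (3,[j 2 [0,0,2,2,1,2]]) [N 1294
(3,[(2,[0,0,0,2,2,1,3,0,2],[-1]),j 3 [0,2,2,1,3,0,3,0,2]]) [H 982 2
[(3,[0,0,2,2,1,3,0,2],[1])]]],Z 1182 11 [E,Z 687 3 [E,H 628 1 (loop [1,1,1,2,2,1,3,0,2] 4)],E,Z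
687 6 [E,H 628 1 (loop [1,3,1,2,2,1,3,0,2] 4)]]]],Z 2635 13 [N 2166 (3,[j 2 [0,0,3,1,2]]) [N 1558
(3,[(2,[0,0,0,3,1,3,0,2],[-1]),j 3 [0,3,1,3,0,3,0,2]]) [H 1183 2 [(3,[0,0,3,1,3,0,2],[1])]]],E,E,Z
1296 5 [H 780 2 [j 2 [0,0,3,3,1,2]]]]],E,Z 3897 15 [N 2678 (11,[(2,[0,0,3,3,0,2],[-1])]) [H 2033 2
[(3,[0,3,3,0,2],[1])],E,E,Z 1556 6 [E,H 1422 1 (loop [1,3,0,3,3,0,2] 4)]],H 3561 1 (loop
[1,3,3,0,2] 4),E,Z 1948 5 [N 1235 (3,[(2,[0,0,3,3,3,0,2],[-1])]) [H 937 2
[(3,[0,3,3,3,0,2],[1])]]]]]]"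

definition thompson_3 :: "(int \<times> jump list) trie" where
"thompson_3 = N 7044 (13,[(1,[2,1,2],[3])]) [Z 6526 15 [N 4871 (11,[(2,[0,0,0,2,2],[-1])]) [H 3698 2
[(3,[0,0,2,2],[1])],E,E,N 3391 (13,[j 1 [2,2,1,3,0,0]]) [Z 1667 10 [E,E,E,H 1001 4 [j 1
[2,2,1,3,0,3,0,0]]],E,E,H 1896 4 [(1,[2,1,3,3,0,0,2],[3])]]],E,Z 6479 15 [N 4737
(11,[(2,[0,0,2,0,2,2],[-1])]) [H 3596 2 [(3,[0,2,0,2,2],[1])],E,E,Z 3164 14 [E,N 2971 (13,[j 1
[2,2,1,1,3,0,2,0]]) [E,E,N 2231 (14,[(0,[3,0,2,2,0,2,2],[-2])]) [E,N 1470 (5,[j 1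
[2,2,1,1,2,1,3,0,2,0]]) [E,E,H 841 8 [(0,[1,3,0,2,2,2,0,2,2],[-2,-2])]],Z 1192 9 [H 909 2 [j 2
[0,0,2,2,1,2,0,2,2]]]],N 2037 (13,[(1,[2,1,3,1,3,0,2,0,2],[3])]) [H 1607 2 [j 2
[0,0,3,1,2,0,2,2]],E,E,Z 1097 5 [H 853 2 [j 2 [0,0,3,3,1,2,0,2,2]]]]],E,N 2082 (12,[j 1
[2,2,1,3,3,0,2,0]]) [E,E,E,H 1094 4 [(1,[2,1,3,3,3,0,2,0,2],[3])]]]],N 6537 (13,[j 1
[2,2,1,1,2,0]]) [E,E,N 5240 (14,[(0,[2,2,0,2,2],[-2])]) [E,N 4202 (13,[j 1 [2,2,1,1,2,1,2,0]])
[E,E,N 2677 (14,[(0,[1,2,2,2,0,2,2],[-2,-2])]) [E,N 1710 (5,[j 1 [2,2,1,1,2,1,2,1,2,0]]) [E,E,H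
906 8 [(0,[1,1,2,2,2,2,0,2,2],[-2,-2,-2])]],Z 1340 9 [H 853 2 [(0,[2,0,2,2,1,2,0,2,2],[-2])]]],N
2574 (13,[(1,[2,1,3,1,2,1,2,0,2],[3])]) [H 1678 2 [(0,[2,0,3,1,2,0,2,2],[-2])],E,E,Z 1289 5 [H 822
2 [(0,[2,0,3,3,1,2,0,2,2],[-2])]]]],Z 2657 11 [Z 1541 7 [N 1203
(3,[(2,[0,0,0,2,2,1,2,0,2,2],[-1]),j 3 [0,2,2,1,3,0,2,0,2,2]]) [H 913 2
[(3,[0,0,2,2,1,2,0,2,2],[1])]],E,H 908 8 [(1,[0,2,2,1,2,1,2,0,2,2],[2])]],Z 1440 11 [E,N 958 (5,[j
1 [2,2,1,1,1,2,2,1,2,0]]) [E,E,H 610 8 [(0,[1,2,1,2,2,2,0,2,2],[-2,-2])]],E,H 841 4 [j 1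
[2,2,1,3,1,2,2,1,2,0]]]]],N 4428 (13,[(1,[2,1,3,1,2,0,2],[3])]) [Z 2866 15 [N 2197
(3,[(2,[0,0,0,3,1,2,0,2,2],[-1]),j 3 [0,3,1,3,0,2,0,2,2]]) [H 1668 2
[(3,[0,0,3,1,2,0,2,2],[1])]],E,N 1847 (9,[(1,[0,3,1,2,1,2,0,2,2],[2])]) [N 1171
(3,[(2,[0,0,2,0,3,1,2,0,2,2],[-1])]) [H 889 2 [(3,[0,2,0,3,1,2,0,2,2],[1])]]],N 1716
(5,[(1,[2,1,3,0,3,1,2,0,2],[3])]) [N 1088 (3,[(2,[0,0,3,0,3,1,2,0,2,2],[-1])]) [H 826 2
[(3,[0,3,0,3,1,2,0,2,2],[1])]]]],E,E,Z 2586 15 [Z 1491 7 [N 1150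
(3,[(2,[0,0,0,3,3,1,2,0,2,2],[-1]),j 3 [0,3,3,1,3,0,2,0,2,2]]) [H 873 2
[(3,[0,0,3,3,1,2,0,2,2],[1])]],E,H 878 8 [(1,[0,3,3,1,2,1,2,0,2,2],[2])]],Z 1769 15 [E,H 1617 1
(loop [1,1,3,3,1,2,0,2,2] 4),H 1143 8 [(0,[3,3,1,2,0,2,2,2],[-3])],H 941 4 [j 0
[3,3,1,2,0,2,0,3,1,2]]],E,Z 1503 6 [E,H 1373 1 (loop [1,3,3,3,1,2,0,2,2] 4)]]]],N 5227
(13,[(1,[2,1,2,0,2,2],[2])]) [N 3696 (11,[(2,[0,0,2,2,0,2,2],[-1])]) [H 2806 2
[(3,[0,2,2,0,2,2],[1])],E,E,N 2297 (12,[(1,[2,1,3,0,2,0,2,2],[2])]) [E,E,E,Z 1181 6 [E,N 814 (5,[j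
1 [2,2,1,1,3,3,0,2,2,0]]) [E,E,H 550 8 [(0,[3,3,0,2,2,2,0,2,2],[-2])]]]]],E,Z 3162 15 [N 2106
(11,[(2,[0,0,2,2,2,0,2,2],[-1])]) [H 1599 2 [(3,[0,2,2,2,0,2,2],[1])],E,E,Z 1128 14 [E,H 747 1
[(1,[2,1,2,1,3,0,2,0,2,2],[2,2])],E,H 637 4 [(1,[2,1,3,3,0,2,2,0,2,2],[2])]]],N 2262
(13,[(1,[2,1,2,1,2,0,2,2],[2,2])]) [E,E,Z 1105 10 [E,H 651 1 [(1,[2,1,1,2,2,1,2,0,2,2],[2,2])]],Z
1095 6 [E,H 623 1 [j 1 [2,2,1,1,3,1,2,2,2,0]]]],Z 1643 11 [N 1042
(3,[(2,[0,0,2,2,2,2,0,2,2],[-1])]) [H 791 2 [(3,[0,2,2,2,2,0,2,2],[1])]],Z 881 3 [E,H 678 1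
[(1,[2,1,2,1,2,1,2,0,2,2],[2,2,2])]]]]]],N 4799 (13,[(1,[2,1,3,0,2],[3])]) [N 3251
(11,[(2,[0,0,3,0,2,2],[-1])]) [H 2468 2 [(3,[0,3,0,2,2],[1])],E,E,H 1820 4
[(1,[2,1,3,0,3,0,2],[3])]],E,E,Z 3192 15 [N 2137 (11,[(2,[0,0,3,3,0,2,2],[-1])]) [H 1622 2
[(3,[0,3,3,0,2,2],[1])],E,E,Z 1159 14 [E,Z 776 7 [E,H 709 1 (loop [1,1,3,0,3,3,0,2,2] 4),H 534 8
[(0,[3,0,3,3,0,2,2,2],[-3])]],E,Z 673 6 [E,H 615 1 (loop [1,3,3,0,3,3,0,2,2] 4)]]],Z 2272 15 [E,H
2076 1 (loop [1,1,3,3,0,2,2] 4),N 1604 (14,[(0,[3,3,0,2,2,2],[-3])]) [E,Z 932 3 [E,H 851 1 (loop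
[1,1,2,1,3,3,0,2,2] 4)],H 827 8 [j 0 [3,3,0,2,0,2,2,1,2]]],H 1203 4 [j 0 [3,3,0,2,0,3,1,2]]],E,Z
2138 7 [N 1469 (11,[(2,[0,0,3,3,3,0,2,2],[-1])]) [H 1115 2 [(3,[0,3,3,3,0,2,2],[1])],E,E,Z 853 6
[E,H 779 1 (loop [1,3,0,3,3,3,0,2,2] 4)]],H 1954 1 (loop [1,3,3,3,0,2,2] 4)]]]],E,Z 4628 15 [Z
3841 15 [N 2891 (11,[(2,[0,0,0,2,2,2],[-1])]) [H 2195 2 [(3,[0,0,2,2,2],[1])],E,E,N 2045 (13,[j 1
[2,2,2,1,3,0,0]]) [Z 1008 10 [E,E,E,H 610 4 [j 1 [2,2,2,1,3,0,3,0,0]]],E,E,Z 1011 6 [E,H 620 1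
[(1,[2,1,2,1,3,3,0,0,2],[3,3])]]]],E,Z 3702 15 [N 2693 (11,[(2,[0,0,2,0,2,2,2],[-1])]) [H 2044 2
[(3,[0,2,0,2,2,2],[1])],E,E,Z 1781 14 [E,N 1615 (13,[j 1 [2,2,2,1,1,3,0,2,0]]) [E,E,N 1155
(10,[(0,[3,0,2,2,0,2,2,2],[-2])]) [E,H 761 1 [j 1 [2,2,2,1,1,2,1,3,0,2,0]]],Z 875 5 [H 690 2 [j 2
[0,0,3,1,2,0,2,2,2]]]],E,H 1204 4 [j 1 [2,2,2,1,3,3,0,2,0]]]],N 3744 (13,[j 1 [2,2,2,1,1,2,0]])
[E,E,N 2887 (10,[(0,[2,2,0,2,2,2],[-2])]) [E,N 2311 (13,[j 1 [2,2,2,1,1,2,1,2,0]]) [E,E,N 1418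
(10,[(0,[1,2,2,2,0,2,2,2],[-2,-2])]) [E,H 916 1 [j 1 [2,2,2,1,1,2,1,2,1,2,0]]],Z 1149 5 [H 717 2
[(0,[2,0,3,1,2,0,2,2,2],[-2])]]]],Z 2131 15 [Z 1233 7 [N 944 (3,[(2,[0,0,0,3,1,2,0,2,2,2],[-1]),j
3 [0,3,1,3,0,2,0,2,2,2]]) [H 716 2 [(3,[0,0,3,1,2,0,2,2,2],[1])]],E,H 740 8
[(1,[0,3,1,2,1,2,0,2,2,2],[2])]],H 1355 1 [(1,[2,1,2,1,3,1,2,0,2],[3,3])],E,H 1243 4
[(1,[2,1,3,3,1,2,0,2,2],[3])]]],N 2879 (13,[(1,[2,1,2,0,2,2,2],[2])]) [N 2002
(11,[(2,[0,0,2,2,0,2,2,2],[-1])]) [H 1520 2 [(3,[0,2,2,0,2,2,2],[1])],E,E,H 1198 4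
[(1,[2,1,3,0,2,0,2,2,2],[2])]],E,Z 1642 11 [N 1042 (3,[(2,[0,0,2,2,2,0,2,2,2],[-1])]) [H 791 2
[(3,[0,2,2,2,0,2,2,2],[1])]],H 1161 1 [(1,[2,1,2,1,2,0,2,2,2],[2,2])]]]],Z 2433 15 [N 1543
(3,[(2,[0,0,3,0,2,2,2],[-1])]) [H 1171 2 [(3,[0,3,0,2,2,2],[1])]],H 1593 1
[(1,[2,1,2,1,3,0,2],[3,3])],E,N 1670 (5,[(1,[2,1,3,3,0,2,2],[3])]) [N 1130
(11,[(2,[0,0,3,3,0,2,2,2],[-1])]) [H 858 2 [(3,[0,3,3,0,2,2,2],[1])],E,E,H 631 4
[(1,[2,1,3,0,3,3,0,2,2],[3])]]]]],N 3031 (13,[(1,[2,1,2,1,2],[3,3])]) [E,E,Z 1476 10 [E,H 858 1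
[(1,[2,1,1,2,2,1,2],[3,3])]],Z 1633 14 [E,Z 1074 7 [E,H 981 1 (loop [1,1,3,1,2,2,2] 4),H 709 8
[(0,[3,1,2,2,2,2],[-3])]],E,Z 949 6 [E,H 867 1 (loop [1,3,3,1,2,2,2] 4)]]],Z 2532 11 [Z 1818 7 [N
1391 (11,[(2,[0,0,0,2,2,2,2],[-1])]) [H 1056 2 [(3,[0,0,2,2,2,2],[1])],E,E,H 1014 4 [j 1
[2,2,2,2,1,3,0,0]]],E,Z 1704 15 [N 1235 (11,[(2,[0,0,2,0,2,2,2,2],[-1])]) [H 937 2
[(3,[0,2,0,2,2,2,2],[1])],E,E,Z 812 14 [E,H 684 1 [j 1 [2,2,2,2,1,1,3,0,2,0]],E,H 594 4 [j 1
[2,2,2,2,1,3,3,0,2,0]]]],N 1779 (5,[j 1 [2,2,2,2,1,1,2,0]]) [E,E,N 1308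
(10,[(0,[2,2,0,2,2,2,2],[-2])]) [E,H 1044 1 [j 1 [2,2,2,2,1,1,2,1,2,0]]]],N 1224
(9,[(1,[2,1,2,0,2,2,2,2],[2])]) [N 776 (3,[(2,[0,0,2,2,0,2,2,2,2],[-1])]) [H 589 2
[(3,[0,2,2,0,2,2,2,2],[1])]]]]],Z 1388 11 [E,H 968 1 [(1,[2,1,2,1,2,1,2],[3,3,3])],E,H 796 4
[(1,[2,1,3,1,2,2,2],[3])]]]]]"

definition thompson_table :: "(int \<times> jump list) trie" where
"thompson_table = Z 7068 15 [Z 6693 15 [N 5035 (11,[(2,[0,0,0],[-1])]) [H 3822 2 [(3,[0,0],[1])],E,E,Z 3558 15 [Z
1790 10 [E,E,E,Z 1158 14 [E,Z 1122 15 [E,H 1025 1 (loop [1,1,3,0,3,0,0] 4),N 1160 (14,[j 0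
[3,0,3,0,0,2]]) [E,Z 848 7 [E,H 775 1 (loop [1,1,2,1,3,0,3,0,0] 4),H 690 8
[(0,[2,2,1,3,0,3,0,0],[-3])]],N 971 (12,[j 0 [3,0,3,0,0,2,2],(1,[2,1,2,1,3,0,3,0,0],[3])]) [E,E,H
600 8 [j 0 [3,0,3,0,0,2,2,2]]]],H 646 4 [j 0 [3,0,3,0,0,3]]],E,Z 673 6 [E,H 615 1 (loop
[1,3,3,0,3,0,0] 4)]]],Z 3720 15 [E,H 3400 1 (loop [1,1,3,0,0] 4),N 4128 (14,[j 0 [3,0,0,2]]) [E,Z
3362 15 [E,H 3073 1 (loop [1,1,2,1,3,0,0] 4),N 2983 (14,[(0,[2,2,1,3,0,0],[-3])]) [E,Z 2083 15
[E,H 1904 1 (loop [1,1,2,1,2,1,3,0,0] 4),N 1440 (14,[(0,[1,2,2,2,1,3,0,0],[-3,-3])]) [E,Z 837 3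
[E,H 765 1 (loop [1,1,2,1,2,1,2,1,3,0,0] 4)],Z 756 9 [H 553 2 [(0,[2,0,2,2,1,2,1,3,0,0],[-3])]]],Z
1077 5 [H 754 2 [(0,[2,0,3,1,2,1,3,0,0],[-3])]]],Z 1539 9 [N 1071 (6,[j 0 [3,0,0,0,2,2,1,2]])
[E,E,H 701 8 [j 0 [3,0,0,2,0,2,2,1,2],(1,[0,2,2,1,2,1,2,1,3,0,0],[3])]]]],Z 1765 5 [N 1289 (6,[j 0
[3,0,0,0,3,1,2]]) [E,E,H 909 8 [j 0 [3,0,0,2,0,3,1,2],(1,[0,3,1,2,1,2,1,3,0,0],[3])]]]],N 3618
(12,[j 0 [3,0,0,2,2],(1,[2,1,2,1,3,0,0],[3])]) [E,E,N 2359 (14,[j 0 [3,0,0,2,2,2]]) [E,H 1442 1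
[(1,[2,1,2,1,2,1,3,0,0],[3,3])],H 1280 8 [j 0 [3,0,0,2,2,2,2]]]]],N 2136 (12,[j 0 [3,0,0,3]])
[E,E,E,H 1144 4 [j 0 [3,0,0,3,3]]]],E,Z 2101 7 [Z 1023 10 [E,E,E,Z 594 6 [E,H 543 1 (loop
[1,3,0,3,3,0,0] 4)]],H 1920 1 (loop [1,3,3,0,0] 4)]]],E,thompson_1,Z 4638 15 [N 3188
(11,[(2,[0,0,3,0],[-1])]) [H 2420 2 [(3,[0,3,0],[1])],E,E,Z 1852 6 [E,H 1693 1 (loop [1,3,0,3,0]
4)]],H 4238 1 (loop [1,3,0] 4),E,Z 2366 13 [N 1501 (3,[(2,[0,0,3,3,0],[-1])]) [H 1139 2
[(3,[0,3,3,0],[1])]],E,E,Z 1183 5 [N 750 (3,[(2,[0,0,3,3,3,0],[-1])]) [H 569 2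
[(3,[0,3,3,3,0],[1])]]]]]],N 6483 (3,loop [1] 4) [E,Z 3008 13 [E,E,Z 1413 9 [Z 714 3 [H 469 2 [j 3
[0,2,1,3]]]],Z 1413 5 [Z 714 3 [H 469 2 [j 3 [0,3,1,3]]]]]],Z 7969 15 [thompson_2,Z 6582 15 [E,H
6014 1 (loop [1,1,2] 4),N 5911 (14,[(0,[2,2],[-3])]) [E,Z 4235 15 [E,H 3870 1 (loop [1,1,2,1,2]
4),N 3037 (14,[(0,[1,2,2,2],[-3,-3])]) [E,Z 1955 15 [E,H 1787 1 (loop [1,1,2,1,2,1,2] 4),N 1162
(10,[(0,[1,1,2,2,2,2],[-3,-3,-3])]) [E,Z 675 3 [E,H 617 1 (loop [1,1,2,1,2,1,2,1,2] 4)]],Z 962 5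
[H 580 2 [(0,[1,2,2,0,3,1,2],[-3,-3])]]],Z 1573 9 [H 1107 2 [(0,[2,0,2,2,1,2],[-3])]]],Z 2233 13
[N 1579 (6,[(0,[2,0,3,1,2],[-3])]) [E,E,Z 813 10 [E,H 563 1 [j 1 [3,1,1,2,2,1,2]]]],E,E,Z 1096 5
[H 654 2 [(0,[2,0,3,3,1,2],[-3])]]]],Z 3148 11 [Z 2097 7 [N 1998 (7,[j 3 [0,2,2,1,3,0,2]]) [N 1509
(11,[(2,[0,0,0,0,2,2,1,2],[-1])]) [H 1145 2 [(3,[0,0,0,2,2,1,2],[1])],E,E,H 1075 4 [j 1
[0,2,2,1,2,1,3,0,0],j 3 [0,2,2,1,3,3,0,0,2]]],E,Z 1694 15 [N 1075
(3,[(2,[0,0,2,0,0,2,2,1,2],[-1])]) [H 816 2 [(3,[0,2,0,0,2,2,1,2],[1])]],N 1764 (5,[j 1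
[0,2,2,1,2,1,1,2,0],j 3 [0,2,2,1,3,1,2,0,2]]) [E,E,N 1221 (10,[(0,[2,2,0,0,2,2,1,2],[-2])]) [E,H
829 1 [j 1 [0,2,2,1,2,1,1,2,1,2,0]]]],N 1185 (9,[(1,[2,1,2,0,0,2,2,1,2],[2])]) [N 752
(3,[(2,[0,0,2,2,0,0,2,2,1,2],[-1])]) [H 571 2 [(3,[0,2,2,0,0,2,2,1,2],[1])]]]]],E,N 1343
(9,[(1,[0,2,2,1,2,1,2],[3])]) [Z 953 15 [N 735 (11,[(2,[0,0,0,2,0,2,2,1,2],[-1])]) [H 558 2
[(3,[0,0,2,0,2,2,1,2],[1])],E,E,H 545 4 [j 1 [2,0,2,2,1,2,1,3,0,0]]],E,Z 621 10 [E,H 683 1 [j 1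
[2,0,2,2,1,2,1,1,2,0]]],N 688 (12,[(1,[0,2,2,1,2,1,3,0,2],[3])]) [E,E,E,H 575 4 [j 1
[2,2,1,3,3,0,2,2]]]]]],Z 1733 11 [E,Z 1207 15 [E,H 1103 1 (loop [1,1,1,2,2,1,2] 4),H 784 8
[(0,[1,2,1,2,2,2],[-3,-3])],H 672 4 [j 0 [1,2,0,3,1,2,1,2]]],E,Z 1007 6 [E,H 920 1 (loop
[1,3,1,2,2,1,2] 4)]]]],Z 3499 13 [Z 2536 7 [N 2509 (7,[j 3 [0,3,1,3,0,2]]) [N 1878
(11,[(2,[0,0,0,0,3,1,2],[-1])]) [H 1426 2 [(3,[0,0,0,3,1,2],[1])],E,E,H 1315 4 [j 1
[0,3,1,2,1,3,0,0],j 3 [0,3,1,3,3,0,0,2]]],E,Z 2337 15 [N 1659 (11,[(2,[0,0,2,0,0,3,1,2],[-1])]) [H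
1259 2 [(3,[0,2,0,0,3,1,2],[1])],E,E,Z 1042 14 [E,N 936 (5,[j 1 [0,3,1,2,1,1,3,0,2,0],j 3
[0,3,1,3,1,3,0,2,0,2]]) [E,E,H 616 8 [(0,[3,0,2,2,0,0,3,1,2],[-2])]],E,H 629 4 [j 1
[0,3,1,2,1,3,3,0,2,0]]]],N 2383 (5,[j 1 [0,3,1,2,1,1,2,0],j 3 [0,3,1,3,1,2,0,2]]) [E,E,N 1794
(10,[(0,[2,2,0,0,3,1,2],[-2])]) [E,N 1414 (5,[j 1 [0,3,1,2,1,1,2,1,2,0],j 3
[0,3,1,3,1,2,1,2,0,2]]) [E,E,H 780 8 [(0,[1,2,2,2,0,0,3,1,2],[-2,-2])]]]],N 1756
(13,[(1,[2,1,2,0,0,3,1,2],[2])]) [N 1200 (11,[(2,[0,0,2,2,0,0,3,1,2],[-1])]) [H 911 2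
[(3,[0,2,2,0,0,3,1,2],[1])],E,E,H 689 4 [(1,[2,1,3,0,2,0,0,3,1,2],[2])]],E,Z 910 10 [E,H 641 1
[(1,[2,1,2,1,2,0,0,3,1,2],[2,2])]]]]],E,N 1841 (13,[(1,[0,3,1,2,1,2],[3])]) [Z 1515 15 [N 1122
(11,[(2,[0,0,0,2,0,3,1,2],[-1])]) [H 851 2 [(3,[0,0,2,0,3,1,2],[1])],E,E,H 771 4 [j 1
[2,0,3,1,2,1,3,0,0]]],E,Z 1264 15 [N 801 (3,[(2,[0,0,2,0,2,0,3,1,2],[-1])]) [H 608 2
[(3,[0,2,0,2,0,3,1,2],[1])]],N 1353 (13,[j 1 [2,0,3,1,2,1,1,2,0]]) [E,E,N 909
(10,[(0,[2,2,0,2,0,3,1,2],[-2])]) [E,H 635 1 [j 1 [2,0,3,1,2,1,1,2,1,2,0]]],N 933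
(12,[(1,[0,3,1,2,1,3,1,2,0,2],[3])]) [E,E,E,H 711 4 [j 1 [3,1,3,3,1,2,0,2,2]]]],H 825 8
[(1,[2,1,2,0,2,0,3,1,2],[2])]],N 1160 (13,[(1,[0,3,1,2,1,3,0,2],[3])]) [N 735
(3,[(2,[0,0,3,0,2,0,3,1,2],[-1])]) [H 558 2 [(3,[0,3,0,2,0,3,1,2],[1])]],E,E,H 897 4 [j 1
[3,1,3,3,0,2,2]]]],E,Z 914 10 [E,H 567 1 [(1,[0,3,1,2,1,2,1,2],[3,3])]]]],E,E,Z 1708 5 [Z 1000 7
[N 759 (6,[j 3 [0,3,3,1,3,0,2]]) [E,E,Z 570 10 [E,H 744 1 [j 1 [0,3,3,1,2,1,1,2,0],j 3
[0,3,3,1,3,1,2,0,2]]]],E,H 627 8 [(1,[0,3,3,1,2,1,2],[3])]]]]],thompson_3],Z 3975 15 [Z 3107 15 [N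
2384 (11,[(2,[0,0,0,3],[-1])]) [H 1810 2 [(3,[0,0,3],[1])],E,E,N 1746 (5,[j 1 [3,1,3,0,0]]) [Z 883
10 [E,E,E,H 580 4 [j 1 [3,1,3,0,3,0,0]]]]],E,Z 3132 15 [N 2339 (11,[(2,[0,0,2,0,3],[-1])]) [H 1776
2 [(3,[0,2,0,3],[1])],E,E,Z 1629 14 [E,N 1555 (13,[j 1 [3,1,1,3,0,2,0]]) [E,E,N 1117
(10,[(0,[3,0,2,2,0,3],[-2])]) [E,H 809 1 [j 1 [3,1,1,2,1,3,0,2,0]]],Z 817 5 [H 597 2 [j 2
[0,0,3,1,2,0,3]]]],E,H 1146 4 [j 1 [3,1,3,3,0,2,0]]]],N 3188 (13,[j 1 [3,1,1,2,0]]) [E,E,N 2538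
(10,[(0,[2,2,0,3],[-2])]) [E,N 2166 (13,[j 1 [3,1,1,2,1,2,0]]) [E,E,N 1352
(10,[(0,[1,2,2,2,0,3],[-2,-2])]) [E,H 956 1 [j 1 [3,1,1,2,1,2,1,2,0]]],Z 1061 5 [H 629 2
[(0,[2,0,3,1,2,0,3],[-2])]]]],Z 1568 5 [Z 944 7 [N 756 (3,[(2,[0,0,0,3,1,2,0,3],[-1]),j 3
[0,3,1,3,0,2,0,3]]) [H 574 2 [(3,[0,0,3,1,2,0,3],[1])]],E,H 597 8 [(1,[0,3,1,2,1,2,0,3],[2])]]]],N
2499 (13,[(1,[2,1,2,0,3],[2])]) [N 1765 (11,[(2,[0,0,2,2,0,3],[-1])]) [H 1340 2
[(3,[0,2,2,0,3],[1])],E,E,H 1094 4 [(1,[2,1,3,0,2,0,3],[2])]],E,Z 1448 11 [N 918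
(3,[(2,[0,0,2,2,2,0,3],[-1])]) [H 697 2 [(3,[0,2,2,2,0,3],[1])]],H 1063 1
[(1,[2,1,2,1,2,0,3],[2,2])]]]],Z 1553 5 [N 984 (3,[(2,[0,0,3,0,3],[-1])]) [H 747 2
[(3,[0,3,0,3],[1])]]]],Z 1872 13 [E,E,Z 909 9 [H 523 2 [j 2 [0,0,2,1,1]]],Z 909 5 [H 523 2 [j 2
[0,0,3,1,1]]]],E,Z 2080 5 [Z 1504 7 [N 1169 (11,[(2,[0,0,0,3,3],[-1])]) [H 887 2
[(3,[0,0,3,3],[1])],E,E,H 878 4 [j 1 [3,3,1,3,0,0]]],E,Z 1405 15 [N 1048
(11,[(2,[0,0,2,0,3,3],[-1])]) [H 795 2 [(3,[0,2,0,3,3],[1])],E,E,Z 730 14 [E,H 654 1 [j 1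
[3,3,1,1,3,0,2,0]],E,H 557 4 [j 1 [3,3,1,3,3,0,2,0]]]],N 1493 (5,[j 1 [3,3,1,1,2,0]]) [E,E,N 1095
(10,[(0,[2,2,0,3,3],[-2])]) [E,H 948 1 [j 1 [3,3,1,1,2,1,2,0]]]],H 949 8
[(1,[2,1,2,0,3,3],[2])]]]]]]"

section \<open>Verification of the table for Thompson's group\<close>

definition "thompson_val t = look thompson_table (rev t)"

lemma thompson_entries: "chk (\<lambda>t f m. thompson_val t = f) [] thompson_table"
  by (rule chk_look) (simp add: thompson_val_def)

lemmas thompson_table_entries' [simp] = thompson_entries[unfolded thompson_table_def, simplified]

lemma thompson_3_entries: "chk (\<lambda>t f m. thompson_val t = f) [2,2] thompson_3" by simp

lemmas thompson_3_entries' [simp] = thompson_3_entries[unfolded thompson_3_def, simplified]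

lemma thompson_2_entries: "chk (\<lambda>t f m. thompson_val t = f) [0,2] thompson_2" by simp

lemmas thompson_2_entries' [simp] = thompson_2_entries[unfolded thompson_2_def, simplified]

lemma thompson_1_entries: "chk (\<lambda>t f m. thompson_val t = f) [2,0] thompson_1" by simp

lemmas thompson_1_entries' [simp] = thompson_1_entries[unfolded thompson_1_def, simplified]

text \<open>Here \<open>al = 50 / 23\<close>, with \<open>1150 = 50 * 23\<close>,
  \<open>1971 = 50\<^sup>2 - 23\<^sup>2\<close> and \<open>529 = 23\<^sup>2\<close>. Besides the
  inequalities, the simplifier evaluates the word procedure \<open>trivial_xword\<close> on every
  jump.\<close>

lemma thompson_1_ok [simp]: "chk (thompson_ok 1150 1971 529 thompson_val) [2,0] thompson_1"
  by (simp add: thompson_1_def thompson_ok_simps)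

lemma thompson_2_ok [simp]: "chk (thompson_ok 1150 1971 529 thompson_val) [0,2] thompson_2"
  by (simp add: thompson_2_def thompson_ok_simps)

lemma thompson_3_ok [simp]: "chk (thompson_ok 1150 1971 529 thompson_val) [2,2] thompson_3"
  by (simp add: thompson_3_def thompson_ok_simps)

lemma thompson_table_ok [simp]: "chk (thompson_ok 1150 1971 529 thompson_val) [] thompson_table"
  by (simp add: thompson_table_def thompson_ok_simps)

lemma rho_thompson_F:
  "ereal (50 / 23 + 3 / (50 / 23))
    \<le> rho thompson_F (gen_a thompson_relators) (gen_b thompson_relators)"
proof -
  have val: "(\<lambda>t. look thompson_table (rev t)) = thompson_val"
    by (simp add: thompson_val_def fun_eq_iff)
  have "look thompson_table [] \<noteq> 0" by (simp add: thompson_table_def)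
  moreover have "chk (thompson_ok (50 * 23) (50\<^sup>2 - 23\<^sup>2) (23\<^sup>2) thompson_val) [] thompson_table"
    using thompson_table_ok by simp
  ultimately show ?thesis
    using rho_thompson_ge[of 50 23 thompson_table] unfolding val by simp
qed

section \<open>Conclusion\<close>

lemma alpha_presented_ge:
  fixes s :: real
  assumes "ereal (s + 3 / s) \<le> rho (presented_group R) (gen_a R) (gen_b R)" and "1 \<le> s" "3 < s\<^sup>2"
  shows "ereal s \<le> alpha (presented_group R) (gen_a R) (gen_b R)"
proof -
  interpret group "presented_group R" by (rule group_presented_group)
  show ?thesis
    using assms by (intro alpha_ge_of_rho_ge) (simp_all add: gen_a_def gen_b_def pres_class_in_carrier)
qed

lemma rational_bounds:
  "ereal 2.5904 \<le> ereal (57 / 22)" "ereal 3.748522 \<le> ereal (57 / 22 + 3 / (57 / 22))"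
  "ereal 2.42579 \<le> ereal (131 / 54)" "ereal 3.66250 \<le> ereal (131 / 54 + 3 / (131 / 54))"
  "ereal 2.06357 \<le> ereal (97 / 47)" "ereal 3.51736 \<le> ereal (97 / 47 + 3 / (97 / 47))"
  "ereal 2.17329 \<le> ereal (50 / 23)" "ereal 3.55368 \<le> ereal (50 / 23 + 3 / (50 / 23))"
  by simp_all

theorem theorem7:
  shows
    "(alpha (BS 2 2) (gen_a (BS_relators 2 2)) (gen_b (BS_relators 2 2)) \<ge> ereal 2.5904 \<and>
      alpha (BS 2 3) (gen_a (BS_relators 2 3)) (gen_b (BS_relators 2 3)) \<ge> ereal 2.42579 \<and>
      alpha (BS 3 5) (gen_a (BS_relators 3 5)) (gen_b (BS_relators 3 5)) \<ge> ereal 2.06357 \<and>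
      alpha thompson_F (gen_a thompson_relators) (gen_b thompson_relators) \<ge> ereal 2.17329) \<and>
     (rho (BS 2 2) (gen_a (BS_relators 2 2)) (gen_b (BS_relators 2 2)) \<ge> ereal 3.748522 \<and>
      rho (BS 2 3) (gen_a (BS_relators 2 3)) (gen_b (BS_relators 2 3)) \<ge> ereal 3.66250 \<and>
      rho (BS 3 5) (gen_a (BS_relators 3 5)) (gen_b (BS_relators 3 5)) \<ge> ereal 3.51736 \<and>
      rho thompson_F (gen_a thompson_relators) (gen_b thompson_relators) \<ge> ereal 3.55368)"
proof -
  note rhos = rho_BS_2_2 rho_BS_2_3 rho_BS_3_5 rho_thompson_F
  have "ereal (57 / 22) \<le> alpha (BS 2 2) (gen_a (BS_relators 2 2)) (gen_b (BS_relators 2 2))"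
    unfolding BS_def
    by (rule alpha_presented_ge[OF rho_BS_2_2[unfolded BS_def]]) (simp_all add: power2_eq_square)
  moreover have "ereal (131 / 54) \<le> alpha (BS 2 3) (gen_a (BS_relators 2 3)) (gen_b (BS_relators 2 3))"
    unfolding BS_def
    by (rule alpha_presented_ge[OF rho_BS_2_3[unfolded BS_def]]) (simp_all add: power2_eq_square)
  moreover have "ereal (97 / 47) \<le> alpha (BS 3 5) (gen_a (BS_relators 3 5)) (gen_b (BS_relators 3 5))"
    unfolding BS_def
    by (rule alpha_presented_ge[OF rho_BS_3_5[unfolded BS_def]]) (simp_all add: power2_eq_square)
  moreover have "ereal (50 / 23) \<le> alpha thompson_F (gen_a thompson_relators) (gen_b thompson_relators)"
    unfolding thompson_F_def
    by (rule alpha_presented_ge[OF rho_thompson_F[unfolded thompson_F_def]])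
      (simp_all add: power2_eq_square)
  ultimately show ?thesis
    using rhos rational_bounds by (meson order_trans)
qed

end
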